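(* Let $g \ge 2$ and $k \ge 2$ be integers, let $d = \binom{k}{2}(g-1)$, and let $D_1, D_2 > 0$ be constants as described in the context. Suppose that $0<\delta < \frac{8}{5} g^{-k-3}k^{-2}$, and let $t$ be a positive integer multiple of $g$ such that $t < 2 (d \delta)^{-3}$. If $g$ is odd, or if $g$ and $t/g$ are both even, then \[ \mathbb{P}(X_t = \vec 0) \leq \frac{g^{\frac{g}{2} \binom{k}{2} + \binom{k-1}{2}}}{\sqrt{(2 \pi t)^{d}}} U(g , k, t, \delta) + \exp \left({- \tfrac{11}{192} g^{-k} t \delta^2} \right)\] and \[ \mathbb{P}(X_t = \vec 0) \geq\frac{g^{\frac{g}{2} \binom{k}{2} + \binom{k-1}{2}}}{\sqrt{(2 \pi t)^{d}}} L(g , k, t, \delta) - \exp \left({- \tfrac{11}{192} g^{-k} t \delta^2}\right),\] where \[ L(g, k, t, \delta) = [1 + t^2(d \delta)^6]^{-1/2} \left[ 1 - \tfrac{1}{3}(d \delta)^4 \right]^t [1 - e^{-\frac{t}{2} (D_1\delta)^2}]^{d/2},\] \[ U(g, k, t, \delta) = \left[ 1 + \tfrac{1}{4}(d \delta)^6 \right]^{t/2} \left[ 1 + \tfrac{1}{3} ( d \delta)^4 \right]^t [1 - e^{- t (D_2 \delta)^2}]^{d/2}.\]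
   Context: Let $\mathbb Z_g$ be the integers mod $g$ and $d=\binom{k}{2}(g-1)$. Index the coordinates of $\mathbb R^d$ by pairs $(\{i,j\},a)$ with $1\le i<j\le k$ and $a\in\mathbb Z_g\setminus\{0\}$. Define $Z:(\mathbb Z_g)^k\to\mathbb R^d$ by $[Z(\vec x)]_{\{i,j\},a}=1-1/g$ if $x_i-x_j=a$ and $-1/g$ otherwise. Let $X_t=Z(\vec x_1)+\dots+Z(\vec x_t)$ where $\vec x_1,\vec x_2,\dots$ are independent and uniformly distributed on $(\mathbb Z_g)^k$ (a random walk on $\mathbb R^d$ started at $\vec 0$). Let $M$ be the $d\times d$ matrix indexed like $\mathbb R^d$ with $M_{(\{i,j\},a),(\{m,n\},b)}=\frac{g-1}{g^2}$ if $\{i,j\}=\{m,n\}$ and $a=b$, $-\frac{1}{g^2}$ if $\{i,j\}=\{m,n\}$ and $a\ne b$, and $0$ if $\{i,j\}\ne\{m,n\}$. The constants $D_1,D_2>0$ depend only on $g$ and have the property that there is a symmetric matrix $P$ with $P^2=M$ such that for all $\delta>0$, $[-D_1\delta,D_1\delta]^d\subset P[-\delta,\delta]^d\subset[-D_2\delta,D_2\delta]^d$, where $P[-\delta,\delta]^d=\{P\vec\mu:\vec\mu\in[-\delta,\delta]^d\}$ (such constants exist). *)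

theory Defs
  imports "HOL-Probability.Probability"
begin

type_synonym idx = "(nat \<times> nat) \<times> nat"

text \<open>Coordinate index set: pairs (i,j) with 1 <= i < j <= k and a in Z_g minus 0,
  a represented by 1..g-1.\<close>
definition coord_idx :: "nat \<Rightarrow> nat \<Rightarrow> idx set" where
  "coord_idx g k = {((i,j),a). 1 \<le> i \<and> i < j \<and> j \<le> k \<and> 1 \<le> a \<and> a \<le> g - 1}"

definition Zgk :: "nat \<Rightarrow> nat \<Rightarrow> (nat \<Rightarrow> nat) set" where
  "Zgk g k = PiE {1..k} (\<lambda>_. {0..<g})"

definition Zmap :: "nat \<Rightarrow> nat \<Rightarrow> (nat \<Rightarrow> nat) \<Rightarrow> idx \<Rightarrow> real" where
  "Zmap g k x c = (if c \<in> coord_idx g k then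
      (case c of ((i,j),a) \<Rightarrow>
         if (int (x i) - int (x j)) mod int g = int a then 1 - 1 / real g else - 1 / real g)
    else 0)"

definition step_pmf :: "nat \<Rightarrow> nat \<Rightarrow> (nat \<Rightarrow> nat) pmf" where
  "step_pmf g k = pmf_of_set (Zgk g k)"

definition walk_pmf :: "nat \<Rightarrow> nat \<Rightarrow> nat \<Rightarrow> (idx \<Rightarrow> real) pmf" where
  "walk_pmf g k t = map_pmf (\<lambda>\<omega> c. \<Sum>s<t. Zmap g k (\<omega> s) c)
      (Pi_pmf {..<t} undefined (\<lambda>_. step_pmf g k))"

definition Mmat :: "nat \<Rightarrow> idx \<Rightarrow> idx \<Rightarrow> real" where
  "Mmat g c c' = (if fst c = fst c' then
       (if snd c = snd c' then (real g - 1) / (real g)^2 else - 1 / (real g)^2) else 0)"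

definition good_consts :: "nat \<Rightarrow> nat \<Rightarrow> real \<Rightarrow> real \<Rightarrow> bool" where
  "good_consts g k D1 D2 \<longleftrightarrow> D1 > 0 \<and> D2 > 0 \<and>
    (\<exists>P :: idx \<Rightarrow> idx \<Rightarrow> real.
      (\<forall>c\<in>coord_idx g k. \<forall>c'\<in>coord_idx g k. P c c' = P c' c) \<and>
      (\<forall>c\<in>coord_idx g k. \<forall>c'\<in>coord_idx g k.
          (\<Sum>e\<in>coord_idx g k. P c e * P e c') = Mmat g c c') \<and>
      (\<forall>\<delta>>0.
        (\<forall>v. (\<forall>c\<in>coord_idx g k. \<bar>v c\<bar> \<le> D1 * \<delta>) \<longrightarrow>
           (\<exists>\<mu>. (\<forall>c\<in>coord_idx g k. \<bar>\<mu> c\<bar> \<le> \<delta>) \<and>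
                 (\<forall>c\<in>coord_idx g k. v c = (\<Sum>e\<in>coord_idx g k. P c e * \<mu> e)))) \<and>
        (\<forall>\<mu>. (\<forall>c\<in>coord_idx g k. \<bar>\<mu> c\<bar> \<le> \<delta>) \<longrightarrow>
           (\<forall>c\<in>coord_idx g k. \<bar>\<Sum>e\<in>coord_idx g k. P c e * \<mu> e\<bar> \<le> D2 * \<delta>))))"

definition Lfun :: "real \<Rightarrow> real \<Rightarrow> nat \<Rightarrow> real \<Rightarrow> real" where
  "Lfun d D1 t \<delta> = (1 + (real t)^2 * (d*\<delta>)^6) powr (-1/2) * (1 - (d*\<delta>)^4 / 3) ^ t
      * (1 - exp (- (real t/2) * (D1*\<delta>)^2)) powr (d/2)"

definition Ufun :: "real \<Rightarrow> real \<Rightarrow> nat \<Rightarrow> real \<Rightarrow> real" where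
  "Ufun d D2 t \<delta> = (1 + (d*\<delta>)^6 / 4) powr (real t/2) * (1 + (d*\<delta>)^4 / 3) ^ t
      * (1 - exp (- real t * (D2*\<delta>)^2)) powr (d/2)"

end

theory Submission
  imports Defs "HOL-Number_Theory.Cong"
begin

text \<open>
  By Fourier inversion \<open>(2 \<pi>)\<^sup>d P(X\<^sub>t = 0)\<close> is the integral of \<open>\<phi>\<^sup>t\<close> over a torus, \<open>\<phi>\<close> being the
  characteristic function of a step. There are exactly \<open>g ^ binom(k - 1, 2)\<close> points where \<open>|\<phi>| = 1\<close>, namely
  tuples of characters \<open>a \<mapsto> 2 \<pi> c\<^sub>i\<^sub>j a / g\<close> of \<open>\<int>\<^sub>g\<close> with \<open>\<Sum> c\<^sub>i\<^sub>j (x\<^sub>i - x\<^sub>j) \<equiv> 0\<close>, and translating by one of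
  them leaves \<open>\<phi>\<^sup>t\<close> unchanged. Outside the cubes of radius \<open>\<delta>\<close> around them two summands of \<open>\<phi>\<close> must have
  phases differing by more than \<open>\<delta> / 2\<close> modulo \<open>2 \<pi>\<close>: otherwise mixed differences of the phase make every
  coordinate function an approximate homomorphism on \<open>\<int>\<^sub>g\<close>, which is uniformly close to a character. This
  yields the exponential error term. In the cube around \<open>0\<close>, \<open>\<phi>\<close> is compared with
  \<open>exp (- \<lambda>\<^sup>T M \<lambda> / 2)\<close>, and the resulting Gaussian integral is evaluated by the substitution
  \<open>\<mu> = P \<lambda>\<close> together with bounds for the square of a truncated one-dimensional Gaussian integral.
\<close>

section \<open>Truncated Gaussian integrals\<close>

text \<open>The radius of the cubes dictates how the outer region is treated: a threshold of
  \<open>\<delta> / 2\<close> on phase differences has to yield characters within exactly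
  \<open>\<delta>\<close>. A mixed difference consists of two phase differences, so its error is
  \<open>\<delta>\<close>; averaging the defect keeps that error uniform over the residues, whereas
  an induction over the residue would multiply it. The coefficient vectors form the cycle space
  modulo \<open>g\<close> of the complete graph on \<open>k\<close> vertices, whose rank binom(k, 2)
  - (k - 1) = binom(k - 1, 2) explains their number. Translation by such a point is not quite a
  symmetry of the characteristic function: the centring \<open>- 1 / g\<close> of the steps leaves a
  constant phase, and the parity assumption makes its t-th power trivial. The bound on
  \<open>t\<close> keeps the argument of \<open>phi ^ t\<close> in a range where its cosine is
  positive. The exponents \<open>d / 2\<close> appear because it is the square of a truncated
  Gaussian integral that has elementary bounds. The factor
  \<open>g powr (g / 2 * binom(k, 2))\<close> is one over the absolute determinant of
  \<open>P\<close>, each of the binom(k, 2) blocks of \<open>Mmat\<close> having determinant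
  \<open>g powr (- g)\<close>.\<close>

lemma gaussian_integral_nn:
  fixes a b :: real
  assumes "a > 0"
  shows "(\<integral>\<^sup>+y. ennreal (exp (- a * y\<^sup>2 / 2 + b * y)) \<partial>lborel) = ennreal (sqrt (2 * pi / a) * exp (b\<^sup>2 / (2 * a)))"
proof -
  \<comment> \<open>Completing the square: the integrand is a multiple of the normal density with
    mean \<open>b / a\<close> and variance \<open>1 / a\<close>.\<close>
  have eq: "exp (- a * y\<^sup>2 / 2 + b * y)
      = sqrt (2 * pi / a) * exp (b\<^sup>2 / (2 * a)) * normal_density (b / a) (1 / sqrt a) y" for y
  proof -
    have "- ((y - b / a)\<^sup>2 / (2 * (1 / sqrt a)\<^sup>2)) + b\<^sup>2 / (2 * a) = - a * y\<^sup>2 / 2 + b * y"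
      using assms by (simp add: field_simps power2_eq_square)
    moreover have "sqrt (2 * pi / a) / sqrt (2 * pi * (1 / sqrt a)\<^sup>2) = 1"
      using assms by (simp add: power_divide)
    ultimately show ?thesis
      by (simp add: normal_density_def mult_exp_exp add.commute)
  qed
  interpret N: prob_space "density lborel (normal_density (b / a) (1 / sqrt a))"
    using assms by (intro prob_space_normal_density) auto
  have 1: "(\<integral>\<^sup>+y. ennreal (normal_density (b / a) (1 / sqrt a) y) \<partial>lborel) = 1"
    using N.emeasure_space_1 by (simp add: emeasure_density)
  show ?thesis
    unfolding eq using 1 assms by (subst ennreal_mult) (auto simp: nn_integral_cmult)
qed

lemma has_integral_arctan_deriv: "((\<lambda>s. 1 / (1 + s\<^sup>2)) has_integral (pi / 4)) {0..1::real}"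
proof -
  have "((\<lambda>s. 1 / (1 + s\<^sup>2)) has_integral (arctan 1 - arctan 0)) {0..1}"
    by (intro fundamental_theorem_of_calculus)
       (auto simp: has_real_derivative_iff_has_vector_derivative[symmetric] inverse_eq_divide
         intro!: derivative_eq_intros)
  thus ?thesis by (simp add: arctan_one)
qed

text \<open>A replacement for polar coordinates: under differentiation in \<open>R\<close> the
  square contributes \<open>2 * exp (- R^2)\<close> times the Gaussian integral and the parameter
  integral contributes its negative, so the sum keeps its value at \<open>R = 0\<close>, which is
  the arctangent of 1.\<close>

lemma gauss_square_identity:
  fixes R :: real
  assumes "R \<ge> 0"
  shows "(integral {0..R} (\<lambda>x. exp (- x\<^sup>2)))\<^sup>2
     + integral {0..1} (\<lambda>s. exp (- R\<^sup>2 * (1 + s\<^sup>2)) / (1 + s\<^sup>2)) = pi / 4"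
proof -
  define G where "G = (\<lambda>R. integral {0..R} (\<lambda>x. exp (- x\<^sup>2 :: real)))"
  define K where "K = (\<lambda>R. integral {0..1} (\<lambda>s. exp (- R\<^sup>2 * (1 + s\<^sup>2)) / (1 + s\<^sup>2 :: real)))"
  define U where "U = {0..R}"
  have nz: "1 + s\<^sup>2 \<noteq> (0::real)" for s by (smt (verit) zero_le_power2)
  have G': "(G has_field_derivative exp (- r\<^sup>2)) (at r within U)" if "r \<in> U" for r
    unfolding G_def U_def using that
    by (intro integral_has_real_derivative continuous_intros) (auto simp: U_def)
  have K': "(K has_field_derivative (- 2 * exp (- r\<^sup>2) * G r)) (at r within U)" if r: "r \<in> U" for r
  proof -
    have "((\<lambda>r. integral (cbox 0 1) (\<lambda>s. exp (- r\<^sup>2 * (1 + s\<^sup>2)) / (1 + s\<^sup>2)))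
        has_field_derivative integral (cbox 0 1) (\<lambda>s. - 2 * r * exp (- r\<^sup>2 * (1 + s\<^sup>2)))) (at r within U)"
      using r nz
      by (intro leibniz_rule_field_derivative)
         (auto simp: U_def split_beta intro!: derivative_eq_intros integrable_continuous_real continuous_intros)
    \<comment> \<open>The factor \<open>exp (- r^2)\<close> splits off, and the rest becomes the
      Gaussian integral under the substitution \<open>x = r * s\<close>.\<close>
    moreover have "integral {0..1} (\<lambda>s. - 2 * r * exp (- r\<^sup>2 * (1 + s\<^sup>2))) = - 2 * exp (- r\<^sup>2) * G r"
    proof -
      have r0: "0 \<le> r" using r by (auto simp: U_def)
      have "((\<lambda>s. r *\<^sub>R exp (- (r * s)\<^sup>2)) has_integral (integral {r * 0..r * 1} (\<lambda>x. exp (- x\<^sup>2)) - integral {r * 1..r * 0} (\<lambda>x. exp (- x\<^sup>2)))) {0..1}"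
        using r0
        by (intro has_integral_substitution_general[where s="{}" and c=0 and d=r])
           (auto intro!: derivative_eq_intros continuous_intros mult_left_le)
      moreover have "integral {r * 1..r * 0} (\<lambda>x. exp (- x\<^sup>2)) = 0"
        using r0 by (cases "r = 0") auto
      ultimately have "((\<lambda>s. r * exp (- (r * s)\<^sup>2)) has_integral G r) {0..1}"
        by (simp add: G_def)
      from has_integral_mult_right[OF this, of "- 2 * exp (- r\<^sup>2)"]
      have "((\<lambda>s. - 2 * r * exp (- r\<^sup>2 * (1 + s\<^sup>2))) has_integral - 2 * exp (- r\<^sup>2) * G r) {0..1}"
        by (rule has_integral_eq[rotated])
           (auto simp: algebra_simps power_mult_distrib exp_add[symmetric] mult_exp_exp)
      thus ?thesis by (rule integral_unique)
    qed
    ultimately show ?thesis by (simp only: K_def box_real)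
  qed
  have "\<exists>c. \<forall>x\<in>U. (G x)\<^sup>2 + K x = c"
  proof (rule has_field_derivative_zero_constant)
    show "convex U" by (simp add: U_def)
    fix x assume "x \<in> U"
    show "((\<lambda>x. (G x)\<^sup>2 + K x) has_field_derivative 0) (at x within U)"
      using G'[OF \<open>x \<in> U\<close>] K'[OF \<open>x \<in> U\<close>] by (auto intro!: derivative_eq_intros)
  qed
  hence "(G R)\<^sup>2 + K R = (G 0)\<^sup>2 + K 0"
    using assms by (auto simp: U_def)
  also have "\<dots> = pi / 4"
    using has_integral_arctan_deriv by (simp add: G_def K_def integral_unique)
  finally show ?thesis by (simp add: G_def K_def)
qed

text \<open>On \<open>{0..1}\<close> the factor \<open>1 + s^2\<close> lies between 1 and 2.
  Geometrically, the square of side \<open>R\<close> lies between the quarter discs of radii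
  \<open>R\<close> and \<open>R * sqrt 2\<close>; this gap is the source of the different exponents
  \<open>t / 2\<close> and \<open>t\<close> in \<open>Lfun\<close> and \<open>Ufun\<close>.\<close>

lemma gauss_square_bounds:
  fixes R :: real
  assumes "R \<ge> 0"
  shows "(integral {0..R} (\<lambda>x. exp (- x\<^sup>2)))\<^sup>2 \<le> pi / 4 * (1 - exp (- 2 * R\<^sup>2))"
    and "(integral {0..R} (\<lambda>x. exp (- x\<^sup>2)))\<^sup>2 \<ge> pi / 4 * (1 - exp (- R\<^sup>2))"
proof -
  have nz: "1 + s\<^sup>2 \<noteq> (0::real)" for s by (smt (verit) zero_le_power2)
  note A = has_integral_arctan_deriv
  have B: "((\<lambda>s. exp (- R\<^sup>2 * (1 + s\<^sup>2)) / (1 + s\<^sup>2)) has_integral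
      (integral {0..1} (\<lambda>s. exp (- R\<^sup>2 * (1 + s\<^sup>2)) / (1 + s\<^sup>2)))) {0..1}"
    using nz by (intro integrable_integral integrable_continuous_real continuous_intros) auto
  have 1: "exp (- 2 * R\<^sup>2) * (pi / 4) \<le> integral {0..1} (\<lambda>s. exp (- R\<^sup>2 * (1 + s\<^sup>2)) / (1 + s\<^sup>2))"
  proof (rule has_integral_le[OF has_integral_mult_right[OF A] B])
    fix s :: real assume s: "s \<in> {0..1}"
    hence "s\<^sup>2 \<le> 1" by (simp add: power_le_one)
    hence "R\<^sup>2 * (1 + s\<^sup>2) \<le> R\<^sup>2 * 2" by (intro mult_left_mono) auto
    thus "exp (- 2 * R\<^sup>2) * (1 / (1 + s\<^sup>2)) \<le> exp (- R\<^sup>2 * (1 + s\<^sup>2)) / (1 + s\<^sup>2)"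
      by (simp add: divide_right_mono add_nonneg_nonneg)
  qed
  have 2: "integral {0..1} (\<lambda>s. exp (- R\<^sup>2 * (1 + s\<^sup>2)) / (1 + s\<^sup>2)) \<le> exp (- R\<^sup>2) * (pi / 4)"
  proof (rule has_integral_le[OF B has_integral_mult_right[OF A]])
    fix s :: real assume s: "s \<in> {0..1}"
    have "R\<^sup>2 * 1 \<le> R\<^sup>2 * (1 + s\<^sup>2)" by (intro mult_left_mono) auto
    thus "exp (- R\<^sup>2 * (1 + s\<^sup>2)) / (1 + s\<^sup>2) \<le> exp (- R\<^sup>2) * (1 / (1 + s\<^sup>2))"
      by (simp add: divide_right_mono add_nonneg_nonneg)
  qed
  from 1 2 gauss_square_identity[OF assms]
  show "(integral {0..R} (\<lambda>x. exp (- x\<^sup>2)))\<^sup>2 \<le> pi / 4 * (1 - exp (- 2 * R\<^sup>2))"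
    and "(integral {0..R} (\<lambda>x. exp (- x\<^sup>2)))\<^sup>2 \<ge> pi / 4 * (1 - exp (- R\<^sup>2))"
    by (auto simp: algebra_simps)
qed

text \<open>Rescaling by \<open>sqrt (t / 2)\<close> and reflection. The bounds concern the square
  of \<open>j\<close> because that is what the comparison with discs provides.\<close>

lemma gauss_truncated:
  fixes t R :: real
  assumes "t > 0" "R > 0"
  obtains j where "j \<ge> 0" "(\<integral>\<^sup>+y. ennreal (indicator {-R..R} y * exp (- t * y\<^sup>2 / 2)) \<partial>lborel) = ennreal j"
    "j\<^sup>2 \<le> 2 * pi / t * (1 - exp (- t * R\<^sup>2))" "j\<^sup>2 \<ge> 2 * pi / t * (1 - exp (- t / 2 * R\<^sup>2))"
proof -
  define c where "c = sqrt (t / 2)"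
  have c: "c > 0" "c\<^sup>2 = t / 2" using assms by (auto simp: c_def)
  define G where "G = integral {0..c * R} (\<lambda>x. exp (- x\<^sup>2 :: real))"
  have G0: "G \<ge> 0" unfolding G_def by (intro integral_nonneg integrable_continuous_real continuous_intros) auto
  have "((\<lambda>x. exp (- x\<^sup>2)) has_integral G) {0..c * R}"
    unfolding G_def by (intro integrable_integral integrable_continuous_real continuous_intros)
  from has_integral_stretch_real[OF this, of c]
  have "((\<lambda>x. exp (- (c * x)\<^sup>2)) has_integral G / c) {0..R}"
    using c(1) assms by (simp add: field_simps)
  hence 1: "((\<lambda>x. exp (- t * x\<^sup>2 / 2)) has_integral G / c) {0..R}"
    using c by (simp add: power_mult_distrib)
  hence "((\<lambda>x. exp (- t * x\<^sup>2 / 2)) has_integral G / c) {- R..0}"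
    using has_integral_reflect_real[where f="\<lambda>x. exp (- t * x\<^sup>2 / 2)" and a=0 and b=R] by simp
  from has_integral_combine[OF _ _ this 1] assms
  have "((\<lambda>x. exp (- t * x\<^sup>2 / 2)) has_integral (2 * (G / c))) {- R..R}" by simp
  from nn_integral_has_integral_lebesgue[OF _ this]
  have I: "(\<integral>\<^sup>+y. ennreal (indicator {-R..R} y * exp (- t * y\<^sup>2 / 2)) \<partial>lborel) = ennreal (2 * (G / c))"
    by simp
  have sq: "(2 * (G / c))\<^sup>2 = 8 / t * G\<^sup>2" using c assms by (simp add: power_divide power_mult_distrib field_simps)
  have e: "- 2 * (c * R)\<^sup>2 = - t * R\<^sup>2" "- (c * R)\<^sup>2 = - t / 2 * R\<^sup>2" using c by (auto simp: power_mult_distrib)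
  have t8: "8 / t \<ge> 0" using assms by simp
  show ?thesis
  proof (rule that[OF _ I])
    show "0 \<le> 2 * (G / c)" using G0 c by simp
    show "(2 * (G / c))\<^sup>2 \<le> 2 * pi / t * (1 - exp (- t * R\<^sup>2))"
      using mult_left_mono[OF gauss_square_bounds(1)[of "c * R"] t8] c assms
      unfolding sq e by (simp add: G_def field_simps)
    show "(2 * (G / c))\<^sup>2 \<ge> 2 * pi / t * (1 - exp (- t / 2 * R\<^sup>2))"
      using mult_left_mono[OF gauss_square_bounds(2)[of "c * R"] t8] c assms
      unfolding sq e by (simp add: G_def field_simps)
  qed
qed

section \<open>Linear substitutions in product Lebesgue measure\<close>

interpretation lebesgue_prod: product_sigma_finite "\<lambda>_ :: 'i. lborel :: real measure"
  by standard

lemma distr_PiM_lborel_shift: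
  fixes v :: "'i \<Rightarrow> real"
  assumes I: "finite I"
  shows "distr (PiM I (\<lambda>_. lborel)) (PiM I (\<lambda>_. lborel)) (\<lambda>x. \<lambda>i\<in>I. x i + v i) = PiM I (\<lambda>_. lborel)"
proof (rule lebesgue_prod.PiM_eqI[OF I])
  fix A :: "'i \<Rightarrow> real set" assume A: "\<And>i. i \<in> I \<Longrightarrow> A i \<in> sets lborel"
  have A': "(\<lambda>x. x + v i) -` A i \<in> sets lborel" if "i \<in> I" for i
    using A[OF that] by (auto intro: measurable_sets_borel[rotated])
  have "emeasure (distr (PiM I (\<lambda>_. lborel)) (PiM I (\<lambda>_. lborel)) (\<lambda>x. \<lambda>i\<in>I. x i + v i)) (Pi\<^sub>E I A)
     = emeasure (PiM I (\<lambda>_. lborel)) (Pi\<^sub>E I (\<lambda>i. (\<lambda>x. x + v i) -` A i))"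
    using A I by (subst emeasure_distr)
      (auto simp: space_PiM PiE_iff extensional_def intro!: arg_cong2[where f=emeasure] sets_PiM_I_finite)
  also have "\<dots> = (\<Prod>i\<in>I. emeasure lborel ((\<lambda>x. x + v i) -` A i))"
    using A' I by (subst lebesgue_prod.emeasure_PiM) auto
  also have "\<dots> = (\<Prod>i\<in>I. emeasure lborel (A i))"
  proof (rule prod.cong[OF refl])
    fix i assume i: "i \<in> I"
    have "emeasure lborel (A i) = emeasure (distr lborel borel ((+) (v i))) (A i)"
      by (simp add: lborel_distr_plus)
    also have "\<dots> = emeasure lborel ((\<lambda>x. x + v i) -` A i)"
      using A[OF i] by (subst emeasure_distr) (auto simp: add.commute[of "v i"] intro!: arg_cong2[where f=emeasure])
    finally show "emeasure lborel ((\<lambda>x. x + v i) -` A i) = emeasure lborel (A i)" ..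
  qed
  finally show "emeasure (distr (PiM I (\<lambda>_. lborel)) (PiM I (\<lambda>_. lborel)) (\<lambda>x. \<lambda>i\<in>I. x i + v i)) (Pi\<^sub>E I A)
     = (\<Prod>i\<in>I. emeasure lborel (A i))" .
qed simp

lemma nn_integral_PiM_lborel_shift:
  fixes v :: "'i \<Rightarrow> real"
  assumes I: "finite I" and [measurable]: "f \<in> borel_measurable (PiM I (\<lambda>_. lborel))"
  shows "(\<integral>\<^sup>+x. f (\<lambda>i\<in>I. x i + v i) \<partial>PiM I (\<lambda>_. lborel)) = (\<integral>\<^sup>+x. f x \<partial>PiM I (\<lambda>_. lborel))"
proof -
  have "(\<integral>\<^sup>+x. f x \<partial>PiM I (\<lambda>_. lborel)) = (\<integral>\<^sup>+x. f x \<partial>distr (PiM I (\<lambda>_. lborel)) (PiM I (\<lambda>_. lborel)) (\<lambda>x. \<lambda>i\<in>I. x i + v i))"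
    using I by (simp add: distr_PiM_lborel_shift)
  also have "\<dots> = (\<integral>\<^sup>+x. f (\<lambda>i\<in>I. x i + v i) \<partial>PiM I (\<lambda>_. lborel))"
    by (rule nn_integral_distr) measurable
  finally show ?thesis ..
qed

text \<open>The restriction places the image in the space of \<open>PiM I\<close>, whose points are
  undefined outside \<open>I\<close>.\<close>

definition matvec :: "'i set \<Rightarrow> ('i \<Rightarrow> 'i \<Rightarrow> real) \<Rightarrow> ('i \<Rightarrow> real) \<Rightarrow> 'i \<Rightarrow> real" where
  "matvec I P u = (\<lambda>i\<in>I. \<Sum>e\<in>I. P i e * u e)"

lemma measurable_matvec [measurable]:
  "matvec I P \<in> measurable (PiM I (\<lambda>_. lborel)) (PiM I (\<lambda>_. lborel))"
  unfolding matvec_def by measurable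

lemma measurable_matvec_component [measurable]:
  assumes [measurable]: "f \<in> measurable N (PiM I (\<lambda>_. borel))" and i [measurable]: "i \<in> I"
  shows "(\<lambda>x. matvec I P (f x) i) \<in> borel_measurable N"
proof -
  have "(\<lambda>x. \<Sum>e\<in>I. P i e * f x e) \<in> borel_measurable N" by measurable
  thus ?thesis using i by (simp add: matvec_def)
qed

text \<open>A linear surjection pushes Lebesgue measure to a translation invariant measure, and two
  translation invariant measures are proportional: integrate \<open>f (P u) * h (y - P u)\<close> in both orders.
  This avoids determinants.\<close>
lemma nn_integral_matvec_proportional:
  fixes P :: "'i \<Rightarrow> 'i \<Rightarrow> real"
  assumes I: "finite I"
    and surj: "\<And>y. \<exists>w. \<forall>i\<in>I. y i = (\<Sum>e\<in>I. P i e * w e)"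
    and f [measurable]: "f \<in> borel_measurable (PiM I (\<lambda>_. lborel))"
    and h [measurable]: "h \<in> borel_measurable (PiM I (\<lambda>_. lborel))"
    and even: "\<And>y. h (\<lambda>i\<in>I. - y i) = h (restrict y I)"
  shows "(\<integral>\<^sup>+u. f (matvec I P u) \<partial>PiM I (\<lambda>_. lborel)) * (\<integral>\<^sup>+y. h y \<partial>PiM I (\<lambda>_. lborel))
       = (\<integral>\<^sup>+y. f y \<partial>PiM I (\<lambda>_. lborel)) * (\<integral>\<^sup>+u. h (matvec I P u) \<partial>PiM I (\<lambda>_. lborel))"
proof -
  let ?L = "PiM I (\<lambda>_. lborel) :: ('i \<Rightarrow> real) measure"
  interpret finite_product_sigma_finite "\<lambda>_. lborel" I by standard (fact I)
  interpret pair_sigma_finite ?L ?L ..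
  have "(\<integral>\<^sup>+u. f (matvec I P u) \<partial>?L) * (\<integral>\<^sup>+y. h y \<partial>?L) = (\<integral>\<^sup>+u. \<integral>\<^sup>+y. f (matvec I P u) * h y \<partial>?L \<partial>?L)"
    by (simp add: nn_integral_cmult nn_integral_multc)
  also have "\<dots> = (\<integral>\<^sup>+u. \<integral>\<^sup>+y. f (matvec I P u) * h (\<lambda>i\<in>I. y i + - matvec I P u i) \<partial>?L \<partial>?L)"
    by (intro nn_integral_cong nn_integral_PiM_lborel_shift[OF I, symmetric]) auto
  also have "\<dots> = (\<integral>\<^sup>+y. \<integral>\<^sup>+u. f (matvec I P u) * h (\<lambda>i\<in>I. y i + - matvec I P u i) \<partial>?L \<partial>?L)"
    by (rule Fubini'[symmetric]) measurable
  also have "\<dots> = (\<integral>\<^sup>+y. \<integral>\<^sup>+u. f (\<lambda>i\<in>I. matvec I P u i + y i) * h (matvec I P u) \<partial>?L \<partial>?L)"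
  proof (rule nn_integral_cong)
    fix y assume "y \<in> space ?L"
    \<comment> \<open>Translating \<open>u\<close> by a preimage \<open>w\<close> of
      \<open>y\<close> turns \<open>P u\<close> into \<open>P u + y\<close> and
      \<open>y - P u\<close> into \<open>- P u\<close>, where evenness of \<open>h\<close> removes
      the sign.\<close>
    obtain w where w: "\<And>i. i \<in> I \<Longrightarrow> y i = (\<Sum>e\<in>I. P i e * w e)" using surj[of y] by blast
    have *: "matvec I P (\<lambda>i\<in>I. u i + w i) = (\<lambda>i\<in>I. matvec I P u i + y i)" for u
      by (auto simp: matvec_def fun_eq_iff w distrib_left sum.distrib)
    have "(\<integral>\<^sup>+u. f (matvec I P u) * h (\<lambda>i\<in>I. y i + - matvec I P u i) \<partial>?L)
        = (\<integral>\<^sup>+u. f (matvec I P (\<lambda>i\<in>I. u i + w i)) * h (\<lambda>i\<in>I. y i + - matvec I P (\<lambda>i\<in>I. u i + w i) i) \<partial>?L)"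
      using \<open>y \<in> space ?L\<close>
      by (intro nn_integral_PiM_lborel_shift[OF I, symmetric, where f="\<lambda>u. f (matvec I P u) * h (\<lambda>i\<in>I. y i + - matvec I P u i)"]) measurable
    also have "\<dots> = (\<integral>\<^sup>+u. f (\<lambda>i\<in>I. matvec I P u i + y i) * h (matvec I P u) \<partial>?L)"
    proof (rule nn_integral_cong)
      fix u
      have "(\<lambda>i\<in>I. y i + - matvec I P (\<lambda>i\<in>I. u i + w i) i) = (\<lambda>i\<in>I. - matvec I P u i)"
        unfolding * by (auto simp: fun_eq_iff)
      moreover have "restrict (matvec I P u) I = matvec I P u" by (auto simp: matvec_def)
      ultimately show "f (matvec I P (\<lambda>i\<in>I. u i + w i)) * h (\<lambda>i\<in>I. y i + - matvec I P (\<lambda>i\<in>I. u i + w i) i)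
          = f (\<lambda>i\<in>I. matvec I P u i + y i) * h (matvec I P u)"
        using even[of "matvec I P u"] by (simp add: *)
    qed
    finally show "(\<integral>\<^sup>+u. f (matvec I P u) * h (\<lambda>i\<in>I. y i + - matvec I P u i) \<partial>?L)
        = (\<integral>\<^sup>+u. f (\<lambda>i\<in>I. matvec I P u i + y i) * h (matvec I P u) \<partial>?L)" .
  qed
  also have "\<dots> = (\<integral>\<^sup>+u. \<integral>\<^sup>+y. f (\<lambda>i\<in>I. y i + matvec I P u i) * h (matvec I P u) \<partial>?L \<partial>?L)"
    by (subst Fubini') (auto simp: add.commute)
  also have "\<dots> = (\<integral>\<^sup>+u. \<integral>\<^sup>+y. f y * h (matvec I P u) \<partial>?L \<partial>?L)"
    by (intro nn_integral_cong nn_integral_PiM_lborel_shift[OF I, where f="\<lambda>y. f y * h _"]) measurable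
  also have "\<dots> = (\<integral>\<^sup>+y. f y \<partial>?L) * (\<integral>\<^sup>+u. h (matvec I P u) \<partial>?L)"
    by (simp add: nn_integral_cmult nn_integral_multc)
  finally show ?thesis .
qed

text \<open>The square of a block sum is linearised by the Hubbard-Stratonovich identity
  \<open>\<integral> exp (- y\<^sup>2 / 2 + s y) dy = sqrt (2 \<pi>) exp (s\<^sup>2 / 2)\<close>, with one auxiliary variable per block.\<close>
lemma gaussian_block_integral:
  fixes B :: "'p set" and A :: "'a set" and g :: nat
  assumes B: "finite B" and A: "finite A" "card A = g - 1" and g: "g \<ge> 1"
  shows "(\<integral>\<^sup>+u. ennreal (exp (- (1/2) * (\<Sum>p\<in>B. (\<Sum>a\<in>A. (u (p, a))\<^sup>2) / g - (\<Sum>a\<in>A. u (p, a))\<^sup>2 / (real g)\<^sup>2))) \<partial>PiM (B \<times> A) (\<lambda>_. lborel))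
           * ennreal (sqrt (2 * pi)) ^ card B = ennreal (sqrt (2 * pi * g)) ^ (g * card B)"
    (is "(\<integral>\<^sup>+u. ?q u \<partial>?L) * _ = _")
proof -
  let ?Y = "PiM B (\<lambda>_. lborel) :: ('p \<Rightarrow> real) measure"
  have BA: "finite (B \<times> A)" using B A by simp
  interpret L: finite_product_sigma_finite "\<lambda>_. lborel :: real measure" "B \<times> A" by standard (fact BA)
  interpret Y: finite_product_sigma_finite "\<lambda>_. lborel :: real measure" B by standard (fact B)
  interpret LY: pair_sigma_finite ?Y ?L ..
  have component: "(\<lambda>u. u (p, a)) \<in> borel_measurable ?L" if "p \<in> B" "a \<in> A" for p a
    using that by (auto intro!: measurable_component_singleton[where M="\<lambda>_. lborel", simplified])
  \<comment> \<open>A joint density in \<open>u\<close> and the auxiliary \<open>y\<close>: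
    integrating out \<open>y\<close> restores the block form up to a constant, while for fixed
    \<open>y\<close> the coordinates of \<open>u\<close> are decoupled.\<close>
  define F where "F = (\<lambda>(u :: 'p \<times> 'a \<Rightarrow> real) y. (\<Prod>c\<in>B\<times>A. ennreal (exp (- (1/g) * (u c)\<^sup>2 / 2 + y (fst c) / g * u c))) * (\<Prod>p\<in>B. ennreal (exp (- (y p)\<^sup>2 / 2))))"
  have F_measurable [measurable]: "(\<lambda>x. F (snd x) (fst x)) \<in> borel_measurable (?Y \<Otimes>\<^sub>M ?L)"
    unfolding F_def by measurable (auto simp: mem_Times_iff)
  have inner_y: "?q u * ennreal (sqrt (2 * pi)) ^ card B = (\<integral>\<^sup>+y. F u y \<partial>?Y)" for u
  proof -
    define S where "S = (\<lambda>p. \<Sum>a\<in>A. u (p, a))"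
    have split: "F u y = (\<Prod>c\<in>B\<times>A. ennreal (exp (- (1/g) * (u c)\<^sup>2 / 2))) * (\<Prod>p\<in>B. ennreal (exp (- 1 * (y p)\<^sup>2 / 2 + S p / g * y p)))" for y
    proof -
      have "(\<Prod>c\<in>B\<times>A. ennreal (exp (- (1/g) * (u c)\<^sup>2 / 2 + y (fst c) / g * u c)))
          = (\<Prod>c\<in>B\<times>A. ennreal (exp (- (1/g) * (u c)\<^sup>2 / 2))) * (\<Prod>c\<in>B\<times>A. ennreal (exp (y (fst c) / g * u c)))"
        by (simp only: exp_add ennreal_mult[OF exp_ge_zero exp_ge_zero] prod.distrib)
      moreover have "(\<Prod>c\<in>B\<times>A. ennreal (exp (y (fst c) / g * u c))) = (\<Prod>p\<in>B. ennreal (exp (S p / g * y p)))"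
        by (simp add: prod.cartesian_product' prod_ennreal exp_sum[OF A(1), symmetric] S_def sum_distrib_left[symmetric]
            sum_divide_distrib[symmetric] sum_distrib_right[symmetric] mult.commute)
      moreover have "(\<Prod>p\<in>B. ennreal (exp (- 1 * (y p)\<^sup>2 / 2 + S p / g * y p)))
         = (\<Prod>p\<in>B. ennreal (exp (- 1 * (y p)\<^sup>2 / 2))) * (\<Prod>p\<in>B. ennreal (exp (S p / g * y p)))"
        by (simp only: exp_add ennreal_mult[OF exp_ge_zero exp_ge_zero] prod.distrib)
      ultimately show ?thesis by (simp add: F_def mult_ac)
    qed
    have "(\<integral>\<^sup>+y. F u y \<partial>?Y) = (\<Prod>c\<in>B\<times>A. ennreal (exp (- (1/g) * (u c)\<^sup>2 / 2))) *
        (\<integral>\<^sup>+y. (\<Prod>p\<in>B. ennreal (exp (- 1 * (y p)\<^sup>2 / 2 + S p / g * y p))) \<partial>?Y)"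
      unfolding split by (rule nn_integral_cmult) measurable
    also have "(\<integral>\<^sup>+y. (\<Prod>p\<in>B. ennreal (exp (- 1 * (y p)\<^sup>2 / 2 + S p / g * y p))) \<partial>?Y)
        = (\<Prod>p\<in>B. \<integral>\<^sup>+y. ennreal (exp (- 1 * y\<^sup>2 / 2 + S p / g * y)) \<partial>lborel)"
      using B by (subst lebesgue_prod.product_nn_integral_prod) auto
    also have "\<dots> = (\<Prod>p\<in>B. ennreal (sqrt (2 * pi) * exp ((S p / g)\<^sup>2 / 2)))"
      by (subst gaussian_integral_nn) auto
    also have "\<dots> = ennreal (sqrt (2 * pi)) ^ card B * (\<Prod>p\<in>B. ennreal (exp ((S p / g)\<^sup>2 / 2)))"
      by (simp add: ennreal_mult prod.distrib)
    also have "(\<Prod>c\<in>B\<times>A. ennreal (exp (- (1/g) * (u c)\<^sup>2 / 2))) * (ennreal (sqrt (2 * pi)) ^ card B * (\<Prod>p\<in>B. ennreal (exp ((S p / g)\<^sup>2 / 2))))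
        = ennreal (sqrt (2 * pi)) ^ card B * ((\<Prod>c\<in>B\<times>A. ennreal (exp (- (1/g) * (u c)\<^sup>2 / 2))) * (\<Prod>p\<in>B. ennreal (exp ((S p / g)\<^sup>2 / 2))))"
      by (simp add: mult_ac)
    also have "(\<Prod>c\<in>B\<times>A. ennreal (exp (- (1/g) * (u c)\<^sup>2 / 2))) * (\<Prod>p\<in>B. ennreal (exp ((S p / g)\<^sup>2 / 2)))
        = ennreal (exp ((\<Sum>p\<in>B. \<Sum>a\<in>A. - (1/g) * (u (p, a))\<^sup>2 / 2) + (\<Sum>p\<in>B. (S p / g)\<^sup>2 / 2)))"
      by (simp only: prod_ennreal[OF exp_ge_zero] exp_sum[OF BA, symmetric] exp_sum[OF B, symmetric]
         ennreal_mult[OF exp_ge_zero exp_ge_zero, symmetric] exp_add[symmetric] sum.cartesian_product split_def prod.collapse)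
    also have "(\<Sum>p\<in>B. \<Sum>a\<in>A. - (1/g) * (u (p, a))\<^sup>2 / 2) + (\<Sum>p\<in>B. (S p / g)\<^sup>2 / 2)
        = - (1/2) * (\<Sum>p\<in>B. (\<Sum>a\<in>A. (u (p, a))\<^sup>2) / g - (\<Sum>a\<in>A. u (p, a))\<^sup>2 / (real g)\<^sup>2)"
    proof -
      have "(\<Sum>p\<in>B. \<Sum>a\<in>A. - (1/g) * (u (p, a))\<^sup>2 / 2) = - (1/2) * (\<Sum>p\<in>B. (\<Sum>a\<in>A. (u (p, a))\<^sup>2) / g)"
        by (simp add: sum_distrib_left sum_divide_distrib sum_negf mult_ac)
      moreover have "(\<Sum>p\<in>B. (S p / g)\<^sup>2 / 2) = (1/2) * (\<Sum>p\<in>B. (S p)\<^sup>2 / (real g)\<^sup>2)"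
        by (simp add: sum_distrib_left power_divide mult.commute)
      ultimately show ?thesis by (simp add: S_def sum_subtractf algebra_simps)
    qed
    finally show ?thesis by (simp add: mult.commute)
  qed
  \<comment> \<open>Each of the \<open>g - 1\<close> coordinates in a block yields
    \<open>exp (y^2 / (2 g))\<close>; against \<open>exp (- y^2 / 2)\<close> this leaves
    \<open>exp (- y^2 / (2 g))\<close>. The auxiliary variable thus has the same width as the
    others, hence \<open>g\<close> equal factors per block.\<close>
  have inner_u: "(\<integral>\<^sup>+u. F u y \<partial>?L) = ennreal (sqrt (2 * pi * g)) ^ ((g - 1) * card B) * (\<Prod>p\<in>B. ennreal (exp (- (1/g) * (y p)\<^sup>2 / 2 + 0 * y p)))" for y
  proof -
    have "(\<integral>\<^sup>+u. F u y \<partial>?L) = (\<integral>\<^sup>+u. (\<Prod>c\<in>B\<times>A. ennreal (exp (- (1/g) * (u c)\<^sup>2 / 2 + y (fst c) / g * u c))) \<partial>?L) * (\<Prod>p\<in>B. ennreal (exp (- (y p)\<^sup>2 / 2)))"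
      unfolding F_def by (rule nn_integral_multc) measurable
    also have "(\<integral>\<^sup>+u. (\<Prod>c\<in>B\<times>A. ennreal (exp (- (1/g) * (u c)\<^sup>2 / 2 + y (fst c) / g * u c))) \<partial>?L)
        = (\<Prod>c\<in>B\<times>A. \<integral>\<^sup>+x. ennreal (exp (- (1/g) * x\<^sup>2 / 2 + y (fst c) / g * x)) \<partial>lborel)"
      using BA by (subst lebesgue_prod.product_nn_integral_prod) auto
    also have "\<dots> = (\<Prod>c\<in>B\<times>A. ennreal (sqrt (2 * pi * g)) * ennreal (exp ((y (fst c))\<^sup>2 / (2 * g))))"
    proof (rule prod.cong[OF refl])
      fix c assume "c \<in> B \<times> A"
      show "(\<integral>\<^sup>+x. ennreal (exp (- (1/g) * x\<^sup>2 / 2 + y (fst c) / g * x)) \<partial>lborel) = ennreal (sqrt (2 * pi * g)) * ennreal (exp ((y (fst c))\<^sup>2 / (2 * g)))"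
        using g by (subst gaussian_integral_nn) (auto simp: ennreal_mult[symmetric] field_simps power2_eq_square)
    qed
    also have "\<dots> = ennreal (sqrt (2 * pi * g)) ^ ((g - 1) * card B) * (\<Prod>p\<in>B. ennreal (exp ((g - 1) * ((y p)\<^sup>2 / (2 * g)))))"
      using A g by (simp add: prod.distrib card_cartesian_product mult.commute prod.cartesian_product' ennreal_power
          exp_of_nat_mult[symmetric] of_nat_diff)
    finally have 1: "(\<integral>\<^sup>+u. F u y \<partial>?L) = ennreal (sqrt (2 * pi * g)) ^ ((g - 1) * card B) *
       ((\<Prod>p\<in>B. ennreal (exp ((g - 1) * ((y p)\<^sup>2 / (2 * g))))) * (\<Prod>p\<in>B. ennreal (exp (- (y p)\<^sup>2 / 2))))"
      by (simp add: mult_ac)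
    have e: "(g - 1) * (z\<^sup>2 / (2 * g)) + - z\<^sup>2 / 2 = - (1/g) * z\<^sup>2 / 2 + 0 * z" for z :: real
      using g by (simp add: field_simps)
    show ?thesis
      unfolding 1 e[symmetric] exp_add ennreal_mult[OF exp_ge_zero exp_ge_zero] prod.distrib by simp
  qed
  have "(\<integral>\<^sup>+u. ?q u \<partial>?L) * ennreal (sqrt (2 * pi)) ^ card B = (\<integral>\<^sup>+u. ?q u * ennreal (sqrt (2 * pi)) ^ card B \<partial>?L)"
  proof (rule nn_integral_multc[symmetric])
    note component [measurable]
    show "?q \<in> borel_measurable ?L" by measurable
  qed
  also have "\<dots> = (\<integral>\<^sup>+u. \<integral>\<^sup>+y. F u y \<partial>?Y \<partial>?L)"
    by (simp only: inner_y)
  also have "\<dots> = (\<integral>\<^sup>+y. \<integral>\<^sup>+u. F u y \<partial>?L \<partial>?Y)"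
    by (rule LY.Fubini'[where f="\<lambda>y u. F u y"]) (use F_measurable in \<open>simp only: case_prod_beta'\<close>)
  also have "\<dots> = (\<integral>\<^sup>+y. ennreal (sqrt (2 * pi * g)) ^ ((g - 1) * card B) * (\<Prod>p\<in>B. ennreal (exp (- (1/g) * (y p)\<^sup>2 / 2 + 0 * y p))) \<partial>?Y)"
    by (simp only: inner_u)
  also have "\<dots> = ennreal (sqrt (2 * pi * g)) ^ ((g - 1) * card B) * (\<Prod>p\<in>B. \<integral>\<^sup>+y. ennreal (exp (- (1/g) * y\<^sup>2 / 2 + 0 * y)) \<partial>lborel)"
    using B by (subst nn_integral_cmult, measurable) (subst lebesgue_prod.product_nn_integral_prod, auto)
  also have "\<dots> = ennreal (sqrt (2 * pi * g)) ^ ((g - 1) * card B) * ennreal (sqrt (2 * pi * g)) ^ card B"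
    using g by (subst gaussian_integral_nn) auto
  also have "\<dots> = ennreal (sqrt (2 * pi * g)) ^ (g * card B)"
    using g by (cases g) (auto simp: power_add[symmetric] algebra_simps)
  finally show ?thesis .
qed

section \<open>The quadratic form of the covariance matrix\<close>

definition pair_idx :: "nat \<Rightarrow> (nat \<times> nat) set" where
  "pair_idx k = {(i, j). 1 \<le> i \<and> i < j \<and> j \<le> k}"

lemma coord_idx_eq: "coord_idx g k = pair_idx k \<times> {1..g - 1}"
  by (auto simp: coord_idx_def pair_idx_def)

lemma pair_idx_Suc: "pair_idx (Suc k) = pair_idx k \<union> (\<lambda>i. (i, Suc k)) ` {1..k}"
  by (auto simp: pair_idx_def)

lemma finite_pair_idx [simp]: "finite (pair_idx k)"
proof -
  have "pair_idx k \<subseteq> {1..k} \<times> {1..k}" by (auto simp: pair_idx_def)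
  thus ?thesis by (rule finite_subset) auto
qed

lemma card_pair_idx: "card (pair_idx k) = k choose 2"
proof (induction k)
  case 0
  have "pair_idx 0 = {}" by (auto simp: pair_idx_def)
  thus ?case by simp
next
  case (Suc k)
  have "card (pair_idx (Suc k)) = card (pair_idx k) + card ((\<lambda>i. (i, Suc k)) ` {1..k})"
    unfolding pair_idx_Suc by (rule card_Un_disjoint) (simp, simp, auto simp: pair_idx_def)
  thus ?case using Suc by (simp add: card_image inj_on_def numeral_2_eq_2)
qed

lemma finite_coord_idx [simp]: "finite (coord_idx g k)"
  by (simp add: coord_idx_eq)

lemma card_coord_idx: "card (coord_idx g k) = (k choose 2) * (g - 1)"
  by (simp add: coord_idx_eq card_cartesian_product card_pair_idx)

definition Mform :: "nat \<Rightarrow> nat \<Rightarrow> (idx \<Rightarrow> real) \<Rightarrow> real" where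
  "Mform g k u = (\<Sum>c\<in>coord_idx g k. \<Sum>c'\<in>coord_idx g k. Mmat g c c' * u c * u c')"

text \<open>Each diagonal block of \<open>Mmat\<close> is the identity divided by \<open>g\<close>
  minus the all-ones matrix divided by \<open>g^2\<close>, the covariance of the indicators of a
  uniform residue.\<close>

lemma Mmat_row:
  assumes "c \<in> coord_idx g k" "g \<ge> 1"
  shows "(\<Sum>c'\<in>coord_idx g k. Mmat g c c' * u c') = u c / g - (\<Sum>a=1..g-1. u (fst c, a)) / (real g)\<^sup>2"
proof -
  obtain p a where c: "c = (p, a)" by (rule prod.exhaust)
  have p: "p \<in> pair_idx k" "a \<in> {1..g-1}" using assms by (auto simp: c coord_idx_eq)
  have M: "Mmat g (p, a) (q, b) * u (q, b) = (if q = p then (if b = a then u (p, a) / g else 0) - u (p, b) / (real g)\<^sup>2 else 0)" for q b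
    using \<open>g \<ge> 1\<close> by (auto simp: Mmat_def field_simps power2_eq_square)
  have "(\<Sum>c'\<in>coord_idx g k. Mmat g c c' * u c') = (\<Sum>q\<in>pair_idx k. \<Sum>b=1..g-1. Mmat g (p, a) (q, b) * u (q, b))"
    by (simp add: coord_idx_eq c sum.cartesian_product)
  also have "\<dots> = (\<Sum>q\<in>pair_idx k. if q = p then (\<Sum>b=1..g-1. (if b = a then u (p, a) / g else 0) - u (p, b) / (real g)\<^sup>2) else 0)"
    unfolding M by (intro sum.cong) auto
  also have "\<dots> = (\<Sum>b=1..g-1. (if b = a then u (p, a) / g else 0) - u (p, b) / (real g)\<^sup>2)"
    using p by (simp add: sum.delta)
  also have "\<dots> = u (p, a) / g - (\<Sum>a=1..g-1. u (p, a)) / (real g)\<^sup>2"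
    using p by (simp add: sum_subtractf sum_divide_distrib)
  finally show ?thesis by (simp add: c)
qed

lemma Mform_blocks:
  assumes "g \<ge> 1"
  shows "Mform g k u = (\<Sum>p\<in>pair_idx k. (\<Sum>a=1..g-1. (u (p, a))\<^sup>2) / g - (\<Sum>a=1..g-1. u (p, a))\<^sup>2 / (real g)\<^sup>2)"
proof -
  have "Mform g k u = (\<Sum>c\<in>coord_idx g k. u c * (\<Sum>c'\<in>coord_idx g k. Mmat g c c' * u c'))"
    by (simp add: Mform_def sum_distrib_left mult_ac)
  also have "\<dots> = (\<Sum>c\<in>coord_idx g k. u c * (u c / g - (\<Sum>a=1..g-1. u (fst c, a)) / (real g)\<^sup>2))"
    using assms by (simp add: Mmat_row)
  also have "\<dots> = (\<Sum>p\<in>pair_idx k. \<Sum>a=1..g-1. u (p, a) * (u (p, a) / g - (\<Sum>a=1..g-1. u (p, a)) / (real g)\<^sup>2))"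
    by (simp add: coord_idx_eq sum.cartesian_product split_def)
  also have "\<dots> = (\<Sum>p\<in>pair_idx k. (\<Sum>a=1..g-1. (u (p, a))\<^sup>2) / g - (\<Sum>a=1..g-1. u (p, a))\<^sup>2 / (real g)\<^sup>2)"
    by (simp add: right_diff_distrib sum_subtractf sum_divide_distrib[symmetric] sum_distrib_right[symmetric] power2_eq_square)
  finally show ?thesis .
qed

section \<open>Gaussian integrals over cubes through a symmetric square root of the covariance
  matrix\<close>

locale root_matrix =
  fixes g k :: nat and P :: "idx \<Rightarrow> idx \<Rightarrow> real"
  assumes g: "g \<ge> 1"
    and sym: "\<And>c c'. c \<in> coord_idx g k \<Longrightarrow> c' \<in> coord_idx g k \<Longrightarrow> P c c' = P c' c"
    and root: "\<And>c c'. c \<in> coord_idx g k \<Longrightarrow> c' \<in> coord_idx g k \<Longrightarrow>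
        (\<Sum>e\<in>coord_idx g k. P c e * P e c') = Mmat g c c'"
    and surj: "\<And>y. \<exists>w. \<forall>c\<in>coord_idx g k. y c = (\<Sum>e\<in>coord_idx g k. P c e * w e)"
begin

abbreviation "I \<equiv> coord_idx g k"
abbreviation "L \<equiv> PiM (coord_idx g k) (\<lambda>_. lborel :: real measure)"

text \<open>By symmetry the square of \<open>P\<close> is also its transpose times itself, so the
  form is a squared norm.\<close>

lemma Mform_root: "Mform g k u = (\<Sum>c\<in>I. (matvec I P u c)\<^sup>2)"
proof -
  have "(\<Sum>c\<in>I. (matvec I P u c)\<^sup>2) = (\<Sum>c\<in>I. \<Sum>a\<in>I. \<Sum>b\<in>I. P a c * P c b * u a * u b)"
    by (simp add: matvec_def power2_eq_square sum_product sym mult_ac)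
  also have "\<dots> = (\<Sum>a\<in>I. \<Sum>b\<in>I. \<Sum>c\<in>I. P a c * P c b * u a * u b)"
    by (rule trans[OF sum.swap]) (intro sum.cong refl sum.swap)
  also have "\<dots> = Mform g k u"
    unfolding Mform_def by (intro sum.cong refl) (simp add: sum_distrib_right[symmetric] root)
  finally show ?thesis ..
qed

text \<open>A vector \<open>w\<close> in the kernel of \<open>P\<close> is in the kernel of
  \<open>Mmat\<close>, whose rows force all entries of a block to equal \<open>S / g\<close> with
  \<open>S\<close> their sum; then \<open>S = (g - 1) * S / g\<close>, so
  \<open>S = 0\<close>.\<close>

lemma matvec_inj:
  assumes "\<And>c. c \<in> I \<Longrightarrow> (\<Sum>e\<in>I. P c e * u e) = (\<Sum>e\<in>I. P c e * v e)" "c \<in> I"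
  shows "u c = v c"
proof -
  define w where "w = (\<lambda>c. u c - v c)"
  have 0: "(\<Sum>e\<in>I. P c e * w e) = 0" if "c \<in> I" for c
    using assms(1)[OF that] by (simp add: w_def right_diff_distrib sum_subtractf)
  have row: "w c / g - (\<Sum>a=1..g-1. w (fst c, a)) / (real g)\<^sup>2 = 0" if "c \<in> I" for c
  proof -
    have "(\<Sum>c'\<in>I. Mmat g c c' * w c') = (\<Sum>c'\<in>I. \<Sum>e\<in>I. P c e * (P e c' * w c'))"
      using that by (simp add: root[symmetric] sum_distrib_left sum_distrib_right mult_ac)
    also have "\<dots> = (\<Sum>e\<in>I. P c e * (\<Sum>c'\<in>I. P e c' * w c'))"
      by (subst sum.swap) (simp add: sum_distrib_left)
    also have "\<dots> = 0" by (simp add: 0)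
    finally show ?thesis using Mmat_row[OF that g, of w] by simp
  qed
  have eq: "w (fst c, a) = (\<Sum>a=1..g-1. w (fst c, a)) / g" if "a \<in> {1..g-1}" for a
  proof -
    have "(fst c, a) \<in> I" using that assms(2) by (auto simp: coord_idx_eq)
    from row[OF this] show ?thesis using g by (simp add: field_simps power2_eq_square)
  qed
  define S where "S = (\<Sum>a=1..g-1. w (fst c, a))"
  note eq = eq[folded S_def]
  have "S = (\<Sum>a=1..g-1. w (fst c, a))" by (rule S_def)
  also have "\<dots> = (\<Sum>a=1..g-1. S / g)" by (rule sum.cong[OF refl]) (rule eq)
  finally have "S = real (g - 1) * (S / g)" by simp
  hence "S = 0" using g by (simp add: field_simps of_nat_diff)
  hence "w (fst c, snd c) = 0" using eq[of "snd c"] assms(2) by (auto simp: coord_idx_eq)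
  thus ?thesis by (simp add: w_def)
qed

text \<open>The proportionality constant, one over the absolute determinant of \<open>P\<close>, is
  found by testing on the standard Gaussian: its pullback is the Gaussian of the block form, whose
  integral is known.\<close>

lemma nn_integral_matvec:
  assumes [measurable]: "f \<in> borel_measurable L"
  shows "(\<integral>\<^sup>+u. f (matvec I P u) \<partial>L) = (\<integral>\<^sup>+u. f u \<partial>L) * ennreal (sqrt g ^ (g * (k choose 2)))"
proof -
  define h :: "(idx \<Rightarrow> real) \<Rightarrow> ennreal" where "h = (\<lambda>y. (\<Prod>c\<in>I. ennreal (exp (- 1 * (y c)\<^sup>2 / 2 + 0 * y c))))"
  define n where "n = k choose 2"
  have [measurable]: "h \<in> borel_measurable L" unfolding h_def by measurable
  have h: "(\<integral>\<^sup>+y. h y \<partial>L) = ennreal (sqrt (2 * pi)) ^ (n * (g - 1))"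
    unfolding h_def using gaussian_integral_nn[of 1 0]
    by (subst lebesgue_prod.product_nn_integral_prod) (simp_all add: card_coord_idx n_def)
  have hP: "h (matvec I P u) = ennreal (exp (- (1/2) * Mform g k u))" for u
    by (simp add: h_def Mform_root prod_ennreal exp_sum[symmetric] sum_negf sum_divide_distrib[symmetric])
  have hP_int: "(\<integral>\<^sup>+u. h (matvec I P u) \<partial>L) * ennreal (sqrt (2 * pi)) ^ n = ennreal (sqrt (2 * pi * g)) ^ (g * n)"
    using gaussian_block_integral[of "pair_idx k" "{1..g-1}" g] g
    unfolding hP by (simp add: Mform_blocks coord_idx_eq card_pair_idx n_def)
  have main: "(\<integral>\<^sup>+u. f (matvec I P u) \<partial>L) * (\<integral>\<^sup>+y. h y \<partial>L) = (\<integral>\<^sup>+y. f y \<partial>L) * (\<integral>\<^sup>+u. h (matvec I P u) \<partial>L)"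
    by (rule nn_integral_matvec_proportional) (auto simp: surj h_def intro!: prod.cong)
  \<comment> \<open>A finite nonzero factor to cancel at the end; the extra \<open>n\<close> factors
    complete \<open>n * (g - 1)\<close> to the exponent \<open>g * n\<close> of the block
    integral.\<close>
  define z where "z = ennreal (sqrt (2 * pi)) ^ (g * n)"
  have z: "z \<noteq> 0" "z \<noteq> \<infinity>" by (auto simp: z_def ennreal_power)
  have "(\<integral>\<^sup>+u. f (matvec I P u) \<partial>L) * z = (\<integral>\<^sup>+u. f (matvec I P u) \<partial>L) * (\<integral>\<^sup>+y. h y \<partial>L) * ennreal (sqrt (2 * pi)) ^ n"
  proof -
    have "n * (g - 1) + n = g * n" using g by (cases g) auto
    hence "z = (\<integral>\<^sup>+y. h y \<partial>L) * ennreal (sqrt (2 * pi)) ^ n"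
      unfolding h z_def by (simp only: power_add[symmetric])
    thus ?thesis by (simp only: mult.assoc)
  qed
  also have "\<dots> = (\<integral>\<^sup>+y. f y \<partial>L) * ennreal (sqrt (2 * pi * g)) ^ (g * n)"
    by (simp only: main mult.assoc hP_int)
  also have "\<dots> = (\<integral>\<^sup>+u. f u \<partial>L) * ennreal (sqrt g ^ (g * n)) * z"
    by (simp add: z_def real_sqrt_mult ennreal_mult ennreal_power power_mult_distrib mult_ac)
  finally show ?thesis using z
    by (simp add: n_def ennreal_mult_cancel_left mult.commute[of _ z])
qed

text \<open>\<open>P\<close> maps the cube of radius \<open>\<delta>\<close> into the one of radius
  \<open>D * \<delta>\<close>; enlarging the domain to the full preimage of the latter lets the
  integral factor into one-dimensional ones.\<close>

lemma box_gaussian_upper: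
  assumes "t > 0" "\<delta> > 0" "D > 0"
    and box: "\<And>\<mu>. (\<And>c. c \<in> I \<Longrightarrow> \<bar>\<mu> c\<bar> \<le> \<delta>) \<Longrightarrow> (\<And>c. c \<in> I \<Longrightarrow> \<bar>\<Sum>e\<in>I. P c e * \<mu> e\<bar> \<le> D * \<delta>)"
  shows "(\<integral>\<^sup>+u. ennreal (indicator (PiE I (\<lambda>_. {-\<delta>..\<delta>})) u * exp (- t / 2 * Mform g k u)) \<partial>L)
     \<le> ennreal (sqrt (2 * pi / t * (1 - exp (- t * (D * \<delta>)\<^sup>2))) ^ ((k choose 2) * (g - 1)) * sqrt g ^ (g * (k choose 2)))"
proof -
  have "D * \<delta> > 0" using assms by simp
  then obtain j where j: "j \<ge> 0"
    "(\<integral>\<^sup>+y. ennreal (indicator {-(D*\<delta>)..D*\<delta>} y * exp (- t * y\<^sup>2 / 2)) \<partial>lborel) = ennreal j"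
    "j\<^sup>2 \<le> 2 * pi / t * (1 - exp (- t * (D * \<delta>)\<^sup>2))" "2 * pi / t * (1 - exp (- t / 2 * (D * \<delta>)\<^sup>2)) \<le> j\<^sup>2"
    by (rule gauss_truncated[OF \<open>t > 0\<close>])
  define f :: "(idx \<Rightarrow> real) \<Rightarrow> ennreal" where
    "f = (\<lambda>y. \<Prod>c\<in>I. ennreal (indicator {-(D*\<delta>)..D*\<delta>} (y c) * exp (- t * (y c)\<^sup>2 / 2)))"
  have [measurable]: "f \<in> borel_measurable L" unfolding f_def by measurable
  have "(\<integral>\<^sup>+u. ennreal (indicator (PiE I (\<lambda>_. {-\<delta>..\<delta>})) u * exp (- t / 2 * Mform g k u)) \<partial>L) \<le> (\<integral>\<^sup>+u. f (matvec I P u) \<partial>L)"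
  proof (rule nn_integral_mono)
    fix u
    show "ennreal (indicator (PiE I (\<lambda>_. {-\<delta>..\<delta>})) u * exp (- t / 2 * Mform g k u)) \<le> f (matvec I P u)"
    proof (cases "u \<in> PiE I (\<lambda>_. {-\<delta>..\<delta>})")
      case True
      have "\<bar>u c\<bar> \<le> \<delta>" if "c \<in> I" for c using True that by (auto simp: PiE_iff abs_le_iff)
      hence "\<bar>matvec I P u c\<bar> \<le> D * \<delta>" if "c \<in> I" for c
        using box[of u c] that by (simp add: matvec_def)
      hence "matvec I P u c \<in> {-(D*\<delta>)..D*\<delta>}" if "c \<in> I" for c
        using that by (auto simp: abs_le_iff minus_le_iff)
      hence "f (matvec I P u) = (\<Prod>c\<in>I. ennreal (exp (- t * (matvec I P u c)\<^sup>2 / 2)))"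
        unfolding f_def by (intro prod.cong) auto
      also have "\<dots> = ennreal (exp (- t / 2 * Mform g k u))"
        by (simp add: Mform_root prod_ennreal exp_sum[symmetric] sum_distrib_left sum_negf)
      finally show ?thesis using True by simp
    qed simp
  qed
  also have "\<dots> = (\<integral>\<^sup>+u. f u \<partial>L) * ennreal (sqrt g ^ (g * (k choose 2)))"
    by (rule nn_integral_matvec) measurable
  also have "(\<integral>\<^sup>+u. f u \<partial>L) = ennreal j ^ ((k choose 2) * (g - 1))"
    unfolding f_def by (subst lebesgue_prod.product_nn_integral_prod) (simp, measurable, simp only: j(2) prod_constant card_coord_idx)
  also have "\<dots> * ennreal (sqrt g ^ (g * (k choose 2))) = ennreal (j ^ ((k choose 2) * (g - 1)) * sqrt g ^ (g * (k choose 2)))"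
    using j by (simp add: ennreal_power ennreal_mult)
  also have "\<dots> \<le> ennreal (sqrt (2 * pi / t * (1 - exp (- t * (D * \<delta>)\<^sup>2))) ^ ((k choose 2) * (g - 1)) * sqrt g ^ (g * (k choose 2)))"
    using j by (intro ennreal_leI mult_right_mono power_mono real_le_rsqrt) auto
  finally show ?thesis .
qed

lemma box_gaussian_lower:
  assumes "t > 0" "\<delta> > 0" "D > 0"
    and box: "\<And>v. (\<And>c. c \<in> I \<Longrightarrow> \<bar>v c\<bar> \<le> D * \<delta>) \<Longrightarrow>
        \<exists>\<mu>. (\<forall>c\<in>I. \<bar>\<mu> c\<bar> \<le> \<delta>) \<and> (\<forall>c\<in>I. v c = (\<Sum>e\<in>I. P c e * \<mu> e))"
  shows "(\<integral>\<^sup>+u. ennreal (indicator (PiE I (\<lambda>_. {-\<delta>..\<delta>})) u * exp (- t / 2 * Mform g k u)) \<partial>L)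
     \<ge> ennreal (sqrt (2 * pi / t * (1 - exp (- t / 2 * (D * \<delta>)\<^sup>2))) ^ ((k choose 2) * (g - 1)) * sqrt g ^ (g * (k choose 2)))"
proof -
  have "D * \<delta> > 0" using assms by simp
  then obtain j where j: "j \<ge> 0"
    "(\<integral>\<^sup>+y. ennreal (indicator {-(D*\<delta>)..D*\<delta>} y * exp (- t * y\<^sup>2 / 2)) \<partial>lborel) = ennreal j"
    "j\<^sup>2 \<le> 2 * pi / t * (1 - exp (- t * (D * \<delta>)\<^sup>2))" "j\<^sup>2 \<ge> 2 * pi / t * (1 - exp (- t / 2 * (D * \<delta>)\<^sup>2))"
    by (rule gauss_truncated[OF \<open>t > 0\<close>])
  define f :: "(idx \<Rightarrow> real) \<Rightarrow> ennreal" where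
    "f = (\<lambda>y. \<Prod>c\<in>I. ennreal (indicator {-(D*\<delta>)..D*\<delta>} (y c) * exp (- t * (y c)\<^sup>2 / 2)))"
  have [measurable]: "f \<in> borel_measurable L" unfolding f_def by measurable
  have "ennreal (sqrt (2 * pi / t * (1 - exp (- t / 2 * (D * \<delta>)\<^sup>2))) ^ ((k choose 2) * (g - 1)) * sqrt g ^ (g * (k choose 2)))
     \<le> ennreal (j ^ ((k choose 2) * (g - 1)) * sqrt g ^ (g * (k choose 2)))"
    using j assms by (intro ennreal_leI mult_right_mono power_mono real_le_lsqrt) auto
  also have "\<dots> = ennreal j ^ ((k choose 2) * (g - 1)) * ennreal (sqrt g ^ (g * (k choose 2)))"
    using j by (simp add: ennreal_power ennreal_mult)
  also have "ennreal j ^ ((k choose 2) * (g - 1)) = (\<integral>\<^sup>+u. f u \<partial>L)"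
    unfolding f_def by (subst lebesgue_prod.product_nn_integral_prod) (simp, measurable, simp only: j(2) prod_constant card_coord_idx)
  also have "(\<integral>\<^sup>+u. f u \<partial>L) * ennreal (sqrt g ^ (g * (k choose 2))) = (\<integral>\<^sup>+u. f (matvec I P u) \<partial>L)"
    by (rule nn_integral_matvec[symmetric]) measurable
  also have "\<dots> \<le> (\<integral>\<^sup>+u. ennreal (indicator (PiE I (\<lambda>_. {-\<delta>..\<delta>})) u * exp (- t / 2 * Mform g k u)) \<partial>L)"
  proof (rule nn_integral_mono)
    fix u assume u: "u \<in> space L"
    show "f (matvec I P u) \<le> ennreal (indicator (PiE I (\<lambda>_. {-\<delta>..\<delta>})) u * exp (- t / 2 * Mform g k u))"
    proof (cases "\<forall>c\<in>I. matvec I P u c \<in> {-(D*\<delta>)..D*\<delta>}")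
      case False
      then obtain c where c: "c \<in> I" "matvec I P u c \<notin> {-(D*\<delta>)..D*\<delta>}" by blast
      hence "ennreal (indicator {-(D*\<delta>)..D*\<delta>} (matvec I P u c) * exp (- t * (matvec I P u c)\<^sup>2 / 2)) = 0" by simp
      hence "f (matvec I P u) = 0" unfolding f_def using c(1) by (intro prod_zero) auto
      thus ?thesis by simp
    next
      case True
      hence "\<bar>\<Sum>e\<in>I. P c e * u e\<bar> \<le> D * \<delta>" if "c \<in> I" for c
        using that by (auto simp: abs_le_iff minus_le_iff matvec_def)
      from box[of "\<lambda>c. \<Sum>e\<in>I. P c e * u e", OF this] obtain \<mu> where
        \<mu>: "\<forall>c\<in>I. \<bar>\<mu> c\<bar> \<le> \<delta>" "\<forall>c\<in>I. (\<Sum>e\<in>I. P c e * u e) = (\<Sum>e\<in>I. P c e * \<mu> e)" by blast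
      \<comment> \<open>The inclusion of cubes only provides some point of the small cube with the
        same image; injectivity identifies it with \<open>u\<close>.\<close>
      have "u c = \<mu> c" if "c \<in> I" for c using matvec_inj[of u \<mu> c] \<mu> that by blast
      hence "u \<in> PiE I (\<lambda>_. {-\<delta>..\<delta>})" using u \<mu> by (auto simp: space_PiM PiE_iff abs_le_iff minus_le_iff)
      moreover have "f (matvec I P u) = (\<Prod>c\<in>I. ennreal (exp (- t * (matvec I P u c)\<^sup>2 / 2)))"
        unfolding f_def using True by (intro prod.cong) auto
      moreover have "\<dots> = ennreal (exp (- t / 2 * Mform g k u))"
        by (simp add: Mform_root prod_ennreal exp_sum[symmetric] sum_distrib_left sum_negf)
      ultimately show ?thesis by simp
    qed
  qed
  finally show ?thesis .
qed

end

section \<open>Moments of a step\<close>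

definition diff_mod :: "nat \<Rightarrow> (nat \<Rightarrow> nat) \<Rightarrow> nat \<times> nat \<Rightarrow> nat" where
  "diff_mod g x p = nat ((int (x (fst p)) - int (x (snd p))) mod int g)"

definition zdot :: "nat \<Rightarrow> nat \<Rightarrow> (idx \<Rightarrow> real) \<Rightarrow> (nat \<Rightarrow> nat) \<Rightarrow> real" where
  "zdot g k l x = (\<Sum>c\<in>coord_idx g k. l c * Zmap g k x c)"

definition phi :: "nat \<Rightarrow> nat \<Rightarrow> (idx \<Rightarrow> real) \<Rightarrow> complex" where
  "phi g k l = (\<Sum>x\<in>Zgk g k. cis (zdot g k l x)) / of_nat (g ^ k)"

lemma finite_Zgk [simp]: "finite (Zgk g k)"
  unfolding Zgk_def by (intro finite_PiE) auto

lemma card_Zgk: "card (Zgk g k) = g ^ k"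
  unfolding Zgk_def by (subst card_PiE) auto

lemma Zgk_nonempty: "g \<ge> 1 \<Longrightarrow> Zgk g k \<noteq> {}"
  by (auto simp: Zgk_def PiE_eq_empty_iff)

lemma diff_mod_less: "g \<ge> 1 \<Longrightarrow> diff_mod g x p < g"
  by (simp add: diff_mod_def nat_less_iff)

lemma Zmap_diff_mod:
  assumes "(p, a) \<in> coord_idx g k"
  shows "Zmap g k x (p, a) = (if diff_mod g x p = a then 1 else 0) - 1 / g"
proof -
  have "g \<ge> 1" using assms by (auto simp: coord_idx_eq)
  hence "(int (x (fst p)) - int (x (snd p))) mod int g = int a \<longleftrightarrow> diff_mod g x p = a"
    by (auto simp: diff_mod_def)
  thus ?thesis using assms by (auto simp: Zmap_def split: prod.splits)
qed

section \<open>First and second moments of a step by resampling one coordinate\<close>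

lemma sum_Zgk_resample:
  fixes h :: "(nat \<Rightarrow> nat) \<Rightarrow> real"
  assumes v: "v \<in> {1..k}"
  shows "(\<Sum>x\<in>Zgk g k. \<Sum>s<g. h (x(v := s))) = g * (\<Sum>x\<in>Zgk g k. h x)"
proof -
  define K where "K = {1..k} - {v}"
  have K: "{1..k} = insert v K" "v \<notin> K" using v by (auto simp: K_def)
  have Z: "Zgk g k = (\<lambda>(s, z). z(v := s)) ` ({..<g} \<times> PiE K (\<lambda>_. {..<g}))"
    unfolding Zgk_def K PiE_insert_eq by (simp add: atLeast0LessThan)
  have inj: "inj_on (\<lambda>(s, z). z(v := s)) ({..<g} \<times> PiE K (\<lambda>_. {..<g}))"
    by (rule inj_combinator[OF K(2), of "\<lambda>_. {..<g}"])
  have sum: "(\<Sum>x\<in>Zgk g k. f x) = (\<Sum>z\<in>PiE K (\<lambda>_. {..<g}). \<Sum>s<g. f (z(v := s)))" for f :: "(nat \<Rightarrow> nat) \<Rightarrow> real"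
  proof -
    have "(\<Sum>x\<in>Zgk g k. f x) = (\<Sum>(s, z)\<in>{..<g} \<times> PiE K (\<lambda>_. {..<g}). f (z(v := s)))"
      unfolding Z using inj by (subst sum.reindex) (auto simp: split_def)
    also have "\<dots> = (\<Sum>s<g. \<Sum>z\<in>PiE K (\<lambda>_. {..<g}). f (z(v := s)))"
      by (simp add: sum.cartesian_product)
    also have "\<dots> = (\<Sum>z\<in>PiE K (\<lambda>_. {..<g}). \<Sum>s<g. f (z(v := s)))"
      by (rule sum.swap)
    finally show ?thesis .
  qed
  show ?thesis
    unfolding sum by (simp add: sum_distrib_left)
qed

text \<open>Moving one endpoint through all residues permutes the values of the difference.\<close>

lemma sum_diff_mod_resample:
  fixes u :: "nat \<Rightarrow> real"
  assumes "v = fst p \<or> v = snd p" "fst p \<noteq> snd p" "g \<ge> 1"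
  shows "(\<Sum>s<g. u (diff_mod g (x(v := s)) p)) = (\<Sum>b<g. u b)"
proof -
  define f where "f = (\<lambda>s. diff_mod g (x(v := s)) p)"
  have "inj_on f {..<g}"
  proof (rule inj_onI)
    fix r s assume rs: "r \<in> {..<g}" "s \<in> {..<g}" and eq: "f r = f s"
    have "[int r = int s] (mod int g)"
    proof (cases "v = fst p")
      case True
      hence "[int r - int (x (snd p)) = int s - int (x (snd p))] (mod int g)"
        using eq assms by (simp add: f_def diff_mod_def cong_def eq_nat_nat_iff)
      thus ?thesis using cong_add[OF _ cong_refl, of _ _ _ "int (x (snd p))"] by fastforce
    next
      case False
      hence "[int (x (fst p)) - int r = int (x (fst p)) - int s] (mod int g)"
        using eq assms by (auto simp: f_def diff_mod_def cong_def eq_nat_nat_iff)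
      from cong_diff[OF cong_refl[of "int (x (fst p))"] this] show ?thesis by simp
    qed
    thus "r = s" using rs by (simp add: cong_def)
  qed
  moreover have "f ` {..<g} \<subseteq> {..<g}" unfolding f_def by (intro image_subsetI) (simp add: diff_mod_less assms)
  ultimately have "f ` {..<g} = {..<g}" by (intro endo_inj_surj) auto
  with \<open>inj_on f _\<close> have "(\<Sum>b<g. u b) = (\<Sum>s<g. u (f s))"
    by (metis (no_types, lifting) sum.reindex_cong)
  thus ?thesis by (simp add: f_def)
qed

text \<open>Given all coordinates except \<open>v\<close>, the residue at \<open>p\<close> is
  uniform, so it is independent of anything that does not look at coordinate
  \<open>v\<close>.\<close>

lemma sum_diff_mod_independent:
  fixes u :: "nat \<Rightarrow> real" and w :: "(nat \<Rightarrow> nat) \<Rightarrow> real"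
  assumes p: "p \<in> pair_idx k" and v: "v = fst p \<or> v = snd p" and g: "g \<ge> 1"
    and w: "\<And>x s. w (x(v := s)) = w x"
  shows "(\<Sum>x\<in>Zgk g k. u (diff_mod g x p) * w x) = (\<Sum>b<g. u b) / g * (\<Sum>x\<in>Zgk g k. w x)"
proof -
  have vk: "v \<in> {1..k}" and ne: "fst p \<noteq> snd p" using p v by (auto simp: pair_idx_def)
  have "g * (\<Sum>x\<in>Zgk g k. u (diff_mod g x p) * w x)
      = (\<Sum>x\<in>Zgk g k. \<Sum>s<g. u (diff_mod g (x(v := s)) p) * w (x(v := s)))"
    by (rule sum_Zgk_resample[OF vk, symmetric])
  also have "\<dots> = (\<Sum>b<g. u b) * (\<Sum>x\<in>Zgk g k. w x)"
    by (simp add: w sum_distrib_right[symmetric] sum_diff_mod_resample[OF v ne g] sum_distrib_left)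
  finally show ?thesis using g by (simp add: field_simps)
qed

lemma sum_Zmap:
  assumes c: "c \<in> coord_idx g k"
  shows "(\<Sum>x\<in>Zgk g k. Zmap g k x c) = 0"
proof -
  obtain p a where pa: "c = (p, a)" by (rule prod.exhaust)
  have p: "p \<in> pair_idx k" "a \<in> {1..g-1}" and g: "g \<ge> 1" using c by (auto simp: coord_idx_eq pa)
  have ag: "a < g" using p g by auto
  have "(\<Sum>x\<in>Zgk g k. Zmap g k x c) = (\<Sum>x\<in>Zgk g k. ((if diff_mod g x p = a then 1 else 0) - 1 / g) * 1)"
    using c by (simp add: pa Zmap_diff_mod)
  also have "\<dots> = (\<Sum>b<g. (if b = a then 1 else 0) - 1 / g) / g * (\<Sum>x\<in>Zgk g k. 1)"
    by (rule sum_diff_mod_independent[OF p(1), of "fst p"]) (use g in auto)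
  also have "(\<Sum>b<g. (if b = a then 1 else 0) - 1 / g) = 0"
    using ag by (simp add: sum_subtractf)
  finally show ?thesis by simp
qed

lemma sum_Zmap_Zmap:
  assumes c: "c \<in> coord_idx g k" "c' \<in> coord_idx g k"
  shows "(\<Sum>x\<in>Zgk g k. Zmap g k x c * Zmap g k x c') = g ^ k * Mmat g c c'"
proof -
  obtain p a where pa: "c = (p, a)" by (rule prod.exhaust)
  obtain q b where qb: "c' = (q, b)" by (rule prod.exhaust)
  have p: "p \<in> pair_idx k" "a \<in> {1..g-1}" and q: "q \<in> pair_idx k" "b \<in> {1..g-1}" and g: "g \<ge> 1"
    using c by (auto simp: coord_idx_eq pa qb)
  have ag: "a < g" "b < g" using p q g by auto
  define U :: "nat \<Rightarrow> nat \<Rightarrow> real" where "U = (\<lambda>a n. (if n = a then 1 else 0) - 1 / g)"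
  have Z: "Zmap g k x c = U a (diff_mod g x p)" "Zmap g k x c' = U b (diff_mod g x q)" for x
    using c by (simp_all add: pa qb Zmap_diff_mod U_def)
  show ?thesis
  proof (cases "p = q")
    case True
    have "(\<Sum>x\<in>Zgk g k. Zmap g k x c * Zmap g k x c') = (\<Sum>x\<in>Zgk g k. (\<lambda>n. U a n * U b n) (diff_mod g x p) * 1)"
      by (simp add: Z True)
    also have "\<dots> = (\<Sum>n<g. U a n * U b n) / g * (\<Sum>x\<in>Zgk g k. 1)"
      by (rule sum_diff_mod_independent[OF p(1), of "fst p"]) (use g in auto)
    also have "(\<Sum>n<g. U a n * U b n) = (\<Sum>n<g. (if n = a then U b a else 0) - (if n = b then 1 / g else 0) + 1 / g * (1 / g))"
      by (intro sum.cong) (auto simp: U_def algebra_simps)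
    also have "\<dots> = U b a - 1 / g + g * (1 / g * (1 / g))"
      using ag by (simp add: sum.distrib sum_subtractf)
    also have "\<dots> = (if a = b then 1 else 0) - 1 / g"
      using g by (simp add: U_def)
    finally show ?thesis using True g
      by (auto simp: pa qb card_Zgk Mmat_def field_simps power2_eq_square)
  next
    case False
    \<comment> \<open>Both pairs are increasing, so different pairs cannot have the same endpoints.
      Resampling the endpoint of \<open>p\<close> outside \<open>q\<close> makes the first factor
      average to zero.\<close>
    have "\<exists>v. (v = fst p \<or> v = snd p) \<and> v \<noteq> fst q \<and> v \<noteq> snd q"
    proof (cases "fst p = fst q \<or> fst p = snd q")
      case True
      hence "snd p \<noteq> fst q \<and> snd p \<noteq> snd q"
        using p(1) q(1) False by (auto simp: pair_idx_def)
      thus ?thesis by blast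
    qed blast
    then obtain v where v: "v = fst p \<or> v = snd p" "v \<noteq> fst q" "v \<noteq> snd q" by blast
    have "(\<Sum>x\<in>Zgk g k. Zmap g k x c * Zmap g k x c') = (\<Sum>x\<in>Zgk g k. U a (diff_mod g x p) * U b (diff_mod g x q))"
      by (simp add: Z)
    also have "\<dots> = (\<Sum>n<g. U a n) / g * (\<Sum>x\<in>Zgk g k. U b (diff_mod g x q))"
      by (rule sum_diff_mod_independent[OF p(1) v(1) g]) (use v in \<open>auto simp: diff_mod_def\<close>)
    also have "(\<Sum>n<g. U a n) = 0"
      using ag by (simp add: U_def sum_subtractf)
    finally show ?thesis using False by (simp add: pa qb Mmat_def)
  qed
qed

lemma sum_zdot: "(\<Sum>x\<in>Zgk g k. zdot g k l x) = 0"
  unfolding zdot_def by (subst sum.swap) (simp add: sum_distrib_left[symmetric] sum_Zmap)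

lemma sum_zdot_squared: "(\<Sum>x\<in>Zgk g k. (zdot g k l x)\<^sup>2) = real g ^ k * Mform g k l"
proof -
  have "(\<Sum>x\<in>Zgk g k. (zdot g k l x)\<^sup>2)
      = (\<Sum>x\<in>Zgk g k. \<Sum>c\<in>coord_idx g k. \<Sum>c'\<in>coord_idx g k. l c * l c' * (Zmap g k x c * Zmap g k x c'))"
    by (simp add: zdot_def power2_eq_square sum_product mult_ac)
  also have "\<dots> = (\<Sum>c\<in>coord_idx g k. \<Sum>x\<in>Zgk g k. \<Sum>c'\<in>coord_idx g k. l c * l c' * (Zmap g k x c * Zmap g k x c'))"
    by (rule sum.swap)
  also have "\<dots> = (\<Sum>c\<in>coord_idx g k. \<Sum>c'\<in>coord_idx g k. \<Sum>x\<in>Zgk g k. l c * l c' * (Zmap g k x c * Zmap g k x c'))"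
    by (intro sum.cong refl sum.swap)
  also have "\<dots> = real g ^ k * Mform g k l"
    by (simp only: sum_distrib_left[symmetric] sum_Zmap_Zmap cong: sum.cong)
      (simp add: Mform_def sum_distrib_left mult_ac)
  finally show ?thesis .
qed

text \<open>The source of the quantity \<open>d * \<delta>\<close> in all error factors: there are
  \<open>d\<close> coordinates, and each entry of \<open>Zmap\<close> is at most 1 in absolute
  value.\<close>

lemma abs_zdot_le:
  assumes "\<And>c. c \<in> coord_idx g k \<Longrightarrow> \<bar>l c\<bar> \<le> \<delta>"
  shows "\<bar>zdot g k l x\<bar> \<le> real ((k choose 2) * (g - 1)) * \<delta>"
proof -
  have "\<bar>zdot g k l x\<bar> \<le> (\<Sum>c\<in>coord_idx g k. \<bar>l c * Zmap g k x c\<bar>)"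
    unfolding zdot_def by (rule sum_abs)
  also have "\<dots> \<le> (\<Sum>c\<in>coord_idx g k. \<delta> * 1)"
  proof (rule sum_mono)
    fix c assume c: "c \<in> coord_idx g k"
    hence "g \<ge> 1" by (auto simp: coord_idx_eq)
    hence "\<bar>Zmap g k x c\<bar> \<le> 1"
      using c by (cases c) (auto simp: Zmap_diff_mod abs_le_iff field_simps)
    thus "\<bar>l c * Zmap g k x c\<bar> \<le> \<delta> * 1"
      unfolding abs_mult using assms[OF c] by (intro mult_mono) auto
  qed
  finally show ?thesis by (simp add: card_coord_idx)
qed

section \<open>The characteristic function near the origin\<close>

lemma abs_cos_minus_Taylor2_le: "\<bar>cos x - (1 - x\<^sup>2 / 2)\<bar> \<le> x ^ 4 / 24" for x :: real
proof -
  obtain t where t: "cos x = (\<Sum>m<4. cos_coeff m * x ^ m) + (cos (t + 1/2 * real 4 * pi) / fact 4) * x ^ 4"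
    using Maclaurin_cos_expansion[of x 4] by blast
  have "(\<Sum>m<4. cos_coeff m * x ^ m) = 1 - x\<^sup>2 / 2"
    by (simp add: lessThan_nat_numeral cos_coeff_def fact_numeral)
  with t have "cos x - (1 - x\<^sup>2 / 2) = cos (t + 2 * pi) * (x ^ 4 / 24)"
    by (simp add: fact_numeral)
  also have "\<bar>\<dots>\<bar> \<le> 1 * (x ^ 4 / 24)"
    unfolding abs_mult by (intro mult_mono) auto
  finally show ?thesis by simp
qed

lemma cos_ge_Taylor1: "1 - z\<^sup>2 / 2 \<le> cos z" for z :: real
proof -
  have "(sin (z / 2))\<^sup>2 \<le> (z / 2)\<^sup>2" using abs_sin_x_le_abs_x[of "z / 2"] by (subst (asm) abs_le_square_iff)
  moreover have "cos z = 1 - 2 * (sin (z / 2))\<^sup>2" using cos_double_sin[of "z / 2"] by simp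
  ultimately show ?thesis by (simp add: power_divide)
qed

lemma abs_sin_minus_id_le: "\<bar>sin x - x\<bar> \<le> \<bar>x\<bar> ^ 3 / 6" for x :: real
  using Maclaurin_sin_bound[of x 3] by (simp add: lessThan_nat_numeral sin_coeff_def fact_numeral)

lemma exp_minus_le_Taylor2:
  fixes y :: real
  assumes "y \<ge> 0"
  shows "exp (- y) \<le> 1 - y + y\<^sup>2 / 2"
proof -
  define f where "f = (\<lambda>y::real. 1 - y + y\<^sup>2 / 2 - exp (- y))"
  have "f 0 \<le> f y"
  proof (rule DERIV_nonneg_imp_nondecreasing[OF assms])
    fix x :: real assume "0 \<le> x"
    have "(f has_real_derivative (- 1 + x + exp (- x))) (at x)"
      unfolding f_def by (auto intro!: derivative_eq_intros)
    moreover have "- 1 + x + exp (- x) \<ge> 0" using exp_ge_add_one_self[of "- x"] by linarith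
    ultimately show "\<exists>y. (f has_real_derivative y) (at x) \<and> 0 \<le> y" by blast
  qed
  thus ?thesis by (simp add: f_def)
qed

locale near_origin =
  fixes g k :: nat and \<delta> \<rho> :: real and l :: "idx \<Rightarrow> real"
  assumes g: "g \<ge> 1"
    and l: "\<And>c. c \<in> coord_idx g k \<Longrightarrow> \<bar>l c\<bar> \<le> \<delta>"
    and rho_def: "\<rho> = real ((k choose 2) * (g - 1)) * \<delta>"
    and rho: "0 < \<rho>" "\<rho> \<le> 1"
begin

abbreviation "q \<equiv> Mform g k l"

lemma abs_zdot: "\<bar>zdot g k l x\<bar> \<le> \<rho>"
  unfolding rho_def by (rule abs_zdot_le) (fact l)

lemma abs_zdot_power: "\<bar>zdot g k l x\<bar> ^ n \<le> \<rho> ^ n"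
  using abs_zdot by (intro power_mono) auto

lemma avg_le:
  fixes f :: "(nat \<Rightarrow> nat) \<Rightarrow> real"
  assumes "\<And>x. f x \<le> C"
  shows "(\<Sum>x\<in>Zgk g k. f x) / real g ^ k \<le> C"
proof -
  have "(\<Sum>x\<in>Zgk g k. f x) \<le> real g ^ k * C"
    using sum_bounded_above[of "Zgk g k" f C] assms by (simp add: card_Zgk)
  thus ?thesis using g by (simp add: field_simps)
qed

lemma q_bounds: "0 \<le> q" "q \<le> \<rho>\<^sup>2"
proof -
  have q: "q = (\<Sum>x\<in>Zgk g k. (zdot g k l x)\<^sup>2) / real g ^ k"
    using g by (simp add: sum_zdot_squared)
  show "0 \<le> q" unfolding q by (intro divide_nonneg_nonneg sum_nonneg) auto
  show "q \<le> \<rho>\<^sup>2" unfolding q using abs_zdot_power[of _ 2] by (intro avg_le) simp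
qed

lemma Re_phi: "Re (phi g k l) = (\<Sum>x\<in>Zgk g k. cos (zdot g k l x)) / real g ^ k"
  and Im_phi: "Im (phi g k l) = (\<Sum>x\<in>Zgk g k. sin (zdot g k l x)) / real g ^ k"
  by (simp_all add: phi_def Re_divide_of_nat Im_divide_of_nat del: of_nat_power)

lemma abs_Re_phi_minus: "\<bar>Re (phi g k l) - (1 - q / 2)\<bar> \<le> \<rho> ^ 4 / 24"
proof -
  have "Re (phi g k l) - (1 - q / 2) = (\<Sum>x\<in>Zgk g k. cos (zdot g k l x) - (1 - (zdot g k l x)\<^sup>2 / 2)) / real g ^ k"
    using g by (simp add: Re_phi sum_subtractf sum_zdot_squared card_Zgk diff_divide_distrib sum_divide_distrib[symmetric])
  also have "\<bar>\<dots>\<bar> \<le> (\<Sum>x\<in>Zgk g k. \<bar>cos (zdot g k l x) - (1 - (zdot g k l x)\<^sup>2 / 2)\<bar>) / real g ^ k"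
    by (simp add: divide_right_mono sum_abs)
  also have "\<dots> \<le> \<rho> ^ 4 / 24"
  proof (rule avg_le)
    fix x
    have "\<bar>zdot g k l x\<bar> ^ 4 \<le> \<rho> ^ 4" by (rule abs_zdot_power)
    thus "\<bar>cos (zdot g k l x) - (1 - (zdot g k l x)\<^sup>2 / 2)\<bar> \<le> \<rho> ^ 4 / 24"
      using abs_cos_minus_Taylor2_le[of "zdot g k l x"] by (simp add: power_even_abs)
  qed
  finally show ?thesis .
qed

lemma Re_phi_ge: "Re (phi g k l) \<ge> 1 - q / 2"
proof -
  have "1 - Re (phi g k l) = (\<Sum>x\<in>Zgk g k. 1 - cos (zdot g k l x)) / real g ^ k"
    using g by (simp add: Re_phi sum_subtractf card_Zgk diff_divide_distrib)
  also have "\<dots> \<le> (\<Sum>x\<in>Zgk g k. (zdot g k l x)\<^sup>2 / 2) / real g ^ k"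
  proof (intro divide_right_mono sum_mono)
    fix x
    show "1 - cos (zdot g k l x) \<le> (zdot g k l x)\<^sup>2 / 2"
      using cos_ge_Taylor1[of "zdot g k l x"] by simp
  qed simp
  also have "\<dots> = q / 2"
    using g by (simp add: sum_divide_distrib[symmetric] sum_zdot_squared)
  finally show ?thesis by simp
qed

text \<open>The linear term of the sine averages to zero because the steps are centred, so only the
  cubic remainder survives.\<close>

lemma abs_Im_phi: "\<bar>Im (phi g k l)\<bar> \<le> \<rho> ^ 3 / 6"
proof -
  have "Im (phi g k l) = (\<Sum>x\<in>Zgk g k. sin (zdot g k l x) - zdot g k l x) / real g ^ k"
    by (simp add: Im_phi sum_subtractf sum_zdot)
  also have "\<bar>\<dots>\<bar> \<le> (\<Sum>x\<in>Zgk g k. \<bar>sin (zdot g k l x) - zdot g k l x\<bar>) / real g ^ k"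
    by (simp add: divide_right_mono sum_abs)
  also have "\<dots> \<le> \<rho> ^ 3 / 6"
  proof (rule avg_le)
    fix x
    have "\<bar>zdot g k l x\<bar> ^ 3 \<le> \<rho> ^ 3" by (rule abs_zdot_power)
    thus "\<bar>sin (zdot g k l x) - zdot g k l x\<bar> \<le> \<rho> ^ 3 / 6"
      using abs_sin_minus_id_le[of "zdot g k l x"] by simp
  qed
  finally show ?thesis .
qed

lemma Re_phi_half: "Re (phi g k l) \<ge> 1 / 2"
proof -
  have "\<rho>\<^sup>2 \<le> 1" using rho by (simp add: power_le_one)
  thus ?thesis using Re_phi_ge q_bounds by linarith
qed

text \<open>Since \<open>q \<le> 1\<close>, the exponential is at least 1/2, so the factor with
  \<open>\<rho> ^ 4 / 3\<close> subtracts at least \<open>\<rho> ^ 4 / 6\<close>; this absorbs the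
  excess \<open>\<rho> ^ 4 / 8\<close> of the exponential over \<open>1 - q / 2\<close>.\<close>

lemma Re_phi_lower: "exp (- q / 2) * (1 - \<rho> ^ 4 / 3) \<le> Re (phi g k l)"
proof -
  have "\<rho>\<^sup>2 \<le> 1" using rho by (simp add: power_le_one)
  hence "1 / 2 \<le> exp (- q / 2)" using exp_ge_add_one_self[of "- q / 2"] q_bounds by linarith
  hence 1: "1 / 2 * (\<rho> ^ 4 / 3) \<le> exp (- q / 2) * (\<rho> ^ 4 / 3)" by (intro mult_right_mono) auto
  have "exp (- (q / 2)) \<le> 1 - q / 2 + (q / 2)\<^sup>2 / 2"
    by (rule exp_minus_le_Taylor2) (use q_bounds in auto)
  moreover have "q\<^sup>2 \<le> (\<rho>\<^sup>2)\<^sup>2" using q_bounds by (intro power_mono) auto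
  ultimately have "exp (- q / 2) \<le> 1 - q / 2 + \<rho> ^ 4 / 8" by (simp add: power_divide)
  with 1 Re_phi_ge have "exp (- q / 2) - exp (- q / 2) * (\<rho> ^ 4 / 3) \<le> Re (phi g k l)"
    using zero_le_power[of \<rho> 4] rho by linarith
  thus ?thesis by (simp add: right_diff_distrib)
qed

text \<open>The relative slack \<open>\<rho> ^ 4 / 3\<close> is worth at least
  \<open>\<rho> ^ 4 / 6\<close>, which exceeds the cosine error
  \<open>\<rho> ^ 4 / 24\<close>.\<close>

lemma Re_phi_upper: "Re (phi g k l) \<le> exp (- q / 2) * (1 + \<rho> ^ 4 / 3)"
proof -
  have "\<rho>\<^sup>2 \<le> 1" using rho by (simp add: power_le_one)
  hence "1 / 2 \<le> exp (- q / 2)" "1 - q / 2 \<le> exp (- q / 2)" using exp_ge_add_one_self[of "- q / 2"] q_bounds by linarith+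
  moreover from this(1) have "1 / 2 * (\<rho> ^ 4 / 3) \<le> exp (- q / 2) * (\<rho> ^ 4 / 3)" by (intro mult_right_mono) auto
  moreover have "\<rho> ^ 4 \<ge> 0" by simp
  ultimately have "Re (phi g k l) \<le> exp (- q / 2) + exp (- q / 2) * (\<rho> ^ 4 / 3)"
    using abs_le_D1[OF abs_Re_phi_minus] by linarith
  thus ?thesis by (simp add: distrib_left)
qed

text \<open>The tangent of the argument of \<open>phi\<close>; as the real part is at least 1/2,
  \<open>arctan \<tau>\<close> is the argument itself.\<close>

definition "\<tau> = Im (phi g k l) / Re (phi g k l)"

lemma abs_tau: "\<bar>\<tau>\<bar> \<le> \<rho> ^ 3 / 3"
proof -
  have "\<bar>\<tau>\<bar> \<le> (\<rho> ^ 3 / 6) / (1 / 2)"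
  proof -
    have "1 / 2 \<le> \<bar>Re (phi g k l)\<bar>" using Re_phi_half by linarith
    moreover have "0 \<le> \<rho> ^ 3 / 6" using rho by simp
    ultimately show ?thesis unfolding \<tau>_def abs_divide using abs_Im_phi by (intro frac_le) simp_all
  qed
  thus ?thesis by simp
qed

lemma phi_polar: "phi g k l = of_real (Re (phi g k l) * sqrt (1 + \<tau>\<^sup>2)) * cis (arctan \<tau>)"
proof -
  have "1 + \<tau>\<^sup>2 > 0" by (simp add: add_pos_nonneg)
  hence s: "1 + \<tau>\<^sup>2 \<noteq> 0" by linarith
  have "Re (phi g k l) * \<tau> = Im (phi g k l)" using Re_phi_half by (simp add: \<tau>_def)
  moreover have "sqrt (1 + \<tau>\<^sup>2) * cos (arctan \<tau>) = 1" "sqrt (1 + \<tau>\<^sup>2) * sin (arctan \<tau>) = \<tau>"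
    using s by (simp_all add: cos_arctan sin_arctan)
  ultimately show ?thesis by (intro complex_eqI) (simp_all add: mult.assoc)
qed

lemma norm_phi_power_le:
  "norm (phi g k l ^ t) \<le> (1 + \<rho> ^ 6 / 4) powr (real t / 2) * (1 + \<rho> ^ 4 / 3) ^ t * exp (- real t / 2 * q)"
proof -
  \<comment> \<open>The bound on \<open>\<tau>\<close> gives \<open>\<rho> ^ 6 / 9\<close>, which is
    rounded up to the constant 1/4 of \<open>Ufun\<close>.\<close>
  have "\<tau>\<^sup>2 \<le> (\<rho> ^ 3 / 3)\<^sup>2" using abs_tau rho abs_le_square_iff[of \<tau> "\<rho> ^ 3 / 3"] by simp
  also have "\<dots> \<le> \<rho> ^ 6 / 4" by (simp add: power_divide power_mult[symmetric])
  finally have tau: "sqrt (1 + \<tau>\<^sup>2) \<le> sqrt (1 + \<rho> ^ 6 / 4)" by simp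
  have "norm (phi g k l) = \<bar>Re (phi g k l)\<bar> * sqrt (1 + \<tau>\<^sup>2)"
    by (subst phi_polar) (simp add: norm_mult abs_mult)
  also have "\<dots> \<le> (exp (- q / 2) * (1 + \<rho> ^ 4 / 3)) * sqrt (1 + \<rho> ^ 6 / 4)"
    using Re_phi_upper Re_phi_half tau rho by (intro mult_mono) auto
  finally have "norm (phi g k l ^ t) \<le> ((exp (- q / 2) * (1 + \<rho> ^ 4 / 3)) * sqrt (1 + \<rho> ^ 6 / 4)) ^ t"
    unfolding norm_power by (intro power_mono) auto
  also have "\<dots> = sqrt (1 + \<rho> ^ 6 / 4) ^ t * (1 + \<rho> ^ 4 / 3) ^ t * exp (- real t / 2 * q)"
    by (simp add: power_mult_distrib exp_of_nat_mult[symmetric])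
  also have "sqrt (1 + \<rho> ^ 6 / 4) ^ t = (1 + \<rho> ^ 6 / 4) powr (real t / 2)"
  proof -
    have "1 + \<rho> ^ 6 / 4 > 0" using rho by (intro add_pos_nonneg) auto
    thus ?thesis by (simp add: powr_half_sqrt[symmetric] powr_realpow[symmetric] powr_powr)
  qed
  finally show ?thesis .
qed

text \<open>The argument of \<open>phi ^ t\<close> is at most \<open>w = t * \<rho>^3 / 3\<close>,
  and the bound on \<open>t\<close> makes this at most 2/3. There \<open>1 - w^2 / 2\<close>
  dominates \<open>1 / sqrt (1 + 9 * w^2)\<close>, and \<open>9 * w^2 = t^2 * \<rho>^6\<close> turns
  this into the first factor of \<open>Lfun\<close>.\<close>

lemma Re_phi_power_ge:
  assumes t: "real t < 2 / \<rho> ^ 3"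
  shows "Re (phi g k l ^ t) \<ge> (1 + (real t)\<^sup>2 * \<rho> ^ 6) powr (- 1 / 2) * (1 - \<rho> ^ 4 / 3) ^ t * exp (- real t / 2 * q)"
proof -
  define w where "w = real t * \<rho> ^ 3 / 3"
  have "\<rho> ^ 3 > 0" using rho by simp
  hence w: "0 \<le> w" "w \<le> 2 / 3" using t by (auto simp: w_def field_simps)
  define \<theta> where "\<theta> = real t * arctan \<tau>"
  have "\<bar>\<theta>\<bar> \<le> w"
  proof -
    have "\<bar>arctan \<tau>\<bar> \<le> \<rho> ^ 3 / 3" using abs_arctan_le abs_tau order_trans by blast
    hence "real t * \<bar>arctan \<tau>\<bar> \<le> real t * (\<rho> ^ 3 / 3)" by (intro mult_left_mono) auto
    thus ?thesis by (simp add: \<theta>_def w_def abs_mult)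
  qed
  hence th2: "\<theta>\<^sup>2 \<le> w\<^sup>2" using w by (metis abs_le_square_iff abs_of_nonneg)
  have w2: "w\<^sup>2 \<le> 4 / 9" using power_mono[OF w(2,1), of 2] by (simp add: power_divide)
  have cosw: "1 - w\<^sup>2 / 2 \<le> cos \<theta>"
    using th2 cos_ge_Taylor1[of \<theta>] by simp
  have "1 \<le> (1 - w\<^sup>2 / 2)\<^sup>2 * (1 + 9 * w\<^sup>2)"
  proof -
    \<comment> \<open>This is the surplus of \<open>(1 - w^2) * (1 + 9 * w^2)\<close> over 1,
      nonnegative because \<open>w^2 \<le> 4/9\<close>.\<close>
    have "0 \<le> w\<^sup>2 * (8 - 9 * w\<^sup>2)" using w2 by (intro mult_nonneg_nonneg) auto
    hence "1 \<le> (1 - w\<^sup>2) * (1 + 9 * w\<^sup>2)" by (simp add: algebra_simps)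
    also have "\<dots> \<le> (1 - w\<^sup>2 / 2)\<^sup>2 * (1 + 9 * w\<^sup>2)"
    proof (rule mult_right_mono)
      have "(1 - w\<^sup>2 / 2)\<^sup>2 = 1 - w\<^sup>2 + (w\<^sup>2 / 2)\<^sup>2" by (simp add: power2_diff)
      thus "1 - w\<^sup>2 \<le> (1 - w\<^sup>2 / 2)\<^sup>2" by simp
    qed simp
    finally show ?thesis .
  qed
  hence "1 \<le> (1 - w\<^sup>2 / 2) * sqrt (1 + 9 * w\<^sup>2)"
    using w2 real_sqrt_le_mono[of 1 "(1 - w\<^sup>2 / 2)\<^sup>2 * (1 + 9 * w\<^sup>2)"] by (simp add: real_sqrt_mult)
  moreover have "sqrt (1 + 9 * w\<^sup>2) > 0" by (simp add: add_pos_nonneg)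
  ultimately have "1 / sqrt (1 + 9 * w\<^sup>2) \<le> 1 - w\<^sup>2 / 2" by (simp add: field_simps)
  moreover have "9 * w\<^sup>2 = (real t)\<^sup>2 * \<rho> ^ 6"
    by (simp add: w_def power_mult_distrib power_divide power_mult[symmetric])
  moreover have "(1 + (real t)\<^sup>2 * \<rho> ^ 6) powr (- 1 / 2) = 1 / sqrt (1 + (real t)\<^sup>2 * \<rho> ^ 6)"
    by (simp add: powr_minus_divide powr_half_sqrt add_nonneg_nonneg)
  ultimately have cos: "(1 + (real t)\<^sup>2 * \<rho> ^ 6) powr (- 1 / 2) \<le> cos \<theta>" using cosw by simp
  have rho4: "0 \<le> 1 - \<rho> ^ 4 / 3" using rho power_le_one[of \<rho> 4] by simp
  have "exp (- q / 2) * (1 - \<rho> ^ 4 / 3) \<le> Re (phi g k l) * sqrt (1 + \<tau>\<^sup>2)"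
    using mult_mono[OF Re_phi_lower, of 1 "sqrt (1 + \<tau>\<^sup>2)"] Re_phi_half by simp
  hence "(exp (- q / 2) * (1 - \<rho> ^ 4 / 3)) ^ t \<le> (Re (phi g k l) * sqrt (1 + \<tau>\<^sup>2)) ^ t"
    using rho4 by (intro power_mono) auto
  moreover have "Re (phi g k l ^ t) = (Re (phi g k l) * sqrt (1 + \<tau>\<^sup>2)) ^ t * cos \<theta>"
  proof -
    have "phi g k l ^ t = of_real (Re (phi g k l) * sqrt (1 + \<tau>\<^sup>2)) ^ t * cis (arctan \<tau>) ^ t"
      by (subst phi_polar) (rule power_mult_distrib)
    also have "\<dots> = of_real ((Re (phi g k l) * sqrt (1 + \<tau>\<^sup>2)) ^ t) * cis \<theta>"
      by (simp only: Complex.DeMoivre of_real_power \<theta>_def)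
    finally show ?thesis by (simp only: Re_complex_of_real times_complex.sel Im_complex_of_real cis.sel mult_zero_left diff_zero)
  qed
  moreover have "(exp (- q / 2) * (1 - \<rho> ^ 4 / 3)) ^ t = (1 - \<rho> ^ 4 / 3) ^ t * exp (- real t / 2 * q)"
    by (simp add: power_mult_distrib exp_of_nat_mult[symmetric])
  ultimately show ?thesis
    using mult_mono[of "(exp (- q / 2) * (1 - \<rho> ^ 4 / 3)) ^ t" "(Re (phi g k l) * sqrt (1 + \<tau>\<^sup>2)) ^ t" _ "cos \<theta>", OF _ cos]
      rho4 Re_phi_half by (simp add: mult_ac)
qed

end

section \<open>Approximate homomorphisms of cyclic groups\<close>

definition near_2pi :: "real \<Rightarrow> real \<Rightarrow> bool" where
  "near_2pi e u \<longleftrightarrow> (\<exists>n::int. \<bar>u - 2 * pi * n\<bar> \<le> e)"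

lemma near_2pi_add:
  assumes "near_2pi e u" "near_2pi e' v"
  shows "near_2pi (e + e') (u + v)"
proof -
  obtain m n :: int where "\<bar>u - 2 * pi * m\<bar> \<le> e" "\<bar>v - 2 * pi * n\<bar> \<le> e'"
    using assms by (auto simp: near_2pi_def)
  hence "\<bar>u + v - 2 * pi * (m + n)\<bar> \<le> e + e'" by (simp add: distrib_left)
  thus ?thesis unfolding near_2pi_def by (metis of_int_add)
qed

lemma near_2pi_uminus:
  assumes "near_2pi e u"
  shows "near_2pi e (- u)"
proof -
  obtain n :: int where "\<bar>u - 2 * pi * n\<bar> \<le> e" using assms by (auto simp: near_2pi_def)
  hence "\<bar>- u - 2 * pi * of_int (- n)\<bar> \<le> e" by simp
  thus ?thesis unfolding near_2pi_def by blast
qed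

lemma near_2pi_diff: "near_2pi e u \<Longrightarrow> near_2pi e' v \<Longrightarrow> near_2pi (e + e') (u - v)"
  using near_2pi_add[OF _ near_2pi_uminus] by fastforce

lemma near_2pi_sum:
  fixes e :: real
  assumes "finite A" "\<And>a. a \<in> A \<Longrightarrow> near_2pi e (f a)"
  shows "near_2pi (card A * e) (\<Sum>a\<in>A. f a)"
  using assms
proof (induction A rule: finite_induct)
  case empty
  have "\<bar>0 - 2 * pi * of_int 0\<bar> \<le> 0" by simp
  thus ?case unfolding near_2pi_def by (metis card.empty sum.empty mult_zero_left of_nat_0)
next
  case (insert a A)
  have "near_2pi (e + card A * e) (f a + (\<Sum>a\<in>A. f a))"
    using insert by (intro near_2pi_add) auto
  thus ?case using insert by (simp add: algebra_simps)
qed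

lemma near_2pi_shift: "near_2pi e (u + 2 * pi * of_int n) \<longleftrightarrow> near_2pi e u"
proof -
  have *: "near_2pi e (u + 2 * pi * of_int n)" if u: "near_2pi e u" for u n
  proof -
    obtain m :: int where "\<bar>u - 2 * pi * m\<bar> \<le> e" using u by (auto simp: near_2pi_def)
    hence "\<bar>u + 2 * pi * n - 2 * pi * of_int (m + n)\<bar> \<le> e" by (simp add: algebra_simps)
    thus ?thesis unfolding near_2pi_def by blast
  qed
  show ?thesis using *[of u n] *[of "u + 2 * pi * n" "- n"] by auto
qed

text \<open>The defect of an approximate homomorphism is a 2-cocycle modulo \<open>2 \<pi>\<close>; being small it is a real
  cocycle, hence the coboundary of its average, and subtracting that gives an exact homomorphism.\<close>
lemma approx_hom_cyclic:
  fixes f :: "nat \<Rightarrow> real"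
  assumes g: "g \<ge> 2" and e: "4 * e < 2 * pi"
    and hom: "\<And>a b. a < g \<Longrightarrow> b < g \<Longrightarrow> near_2pi e (f ((a + b) mod g) - f a - f b)"
  shows "\<exists>c<g. \<forall>a<g. near_2pi e (f a - 2 * pi * ((c * a) mod g) / g)"
proof -
  have "\<exists>n::int. a < g \<longrightarrow> b < g \<longrightarrow> \<bar>f ((a + b) mod g) - f a - f b - 2 * pi * n\<bar> \<le> e" for a b
    using hom[of a b] by (auto simp: near_2pi_def)
  then obtain n :: "nat \<Rightarrow> nat \<Rightarrow> int" where
    n: "\<And>a b. a < g \<Longrightarrow> b < g \<Longrightarrow> \<bar>f ((a + b) mod g) - f a - f b - 2 * pi * n a b\<bar> \<le> e" by metis
  define E where "E = (\<lambda>a b. f ((a + b) mod g) - f a - f b - 2 * pi * n a b)"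
  have E: "\<bar>E a b\<bar> \<le> e" if "a < g" "b < g" for a b using n that by (simp add: E_def)
  have g0: "g > 0" using g by simp
  \<comment> \<open>By associativity all values of \<open>f\<close> cancel, leaving
    \<open>2 * pi * z\<close> with an integer \<open>z\<close>; a size of at most
    \<open>4 * e < 2 * pi\<close> forces \<open>z = 0\<close>.\<close>
  have cocycle: "E b c - E ((a + b) mod g) c + E a ((b + c) mod g) - E a b = 0"
    if abc: "a < g" "b < g" "c < g" for a b c
  proof -
    define z where "z = - n b c + n ((a + b) mod g) c - n a ((b + c) mod g) + n a b"
    have "((a + b) mod g + c) mod g = (a + (b + c) mod g) mod g"
      by (simp add: mod_simps add.assoc)
    hence K: "E b c - E ((a + b) mod g) c + E a ((b + c) mod g) - E a b = 2 * pi * z"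
      unfolding E_def z_def by (simp add: algebra_simps)
    have "\<bar>E b c - E ((a + b) mod g) c + E a ((b + c) mod g) - E a b\<bar> \<le> 4 * e"
      using E[of b c] E[of "(a + b) mod g" c] E[of a "(b + c) mod g"] E[of a b] abc g0
      by (simp add: abs_le_iff)
    hence "pi * \<bar>real_of_int z\<bar> \<le> 2 * e" unfolding K by (simp add: abs_mult)
    hence "pi * \<bar>real_of_int z\<bar> < pi * 1" using e by linarith
    hence "\<bar>real_of_int z\<bar> < 1" by (rule mult_less_cancel_left_pos[OF pi_gt_zero, THEN iffD1])
    hence "z = 0" by linarith
    thus ?thesis by (simp add: K)
  qed
  define N where "N = (\<lambda>a. \<Sum>c<g. E a c)"
  have N_shift: "(\<Sum>c<g. E a ((b + c) mod g)) = N a" for a b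
  proof -
    have "inj_on (\<lambda>c. (b + c) mod g) {..<g}"
    proof (rule inj_onI)
      fix x y assume xy: "x \<in> {..<g}" "y \<in> {..<g}" "(b + x) mod g = (b + y) mod g"
      hence "[b + x = b + y] (mod g)" by (simp add: cong_def)
      hence "[x = y] (mod g)" by (simp add: cong_add_lcancel_nat)
      thus "x = y" using xy by (simp add: cong_def)
    qed
    moreover from this have "(\<lambda>c. (b + c) mod g) ` {..<g} = {..<g}"
      by (intro endo_inj_surj) (use g0 in auto)
    ultimately show ?thesis
      unfolding N_def by (intro sum.reindex_cong[of "\<lambda>c. (b + c) mod g", symmetric]) auto
  qed
  \<comment> \<open>Summing the cocycle identity over its third argument exhibits \<open>E\<close>
    as the coboundary of \<open>N / g\<close>; being an average, \<open>N a / g\<close> is again at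
    most \<open>e\<close>, whatever \<open>a\<close> is.\<close>
  have cob: "E a b = N a / g + N b / g - N ((a + b) mod g) / g" if ab: "a < g" "b < g" for a b
  proof -
    have "(\<Sum>c<g. E b c - E ((a + b) mod g) c + E a ((b + c) mod g) - E a b) = 0"
      using cocycle[OF ab] by simp
    hence "N b - N ((a + b) mod g) + N a - g * E a b = 0"
      using N_shift[of a b] by (simp add: sum_subtractf sum.distrib N_def)
    thus ?thesis using g0 by (simp add: field_simps)
  qed
  have N_le: "\<bar>N a / g\<bar> \<le> e" if "a < g" for a
  proof -
    have "\<bar>N a\<bar> \<le> (\<Sum>c<g. \<bar>E a c\<bar>)" unfolding N_def by (rule sum_abs)
    also have "\<dots> \<le> g * e" using sum_bounded_above[of "{..<g}" "\<lambda>c. \<bar>E a c\<bar>" e] E that by simp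
    finally show ?thesis using g0 by (simp add: field_simps)
  qed
  define h where "h = (\<lambda>a. f a + N a / g)"
  have h: "h ((a + b) mod g) = h a + h b + 2 * pi * n a b" if "a < g" "b < g" for a b
    using cob[OF that] by (simp add: h_def E_def)
  have lin: "\<exists>m::int. h a = a * h 1 + 2 * pi * m" if "a < g" for a
    using that
  proof (induction a)
    case 0
    have "h 0 = 0 * h 1 + 2 * pi * of_int (- n 0 0)" using h[of 0 0] g0 by simp
    thus ?case by (metis of_nat_0)
  next
    case (Suc a)
    then obtain m :: int where m: "h a = a * h 1 + 2 * pi * m" by auto
    have "h (Suc a) = h a + h 1 + 2 * pi * n a 1" using h[of a 1] Suc.prems g by simp
    hence "h (Suc a) = real (Suc a) * h 1 + 2 * pi * of_int (m + n a 1)"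
      by (simp add: m algebra_simps)
    thus ?case by blast
  qed
  obtain m0 m1 :: int where m0: "h 0 = 0 * h 1 + 2 * pi * m0" and m1: "h (g - 1) = real (g - 1) * h 1 + 2 * pi * m1"
    using lin[of 0] lin[of "g - 1"] g0 by auto
  define M where "M = m0 - m1 - n (g - 1) 1"
  have "h 0 = h (g - 1) + h 1 + 2 * pi * n (g - 1) 1" using h[of "g - 1" 1] g by simp
  \<comment> \<open>The step from \<open>g - 1\<close> back to 0 closes the cycle and quantises
    \<open>h 1\<close> to a multiple of \<open>2 * pi / g\<close>.\<close>
  hence gh: "g * h 1 = 2 * pi * M" using m0 m1 g by (simp add: M_def algebra_simps of_nat_diff)
  define c where "c = nat (M mod int g)"
  have c: "c < g" "M = int c + int g * (M div int g)" using g0 by (auto simp: c_def nat_less_iff)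
  have "near_2pi e (f a - 2 * pi * ((c * a) mod g) / g)" if a: "a < g" for a
  proof -
    obtain m :: int where m: "h a = a * h 1 + 2 * pi * m" using lin[OF a] by blast
    have "h 1 = 2 * pi * M / g" using gh g0 by (simp add: field_simps)
    also have "real_of_int M = real c + real g * (M div int g)" by (subst c(2)) simp
    finally have h1: "h 1 = 2 * pi * c / g + 2 * pi * (M div int g)" using g0 by (simp add: field_simps)
    have "real (c * a) = real ((c * a) mod g) + real g * ((c * a) div g)"
      by (metis mod_mult_div_eq of_nat_add of_nat_mult)
    hence "2 * pi * (c * a) / g = 2 * pi * ((c * a) mod g) / g + 2 * pi * ((c * a) div g)"
      using g0 by (simp add: field_simps)
    hence "h a = 2 * pi * ((c * a) mod g) / g + 2 * pi * of_int (int ((c * a) div g) + int a * (M div int g) + m)"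
      using m h1 by (simp add: algebra_simps)
    hence "f a - 2 * pi * ((c * a) mod g) / g - 2 * pi * of_int (int ((c * a) div g) + int a * (M div int g) + m) = - (N a / g)"
      by (simp add: h_def)
    hence "\<bar>f a - 2 * pi * ((c * a) mod g) / g - 2 * pi * of_int (int ((c * a) div g) + int a * (M div int g) + m)\<bar> \<le> e"
      using N_le[OF a] by simp
    thus ?thesis unfolding near_2pi_def by blast
  qed
  thus ?thesis using c by blast
qed

section \<open>The characteristic function away from its maximum\<close>

text \<open>Extends the coordinates of a pair to a function on all residues; the residue 0, which
  has no coordinate, gets the value that a homomorphism takes there.\<close>

definition slot :: "(idx \<Rightarrow> real) \<Rightarrow> nat \<times> nat \<Rightarrow> nat \<Rightarrow> real" where
  "slot l p b = (if b = 0 then 0 else l (p, b))"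

definition phase :: "nat \<Rightarrow> nat \<Rightarrow> (idx \<Rightarrow> real) \<Rightarrow> (nat \<Rightarrow> nat) \<Rightarrow> real" where
  "phase g k l x = (\<Sum>p\<in>pair_idx k. slot l p (diff_mod g x p))"

text \<open>The entries \<open>- 1 / g\<close> contribute a constant independent of
  \<open>x\<close>, so phase differences may be computed without the centring.\<close>

lemma zdot_phase:
  assumes g: "g \<ge> 1"
  shows "zdot g k l x = phase g k l x - (\<Sum>c\<in>coord_idx g k. l c) / g"
proof -
  have "zdot g k l x = (\<Sum>c\<in>coord_idx g k. (if diff_mod g x (fst c) = snd c then l c else 0) - l c / g)"
    unfolding zdot_def by (rule sum.cong) (auto simp: Zmap_diff_mod algebra_simps)
  also have "\<dots> = (\<Sum>c\<in>coord_idx g k. (if diff_mod g x (fst c) = snd c then l c else 0)) - (\<Sum>c\<in>coord_idx g k. l c) / g"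
    by (simp add: sum_subtractf sum_divide_distrib)
  also have "(\<Sum>c\<in>coord_idx g k. (if diff_mod g x (fst c) = snd c then l c else 0))
      = (\<Sum>p\<in>pair_idx k. \<Sum>a=1..g-1. (if diff_mod g x p = a then l (p, a) else 0))"
    by (simp only: coord_idx_eq sum.cartesian_product split_def prod.collapse)
  also have "\<dots> = phase g k l x"
    unfolding phase_def
  proof (rule sum.cong[OF refl])
    fix p
    have "diff_mod g x p \<noteq> 0 \<longleftrightarrow> diff_mod g x p \<in> {1..g-1}" using diff_mod_less[OF g, of x p] by auto
    thus "(\<Sum>a=1..g-1. (if diff_mod g x p = a then l (p, a) else 0)) = slot l p (diff_mod g x p)"
      by (simp add: slot_def sum.delta')
  qed
  finally show ?thesis .
qed

lemma cis_add_int: "cis (u + 2 * pi * of_int n) = cis u"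
  by (simp add: cis_mult[symmetric] cis_multiple_2pi[of "of_int n", simplified])

text \<open>The modulus is twice the absolute cosine of half the angle between the two unit vectors,
  and that angle, taken in \<open>[0, pi]\<close>, exceeds \<open>e\<close>.\<close>

lemma norm_cis_add_le:
  assumes e: "0 \<le> e" "e \<le> pi" and "\<not> near_2pi e (\<alpha> - \<beta>)"
  shows "norm (cis \<alpha> + cis \<beta>) \<le> 2 * cos (e / 2)"
proof -
  define u where "u = \<alpha> - \<beta>"
  define n where "n = round (u / (2 * pi))"
  define r where "r = u - 2 * pi * n"
  have "\<bar>u / (2 * pi) - of_int n\<bar> \<le> 1 / 2" using of_int_round_abs_le[of "u / (2 * pi)"] by (simp add: n_def abs_minus_commute)
  moreover have "r = 2 * pi * (u / (2 * pi) - of_int n)" by (simp add: r_def right_diff_distrib)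
  ultimately have "\<bar>r\<bar> \<le> pi" by (simp add: abs_mult)
  moreover have "\<bar>r\<bar> > e" using assms(3) by (auto simp: near_2pi_def r_def u_def not_le)
  ultimately have "cos \<bar>r\<bar> \<le> cos e" using e by (intro cos_monotone_0_pi_le) auto
  moreover have "cis u = cis r" using cis_add_int[of r n] by (simp add: r_def)
  hence "cos u = cos r" by (metis cis.sel(1))
  ultimately have c: "cos u \<le> cos e" by simp
  have "(norm (cis \<alpha> + cis \<beta>))\<^sup>2 = 2 + 2 * cos u"
  proof -
    have "(norm (cis \<alpha> + cis \<beta>))\<^sup>2 = (cos \<alpha> + cos \<beta>)\<^sup>2 + (sin \<alpha> + sin \<beta>)\<^sup>2"
      by (simp add: cmod_power2)
    also have "\<dots> = ((cos \<alpha>)\<^sup>2 + (sin \<alpha>)\<^sup>2) + ((cos \<beta>)\<^sup>2 + (sin \<beta>)\<^sup>2) + 2 * (cos \<alpha> * cos \<beta> + sin \<alpha> * sin \<beta>)"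
      by algebra
    finally show ?thesis unfolding sin_cos_squared_add2 cos_diff u_def by simp
  qed
  also have "\<dots> \<le> (2 * cos (e / 2))\<^sup>2"
    using c cos_double_cos[of "e / 2"] by (simp add: power2_eq_square)
  finally show ?thesis
    by (rule power2_le_imp_le) (use e in \<open>auto intro!: cos_ge_zero\<close>)
qed

text \<open>Two summands at an angle above \<open>\<delta> / 2\<close> add up to at most
  \<open>2 * cos (\<delta> / 4)\<close> in modulus; all others are bounded trivially, which dilutes
  the gain by the factor \<open>g ^ k\<close>.\<close>

lemma norm_phi_le_of_distant_phases:
  assumes g: "g \<ge> 1" and d: "0 < \<delta>" "\<delta> \<le> 1"
    and xy: "x \<in> Zgk g k" "y \<in> Zgk g k" "\<not> near_2pi (\<delta> / 2) (phase g k l x - phase g k l y)"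
  shows "norm (phi g k l) \<le> exp (- (11/192) * \<delta>\<^sup>2 / real g ^ k)"
proof -
  let ?Z = "Zgk g k"
  have ne: "x \<noteq> y"
  proof
    assume "x = y"
    hence "\<bar>phase g k l x - phase g k l y - 2 * pi * of_int 0\<bar> \<le> \<delta> / 2" using d by simp
    thus False using xy(3) unfolding near_2pi_def by blast
  qed
  have "norm (\<Sum>z\<in>?Z. cis (zdot g k l z)) = norm ((cis (zdot g k l x) + cis (zdot g k l y)) + (\<Sum>z\<in>?Z - {x, y}. cis (zdot g k l z)))"
    using xy ne sum.subset_diff[of "{x, y}" ?Z "\<lambda>z. cis (zdot g k l z)"] by (simp add: add.commute)
  also have "\<dots> \<le> 2 * cos (\<delta> / 4) + (real g ^ k - 2)"
  proof (rule norm_triangle_le, rule add_mono)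
    have "\<not> near_2pi (\<delta> / 2) (zdot g k l x - zdot g k l y)" using xy(3) by (simp add: zdot_phase[OF g])
    moreover have "\<delta> / 2 \<le> pi" using d pi_gt3 by linarith
    ultimately show "norm (cis (zdot g k l x) + cis (zdot g k l y)) \<le> 2 * cos (\<delta> / 4)"
      using norm_cis_add_le[of "\<delta> / 2" "zdot g k l x" "zdot g k l y"] d by simp
    have "card {x, y} \<le> card ?Z" using xy by (intro card_mono) auto
    hence "card (?Z - {x, y}) = g ^ k - 2" "2 \<le> g ^ k" using xy ne by (auto simp: card_Diff_subset card_Zgk)
    hence "real (card (?Z - {x, y})) = real g ^ k - 2" by (simp add: of_nat_diff)
    thus "norm (\<Sum>z\<in>?Z - {x, y}. cis (zdot g k l z)) \<le> real g ^ k - 2"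
      using sum_norm_le[of "?Z - {x, y}" "\<lambda>z. cis (zdot g k l z)" "\<lambda>_. 1"] by simp
  qed
  finally have "norm (phi g k l) \<le> (2 * cos (\<delta> / 4) + (real g ^ k - 2)) / real g ^ k"
    using g by (simp add: phi_def norm_divide norm_power divide_right_mono)
  also have "\<dots> = 1 + - ((2 - 2 * cos (\<delta> / 4)) / real g ^ k)" using g by (simp add: field_simps)
  also have "\<dots> \<le> exp (- ((2 - 2 * cos (\<delta> / 4)) / real g ^ k))" by (rule exp_ge_add_one_self)
  also have "\<dots> \<le> exp (- (11/192) * \<delta>\<^sup>2 / real g ^ k)"
  proof -
    \<comment> \<open>The expansion \<open>2 - 2 * cos u \<ge> u^2 - u^4 / 12\<close> at
      \<open>u = \<delta> / 4\<close> starts with \<open>\<delta>^2 / 16\<close>, that is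
      \<open>12/192\<close> of \<open>\<delta>^2\<close>; the quartic term costs less than
      \<open>1/192\<close> of it.\<close>
    have "(\<delta> / 4) ^ 4 = (\<delta>\<^sup>2 / 256) * \<delta>\<^sup>2" by (simp add: power_divide flip: power_add)
    also have "\<dots> \<le> (1 / 256) * \<delta>\<^sup>2" using d by (intro mult_right_mono) (auto simp: power_le_one)
    finally have "(11/192) * \<delta>\<^sup>2 \<le> 2 - 2 * cos (\<delta> / 4)"
      using abs_le_D1[OF abs_cos_minus_Taylor2_le[of "\<delta> / 4"]] by (simp add: power_divide) (use zero_le_power2[of \<delta>] in linarith)
    hence "(11/192) * \<delta>\<^sup>2 / real g ^ k \<le> (2 - 2 * cos (\<delta> / 4)) / real g ^ k"
      by (rule divide_right_mono) simp
    thus ?thesis by simp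
  qed
  finally show ?thesis .
qed

text \<open>The signed incidence matrix of the complete graph, each edge oriented away from its
  smaller endpoint. Its kernel modulo \<open>g\<close>, the cycle space, is
  \<open>null_coeffs\<close>.\<close>

definition incidence :: "nat \<Rightarrow> nat \<times> nat \<Rightarrow> int" where
  "incidence v p = (if fst p = v then 1 else 0) - (if snd p = v then 1 else 0)"

text \<open>The coefficient vectors \<open>c\<close> for which \<open>\<Sum> c\<^sub>i\<^sub>j (x\<^sub>i - x\<^sub>j)\<close> vanishes modulo \<open>g\<close> identically in \<open>x\<close>;
  they parametrise the points where the characteristic function has modulus one.\<close>
definition null_coeffs :: "nat \<Rightarrow> nat \<Rightarrow> (nat \<times> nat \<Rightarrow> nat) set" where
  "null_coeffs g k = {c \<in> PiE (pair_idx k) (\<lambda>_. {..<g}). \<forall>v\<in>{1..k}. int g dvd (\<Sum>p\<in>pair_idx k. int (c p) * incidence v p)}"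

text \<open>Reducing modulo \<open>g\<close> picks the representative of the character with all
  values in \<open>[0, 2 * pi)\<close>; the price is that identities for it hold only modulo
  \<open>2 * pi\<close>.\<close>

definition centre :: "nat \<Rightarrow> (nat \<times> nat \<Rightarrow> nat) \<Rightarrow> idx \<Rightarrow> real" where
  "centre g c = (\<lambda>(p, a). 2 * pi * ((c p * a) mod g) / g)"

lemma slot_centre: "slot (centre g c) p b = 2 * pi * ((c p * b) mod g) / g"
  by (simp add: slot_def centre_def)

lemma phase_centre:
  assumes g: "g \<ge> 1"
  shows "\<exists>z::int. phase g k (centre g c) x = 2 * pi * (\<Sum>p\<in>pair_idx k. int (c p) * (int (x (fst p)) - int (x (snd p)))) / g + 2 * pi * z"
proof -
  have "\<exists>z::int. slot (centre g c) p (diff_mod g x p) = 2 * pi * (int (c p) * (int (x (fst p)) - int (x (snd p)))) / g + 2 * pi * z" for p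
  proof -
    define D where "D = int (c p) * (int (x (fst p)) - int (x (snd p)))"
    have "int ((c p * diff_mod g x p) mod g) = D mod int g"
      using g by (simp add: diff_mod_def D_def zmod_int mod_simps)
    also have "\<dots> = D - int g * (D div int g)"
      by (simp add: minus_mult_div_eq_mod)
    finally have "real_of_int (int ((c p * diff_mod g x p) mod g)) = real_of_int (D - int g * (D div int g))"
      by (rule arg_cong)
    hence R: "real ((c p * diff_mod g x p) mod g) = real_of_int D - real g * real_of_int (D div int g)"
      by simp
    have "slot (centre g c) p (diff_mod g x p) = 2 * pi * D / g + 2 * pi * of_int (- (D div int g))"
      unfolding slot_centre R using g by (simp add: field_simps)
    hence "\<exists>z::int. slot (centre g c) p (diff_mod g x p) = 2 * pi * D / g + 2 * pi * z" by blast
    thus ?thesis by (simp only: D_def)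
  qed
  then obtain z :: "nat \<times> nat \<Rightarrow> int" where
    z: "\<And>p. slot (centre g c) p (diff_mod g x p) = 2 * pi * (int (c p) * (int (x (fst p)) - int (x (snd p)))) / g + 2 * pi * z p"
    by metis
  have "phase g k (centre g c) x = 2 * pi * (\<Sum>p\<in>pair_idx k. int (c p) * (int (x (fst p)) - int (x (snd p)))) / g + 2 * pi * (\<Sum>p\<in>pair_idx k. z p)"
    unfolding phase_def z by (simp add: sum.distrib sum_distrib_left sum_divide_distrib)
  thus ?thesis by (intro exI[of _ "\<Sum>p\<in>pair_idx k. z p"]) (simp only: of_int_sum)
qed

text \<open>Summation by parts: regrouped by vertices, the exponent is a sum of \<open>x v\<close>
  times the vertex sums of \<open>c\<close>, all of which \<open>g\<close> divides.\<close>

lemma phase_centre_null: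
  assumes g: "g \<ge> 1" and c: "c \<in> null_coeffs g k"
  shows "\<exists>z::int. phase g k (centre g c) x = 2 * pi * z"
proof -
  have "(\<Sum>p\<in>pair_idx k. int (c p) * (int (x (fst p)) - int (x (snd p))))
      = (\<Sum>p\<in>pair_idx k. \<Sum>v=1..k. int (x v) * (int (c p) * incidence v p))"
  proof (rule sum.cong[OF refl])
    fix p assume p: "p \<in> pair_idx k"
    have "(\<Sum>v=1..k. int (x v) * (int (c p) * incidence v p))
        = (\<Sum>v=1..k. (if fst p = v then int (x v) * int (c p) else 0) - (if snd p = v then int (x v) * int (c p) else 0))"
      by (rule sum.cong) (auto simp: incidence_def)
    also have "\<dots> = int (x (fst p)) * int (c p) - int (x (snd p)) * int (c p)"
      using p by (simp add: sum_subtractf sum.delta' pair_idx_def split_def)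
    finally show "int (c p) * (int (x (fst p)) - int (x (snd p))) = (\<Sum>v=1..k. int (x v) * (int (c p) * incidence v p))"
      by (simp add: algebra_simps)
  qed
  also have "\<dots> = (\<Sum>v=1..k. int (x v) * (\<Sum>p\<in>pair_idx k. int (c p) * incidence v p))"
    by (subst sum.swap) (simp add: sum_distrib_left)
  finally have eq: "(\<Sum>p\<in>pair_idx k. int (c p) * (int (x (fst p)) - int (x (snd p))))
      = (\<Sum>v=1..k. int (x v) * (\<Sum>p\<in>pair_idx k. int (c p) * incidence v p))" .
  have "int g dvd (\<Sum>p\<in>pair_idx k. int (c p) * (int (x (fst p)) - int (x (snd p))))"
    unfolding eq by (rule dvd_sum, rule dvd_mult) (use c in \<open>simp add: null_coeffs_def\<close>)
  then obtain m where m: "(\<Sum>p\<in>pair_idx k. int (c p) * (int (x (fst p)) - int (x (snd p)))) = int g * m" by blast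
  obtain z :: int where z: "phase g k (centre g c) x = 2 * pi * real_of_int (\<Sum>p\<in>pair_idx k. int (c p) * (int (x (fst p)) - int (x (snd p)))) / g + 2 * pi * z"
    using phase_centre[OF g, of k c x] by blast
  have "phase g k (centre g c) x = 2 * pi * of_int (m + z)"
    unfolding z m using g by (simp add: field_simps)
  thus ?thesis by blast
qed

text \<open>Mixed second differences of the phase isolate the slot of a single pair.\<close>
lemma slot_approx_hom:
  assumes g: "g \<ge> 1" and p: "p \<in> pair_idx k" and ab: "a < g" "b < g"
    and near: "\<And>x y. x \<in> Zgk g k \<Longrightarrow> y \<in> Zgk g k \<Longrightarrow> near_2pi (e / 2) (phase g k l x - phase g k l y)"
  shows "near_2pi e (slot l p ((a + b) mod g) - slot l p a - slot l p b)"
proof -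
  define X where "X = (\<lambda>A B. \<lambda>v\<in>{1..k}. if v = fst p then A else if v = snd p then B else (0::nat))"
  \<comment> \<open>\<open>b'\<close> represents \<open>- b\<close>: the slot sees the difference of
    the two entries, and \<open>a - b'\<close> has to be \<open>a + b\<close>.\<close>
  define b' where "b' = (g - b) mod g"
  have b': "b' < g" using g by (simp add: b'_def)
  have X: "X A B \<in> Zgk g k" if "A < g" "B < g" for A B
    using that g by (auto simp: X_def Zgk_def)
  define T where "T = (\<lambda>q. slot l q (diff_mod g (X a b') q) - slot l q (diff_mod g (X a 0) q)
      - (slot l q (diff_mod g (X 0 b') q) - slot l q (diff_mod g (X 0 0) q)))"
  have pk: "fst p \<in> {1..k}" "snd p \<in> {1..k}" "fst p \<noteq> snd p" using p by (auto simp: pair_idx_def)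
  have "near_2pi (e / 2 + e / 2) ((phase g k l (X a b') - phase g k l (X a 0)) - (phase g k l (X 0 b') - phase g k l (X 0 0)))"
    using ab b' g by (intro near_2pi_diff near X) auto
  also have "(phase g k l (X a b') - phase g k l (X a 0)) - (phase g k l (X 0 b') - phase g k l (X 0 0)) = (\<Sum>q\<in>pair_idx k. T q)"
    by (simp add: phase_def T_def sum_subtractf)
  also have "(\<Sum>q\<in>pair_idx k. T q) = (\<Sum>q\<in>{p}. T q)"
  proof (rule sum.mono_neutral_right)
    show "\<forall>q\<in>pair_idx k - {p}. T q = 0"
    proof
      fix q assume q: "q \<in> pair_idx k - {p}"
      hence qk: "fst q \<in> {1..k}" "snd q \<in> {1..k}" by (auto simp: pair_idx_def)
      \<comment> \<open>A different pair misses an endpoint of \<open>p\<close>, so its terms ignore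
        one of the two varied entries and cancel in the mixed difference.\<close>
      have "(fst p \<noteq> fst q \<and> fst p \<noteq> snd q) \<or> (snd p \<noteq> fst q \<and> snd p \<noteq> snd q)"
        using p q by (auto simp: pair_idx_def)
      thus "T q = 0"
      proof
        assume "fst p \<noteq> fst q \<and> fst p \<noteq> snd q"
        hence "diff_mod g (X a B) q = diff_mod g (X 0 B) q" for B
          using qk by (simp add: diff_mod_def X_def)
        thus ?thesis by (simp add: T_def)
      next
        assume "snd p \<noteq> fst q \<and> snd p \<noteq> snd q"
        hence "diff_mod g (X A b') q = diff_mod g (X A 0) q" for A
          using qk by (simp add: diff_mod_def X_def)
        thus ?thesis by (simp add: T_def)
      qed
    qed
  qed (use p in auto)
  also have "(\<Sum>q\<in>{p}. T q) = slot l p ((a + b) mod g) - slot l p a - slot l p b"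
  proof -
    have d: "diff_mod g (X A B) p = nat ((int A - int B) mod int g)" for A B
      using pk by (simp add: diff_mod_def X_def)
    have ib: "int b' = (- int b) mod int g"
      using ab by (simp add: b'_def zmod_int of_nat_diff mod_simps)
    have "(int a - int b') mod int g = (int a + int b) mod int g"
      unfolding ib by (simp add: mod_simps)
    hence "diff_mod g (X a b') p = (a + b) mod g"
      unfolding d by (metis nat_int of_nat_add zmod_int)
    moreover have "diff_mod g (X a 0) p = a" using ab by (simp add: d)
    moreover have "(0 - int b') mod int g = int b"
      unfolding ib using ab by (simp add: mod_simps)
    hence "diff_mod g (X 0 b') p = b" by (simp add: d)
    moreover have "diff_mod g (X 0 0) p = 0" by (simp add: d)
    ultimately show ?thesis by (simp add: T_def slot_def[of l p 0])
  qed
  finally show ?thesis by simp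
qed

text \<open>A character near each slot exists pair by pair; the vertex conditions on the
  coefficients come from comparing the zero vector with the unit vector at \<open>v\<close>, whose
  phase at the centre is \<open>2 * pi / g\<close> times the vertex sum, modulo
  \<open>2 * pi\<close>.\<close>

lemma near_centre_of_close_phases:
  fixes e :: real
  assumes g: "g \<ge> 2" and e: "0 < e" "4 * e < 2 * pi" "((k choose 2) * e + e / 2) * g < 2 * pi"
    and near: "\<And>x y. x \<in> Zgk g k \<Longrightarrow> y \<in> Zgk g k \<Longrightarrow> near_2pi (e / 2) (phase g k l x - phase g k l y)"
  shows "\<exists>c\<in>null_coeffs g k. \<forall>i\<in>coord_idx g k. near_2pi e (l i - centre g c i)"
proof -
  have g1: "g \<ge> 1" using g by simp
  have "\<exists>c<g. \<forall>a<g. near_2pi e (slot l p a - 2 * pi * ((c * a) mod g) / g)" if "p \<in> pair_idx k" for p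
    using slot_approx_hom[OF g1 that _ _ near] by (intro approx_hom_cyclic[OF g e(2)]) auto
  then obtain c0 where c0: "\<And>p. p \<in> pair_idx k \<Longrightarrow> c0 p < g"
      "\<And>p a. p \<in> pair_idx k \<Longrightarrow> a < g \<Longrightarrow> near_2pi e (slot l p a - 2 * pi * ((c0 p * a) mod g) / g)"
    by metis
  define c where "c = restrict c0 (pair_idx k)"
  have c: "near_2pi e (slot l p a - slot (centre g c) p a)" if "p \<in> pair_idx k" "a < g" for p a
    unfolding slot_centre using c0(2)[OF that] that by (simp add: c_def)
  have "c \<in> null_coeffs g k"
    unfolding null_coeffs_def
  proof (intro CollectI conjI ballI)
    show "c \<in> PiE (pair_idx k) (\<lambda>_. {..<g})" using c0(1) by (auto simp: c_def)
    fix v assume v: "v \<in> {1..k}"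
    define x where "x = (\<lambda>w\<in>{1..k}. if w = v then 1 else (0::nat))"
    define x0 where "x0 = (\<lambda>w\<in>{1..k}. (0::nat))"
    have Z: "x \<in> Zgk g k" "x0 \<in> Zgk g k" using g by (auto simp: x_def x0_def Zgk_def)
    have "diff_mod g x0 p = 0" if "p \<in> pair_idx k" for p
      using that by (auto simp: diff_mod_def x0_def pair_idx_def)
    hence "phase g k l x0 = 0" by (simp add: phase_def slot_def)
    hence 1: "near_2pi (e / 2) (phase g k l x)" using near[OF Z] by simp
    have "near_2pi (card (pair_idx k) * e) (\<Sum>p\<in>pair_idx k. slot l p (diff_mod g x p) - slot (centre g c) p (diff_mod g x p))"
      using diff_mod_less[OF g1] by (intro near_2pi_sum c) auto
    hence 2: "near_2pi ((k choose 2) * e) (phase g k l x - phase g k (centre g c) x)"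
      by (simp add: phase_def sum_subtractf card_pair_idx)
    define E where "E = (\<Sum>p\<in>pair_idx k. int (c p) * incidence v p)"
    have E: "(\<Sum>p\<in>pair_idx k. int (c p) * (int (x (fst p)) - int (x (snd p)))) = E"
      unfolding E_def by (rule sum.cong) (auto simp: x_def incidence_def pair_idx_def)
    obtain z :: int where z: "phase g k (centre g c) x = 2 * pi * E / g + 2 * pi * z"
      using phase_centre[OF g1, of k c x] unfolding E by blast
    have "near_2pi (e / 2 + (k choose 2) * e) (phase g k (centre g c) x)"
      using near_2pi_diff[OF 1 2] by simp
    hence "near_2pi (e / 2 + (k choose 2) * e) (2 * pi * E / g)" unfolding z near_2pi_shift .
    then obtain n :: int where n: "\<bar>2 * pi * E / g - 2 * pi * n\<bar> \<le> e / 2 + (k choose 2) * e"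
      by (auto simp: near_2pi_def)
    have "2 * pi * E / g - 2 * pi * n = 2 * pi * (E - g * n) / g" using g by (simp add: field_simps)
    hence "2 * pi * \<bar>real_of_int (E - g * n)\<bar> / g \<le> e / 2 + (k choose 2) * e" using n by (simp add: abs_mult)
    hence "2 * pi * \<bar>real_of_int (E - g * n)\<bar> \<le> ((k choose 2) * e + e / 2) * g" using g by (simp add: field_simps)
    \<comment> \<open>The accumulated error is below one grid step \<open>2 * pi / g\<close>, so the
      integer \<open>E\<close> is a multiple of \<open>g\<close>.\<close>
    also note e(3)
    finally have "(2 * pi) * \<bar>real_of_int (E - g * n)\<bar> < (2 * pi) * 1" by linarith
    hence "\<bar>real_of_int (E - g * n)\<bar> < 1" by (rule mult_less_cancel_left_pos[THEN iffD1, rotated]) simp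
    hence "E = g * n" by linarith
    thus "int g dvd (\<Sum>p\<in>pair_idx k. int (c p) * incidence v p)" by (simp add: E_def[symmetric])
  qed
  moreover have "near_2pi e (l i - centre g c i)" if i: "i \<in> coord_idx g k" for i
  proof -
    obtain p a where i_eq: "i = (p, a)" by (rule prod.exhaust)
    have "p \<in> pair_idx k" "a < g" "a \<noteq> 0" using i g by (auto simp: i_eq coord_idx_eq)
    thus ?thesis using c[of p a] by (simp add: slot_def i_eq)
  qed
  ultimately show ?thesis by blast
qed

section \<open>Fourier inversion\<close>

lemma sum_pair_idx_Suc:
  "(\<Sum>p\<in>pair_idx (Suc m). f p) = (\<Sum>p\<in>pair_idx m. f p) + (\<Sum>i=1..m. f (i, Suc m))" for f :: "nat \<times> nat \<Rightarrow> int"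
proof -
  have "(\<Sum>p\<in>pair_idx (Suc m). f p) = (\<Sum>p\<in>pair_idx m. f p) + (\<Sum>p\<in>(\<lambda>i. (i, Suc m)) ` {1..m}. f p)"
    unfolding pair_idx_Suc by (rule sum.union_disjoint) (simp, simp, auto simp: pair_idx_def)
  also have "(\<Sum>p\<in>(\<lambda>i. (i, Suc m)) ` {1..m}. f p) = (\<Sum>i=1..m. f (i, Suc m))"
    by (subst sum.reindex) (auto simp: inj_on_def)
  finally show ?thesis .
qed

lemma vertex_sum_Suc:
  assumes "v \<in> {1..m}"
  shows "(\<Sum>p\<in>pair_idx (Suc m). int (c p) * incidence v p) = (\<Sum>p\<in>pair_idx m. int (c p) * incidence v p) + int (c (v, Suc m))"
proof -
  have "(\<Sum>i=1..m. int (c (i, Suc m)) * incidence v (i, Suc m)) = (\<Sum>i=1..m. if i = v then int (c (i, Suc m)) else 0)"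
    by (rule sum.cong) (use assms in \<open>auto simp: incidence_def\<close>)
  also have "\<dots> = int (c (v, Suc m))" using assms by simp
  finally show ?thesis by (simp only: sum_pair_idx_Suc)
qed

text \<open>Every edge enters once with each sign.\<close>

lemma vertex_sums_total:
  "(\<Sum>v=1..k. \<Sum>p\<in>pair_idx k. int (c p) * incidence v p) = 0"
proof -
  have 0: "(\<Sum>v=1..k. incidence v p) = 0" if "p \<in> pair_idx k" for p
  proof -
    have "fst p \<in> {1..k}" "snd p \<in> {1..k}" using that by (auto simp: pair_idx_def)
    thus ?thesis by (simp add: incidence_def sum_subtractf sum.delta')
  qed
  have "(\<Sum>v=1..k. \<Sum>p\<in>pair_idx k. int (c p) * incidence v p) = (\<Sum>p\<in>pair_idx k. int (c p) * (\<Sum>v=1..k. incidence v p))"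
    unfolding sum_distrib_left by (rule sum.swap)
  also have "\<dots> = 0" by (rule sum.neutral) (intro ballI, simp only: 0 mult_zero_right)
  finally show ?thesis .
qed

text \<open>The coefficients on the pairs inside \<open>{1..m}\<close> are free, the condition at the vertex \<open>v \<le> m\<close> fixes
  the coefficient of \<open>(v, m + 1)\<close>, and the condition at \<open>m + 1\<close> is redundant.\<close>
lemma card_null_coeffs_Suc:
  assumes g: "g \<ge> 1"
  shows "card (null_coeffs g (Suc m)) = g ^ (m choose 2)"
proof -
  let ?r = "\<lambda>c. restrict c (pair_idx m)"
  have sub: "pair_idx m \<subseteq> pair_idx (Suc m)" by (auto simp: pair_idx_def)
  have last: "p \<in> pair_idx m \<or> (\<exists>i\<in>{1..m}. p = (i, Suc m))" if "p \<in> pair_idx (Suc m)" for p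
    using that by (auto simp: pair_idx_Suc)
  have "inj_on ?r (null_coeffs g (Suc m))"
  proof (rule inj_onI)
    fix c d assume c: "c \<in> null_coeffs g (Suc m)" and d: "d \<in> null_coeffs g (Suc m)" and "?r c = ?r d"
    hence eq: "c p = d p" if "p \<in> pair_idx m" for p using that by (metis restrict_apply')
    have eq_last: "c (v, Suc m) = d (v, Suc m)" if v: "v \<in> {1..m}" for v
    proof -
      have "int g dvd (\<Sum>p\<in>pair_idx m. int (c p) * incidence v p) + int (c (v, Suc m))"
        using c v by (simp add: null_coeffs_def vertex_sum_Suc[OF v, symmetric])
      moreover have "int g dvd (\<Sum>p\<in>pair_idx m. int (c p) * incidence v p) + int (d (v, Suc m))"
        using d v by (simp add: null_coeffs_def eq vertex_sum_Suc[OF v, symmetric])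
      ultimately have "int g dvd int (c (v, Suc m)) - int (d (v, Suc m))"
        by (metis add_diff_cancel_left dvd_diff)
      hence "int (c (v, Suc m)) mod int g = int (d (v, Suc m)) mod int g" by (simp add: mod_eq_dvd_iff)
      moreover have "c (v, Suc m) < g" "d (v, Suc m) < g"
        using c d v by (auto simp: null_coeffs_def pair_idx_def PiE_iff)
      ultimately show ?thesis by simp
    qed
    have "c p = d p" if "p \<in> pair_idx (Suc m)" for p using last[OF that] eq eq_last by blast
    thus "c = d" using c d unfolding null_coeffs_def by (auto intro: PiE_ext)
  qed
  moreover have "?r ` null_coeffs g (Suc m) = PiE (pair_idx m) (\<lambda>_. {..<g})"
  proof
    show "?r ` null_coeffs g (Suc m) \<subseteq> PiE (pair_idx m) (\<lambda>_. {..<g})"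
      using sub by (auto simp: null_coeffs_def PiE_iff)
    show "PiE (pair_idx m) (\<lambda>_. {..<g}) \<subseteq> ?r ` null_coeffs g (Suc m)"
    proof
      fix c assume c: "c \<in> PiE (pair_idx m) (\<lambda>_. {..<g})"
      define E where "E = (\<lambda>v. \<Sum>p\<in>pair_idx m. int (c p) * incidence v p)"
      define d where "d = (\<lambda>p\<in>pair_idx (Suc m). if p \<in> pair_idx m then c p else nat ((- E (fst p)) mod int g))"
      have dc: "d p = c p" if "p \<in> pair_idx m" for p using that sub by (auto simp: d_def)
      have dlast: "int (d (v, Suc m)) = (- E v) mod int g" if "v \<in> {1..m}" for v
        using that g by (auto simp: d_def pair_idx_def)
      have 1: "int g dvd (\<Sum>p\<in>pair_idx (Suc m). int (d p) * incidence v p)" if v: "v \<in> {1..m}" for v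
      proof -
        have "(\<Sum>p\<in>pair_idx m. int (d p) * incidence v p) = E v"
          unfolding E_def by (rule sum.cong) (simp_all add: dc)
        thus ?thesis unfolding vertex_sum_Suc[OF v] dlast[OF v] by (simp add: dvd_eq_mod_eq_0 mod_simps)
      qed
      have "(\<Sum>p\<in>pair_idx (Suc m). int (d p) * incidence (Suc m) p)
          = - (\<Sum>v=1..m. \<Sum>p\<in>pair_idx (Suc m). int (d p) * incidence v p)"
      proof -
        have "{1..Suc m} = insert (Suc m) {1..m}" by auto
        hence "(\<Sum>p\<in>pair_idx (Suc m). int (d p) * incidence (Suc m) p)
            + (\<Sum>v=1..m. \<Sum>p\<in>pair_idx (Suc m). int (d p) * incidence v p) = 0"
          using vertex_sums_total[where k="Suc m" and c=d] by simp
        thus ?thesis by linarith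
      qed
      hence "int g dvd (\<Sum>p\<in>pair_idx (Suc m). int (d p) * incidence (Suc m) p)"
        using 1 by (auto intro: dvd_sum)
      hence 2: "int g dvd (\<Sum>p\<in>pair_idx (Suc m). int (d p) * incidence v p)" if "v \<in> {1..Suc m}" for v
        using 1[of v] that by (cases "v = Suc m") auto
      have "d \<in> PiE (pair_idx (Suc m)) (\<lambda>_. {..<g})"
        using c g by (auto simp: d_def PiE_iff nat_less_iff)
      with 2 have "d \<in> null_coeffs g (Suc m)" by (simp add: null_coeffs_def)
      moreover have "c = ?r d" using c dc by (auto simp: fun_eq_iff PiE_iff extensional_def)
      ultimately show "c \<in> ?r ` null_coeffs g (Suc m)" by blast
    qed
  qed
  ultimately have "card (null_coeffs g (Suc m)) = card (PiE (pair_idx m) (\<lambda>_. {..<g}))"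
    by (metis card_image)
  thus ?thesis by (simp add: card_PiE card_pair_idx)
qed

lemma card_null_coeffs: "g \<ge> 1 \<Longrightarrow> k \<ge> 1 \<Longrightarrow> card (null_coeffs g k) = g ^ ((k - 1) choose 2)"
  using card_null_coeffs_Suc[of g "k - 1"] by simp

section \<open>Translation by a centre and the parity condition\<close>

lemma zdot_add: "zdot g k (\<lambda>i\<in>coord_idx g k. l i + m i) x = zdot g k l x + zdot g k m x"
  by (simp add: zdot_def distrib_right sum.distrib)

text \<open>Modulo \<open>g\<close> the inner reductions may be dropped, leaving
  \<open>c * T\<close> times \<open>g * (g - 1) / 2\<close>. For odd \<open>g\<close> the half of
  \<open>g - 1\<close> is an integer; otherwise \<open>T\<close> supplies the missing factor
  2.\<close>

lemma dvd_sum_mod_multiples: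
  fixes g T c :: nat
  assumes g: "g \<ge> 1" and T: "odd g \<or> even T"
  shows "g dvd T * (\<Sum>a=1..g-1. (c * a) mod g)"
proof -
  define S where "S = (\<Sum>a=1..g-1. a)"
  have S2: "2 * S = g * (g - 1)"
    using double_gauss_sum_from_Suc_0[of "g - 1", where 'a=nat] g by (simp add: S_def mult.commute)
  have "g dvd T * S"
  proof (cases "odd g")
    case True
    then obtain r where "g - 1 = 2 * r" by (metis dvdE odd_two_times_div_two_nat)
    hence "S = g * r" using S2 by simp
    thus ?thesis by simp
  next
    case False
    then obtain r where "T = 2 * r" using T by auto
    hence "T * S = r * (2 * S)" by simp
    thus ?thesis using S2 by simp
  qed
  moreover have "(T * (\<Sum>a=1..g-1. (c * a) mod g)) mod g = (T * (\<Sum>a=1..g-1. c * a)) mod g"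
    by (metis mod_mult_right_eq mod_sum_eq)
  moreover have "T * (\<Sum>a=1..g-1. c * a) = c * (T * S)" by (simp add: S_def sum_distrib_left mult_ac)
  ultimately show ?thesis by (metis dvd_mult dvd_imp_mod_0 mod_0_imp_dvd)
qed

text \<open>At a centre the uncentred phase vanishes modulo \<open>2 * pi\<close>, so the
  translation multiplies \<open>phi\<close> by the constant \<open>cis (- S)\<close> due to the
  centring. With \<open>t = g * T\<close>, the number \<open>t * S\<close> is
  \<open>2 * pi / g\<close> times a sum divisible by \<open>g\<close>.\<close>

lemma phi_power_shift_centre:
  assumes g: "g \<ge> 1" and c: "c \<in> null_coeffs g k" and t: "g dvd t" "odd g \<or> even (t div g)"
  shows "phi g k (\<lambda>i\<in>coord_idx g k. l i + centre g c i) ^ t = phi g k l ^ t"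
proof -
  define S where "S = (\<Sum>i\<in>coord_idx g k. centre g c i) / g"
  have 1: "cis (zdot g k (\<lambda>i\<in>coord_idx g k. l i + centre g c i) x) = cis (zdot g k l x) * cis (- S)" for x
  proof -
    obtain z :: int where z: "phase g k (centre g c) x = 2 * pi * z" using phase_centre_null[OF g c] by blast
    have "zdot g k (\<lambda>i\<in>coord_idx g k. l i + centre g c i) x = (zdot g k l x - S) + 2 * pi * of_int z"
      by (simp add: zdot_add zdot_phase[OF g, of k "centre g c"] z S_def)
    thus ?thesis by (simp only: cis_add_int) (simp add: cis_mult)
  qed
  have "phi g k (\<lambda>i\<in>coord_idx g k. l i + centre g c i) = phi g k l * cis (- S)"
    unfolding phi_def 1 by (simp add: sum_distrib_right[symmetric])
  moreover have "cis (- S) ^ t = 1"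
  proof -
    define T where "T = t div g"
    have tT: "t = g * T" using t by (simp add: T_def)
    define W where "W = (\<lambda>p. \<Sum>a=1..g-1. (c p * a) mod g)"
    have "g dvd T * W p" for p unfolding W_def using dvd_sum_mod_multiples[OF g] t by (simp add: T_def)
    hence "g dvd (\<Sum>p\<in>pair_idx k. T * W p)" by (intro dvd_sum)
    then obtain m where m: "(\<Sum>p\<in>pair_idx k. T * W p) = g * m" by blast
    have S: "S * g = 2 * pi / g * (\<Sum>p\<in>pair_idx k. real (W p))"
    proof -
      have "S * g = (\<Sum>p\<in>pair_idx k. \<Sum>a=1..g-1. centre g c (p, a))"
        using g by (simp add: S_def coord_idx_eq sum.cartesian_product split_def)
      also have "\<dots> = 2 * pi / g * (\<Sum>p\<in>pair_idx k. real (W p))"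
        by (simp add: centre_def W_def sum_distrib_left)
      finally show ?thesis .
    qed
    have "real t * S = T * (S * g)" by (simp add: tT)
    also have "\<dots> = 2 * pi / g * real (\<Sum>p\<in>pair_idx k. T * W p)"
      unfolding S by (simp add: sum_distrib_left sum_divide_distrib mult_ac)
    also have "\<dots> = 2 * pi * m" unfolding m using g by simp
    finally have "real t * - S = 0 + 2 * pi * of_int (- int m)" by simp
    hence "cis (real t * - S) = cis 0" by (simp only: cis_add_int)
    thus ?thesis by (simp only: Complex.DeMoivre cis_zero)
  qed
  ultimately show ?thesis by (simp add: power_mult_distrib)
qed

section \<open>The inversion integral for the walk\<close>

lemma integral_cis_int:
  fixes a :: real and m :: int
  shows "(\<integral>x. indicator {a..a + 2 * pi} x *\<^sub>R cis (m * x) \<partial>lborel) = (if m = 0 then 2 * pi else 0)"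
    and "integrable lborel (\<lambda>x. indicator {a..a + 2 * pi} x *\<^sub>R cis (m * x))"
proof -
  define F where "F = (\<lambda>x::real. if m = 0 then of_real x else cis (m * x) / (\<i> * of_int m))"
  have F: "(F has_vector_derivative cis (m * x)) (at x within {a..a + 2 * pi})" for x :: real
  proof (cases "m = 0")
    case True
    have "((\<lambda>x. complex_of_real x) has_vector_derivative 1) (at x within {a..a + 2 * pi})"
      by (auto intro!: derivative_eq_intros)
    thus ?thesis using True by (simp add: F_def)
  next
    case False
    have "((\<lambda>x. cis (m * x) / (\<i> * of_int m)) has_vector_derivative (of_int m * (\<i> * cis (m * x))) / (\<i> * of_int m)) (at x within {a..a + 2 * pi})"
      unfolding has_vector_derivative_def using False
      by (auto intro!: derivative_eq_intros simp: scaleR_conv_of_real field_simps)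
    thus ?thesis using False by (simp add: F_def)
  qed
  have cont: "continuous_on {a..a + 2 * pi} (\<lambda>x. cis (m * x))" by (intro continuous_intros)
  have "cis (m * (a + 2 * pi)) = cis (m * a)"
    using cis_add_int[of "m * a" m] by (simp add: algebra_simps)
  hence "F (a + 2 * pi) - F a = (if m = 0 then 2 * pi else 0)" by (simp add: F_def)
  with has_bochner_integral_FTC_Icc[OF _ F cont]
  have "has_bochner_integral lborel (\<lambda>x. indicator {a..a + 2 * pi} x *\<^sub>R cis (m * x)) (if m = 0 then 2 * pi else 0)"
    by simp
  thus "(\<integral>x. indicator {a..a + 2 * pi} x *\<^sub>R cis (m * x) \<partial>lborel) = (if m = 0 then 2 * pi else 0)"
    and "integrable lborel (\<lambda>x. indicator {a..a + 2 * pi} x *\<^sub>R cis (m * x))"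
    by (auto simp: has_bochner_integral_iff)
qed

lemma measurable_zdot [measurable]: "(\<lambda>l. zdot g k l x) \<in> borel_measurable (PiM (coord_idx g k) (\<lambda>_. lborel))"
  unfolding zdot_def by measurable

lemma measurable_phi [measurable]: "phi g k \<in> borel_measurable (PiM (coord_idx g k) (\<lambda>_. lborel))"
proof -
  have "continuous_on UNIV cis" by (intro continuous_intros)
  hence [measurable]: "cis \<in> borel_measurable borel" by (rule borel_measurable_continuous_onI)
  show ?thesis unfolding phi_def by measurable
qed

lemma norm_phi_le_1: "g \<ge> 1 \<Longrightarrow> norm (phi g k l) \<le> 1"
  using sum_norm_le[of "Zgk g k" "\<lambda>x. cis (zdot g k l x)" "\<lambda>_. 1"]
  by (simp add: phi_def norm_divide norm_power card_Zgk)

text \<open>Because \<open>g\<close> divides \<open>t\<close>, the \<open>t\<close> corrections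
  \<open>- 1 / g\<close> add up to an integer. This lattice property makes \<open>phi ^ t\<close>
  periodic and so permits inversion over a torus.\<close>

lemma Zmap_sum_int:
  assumes "c \<in> coord_idx g k" "g dvd t"
  shows "\<exists>m::int. (\<Sum>s<t. Zmap g k (\<omega> s) c) = m"
proof -
  obtain p a where pa: "c = (p, a)" by (rule prod.exhaust)
  obtain T where T: "t = g * T" using assms by blast
  have g: "g \<ge> 1" using assms by (auto simp: coord_idx_eq)
  have "(\<Sum>s<t. Zmap g k (\<omega> s) c) = (\<Sum>s<t. (if diff_mod g (\<omega> s) p = a then 1 else 0) - 1 / g)"
    using assms by (simp add: pa Zmap_diff_mod)
  also have "\<dots> = of_int ((\<Sum>s<t. if diff_mod g (\<omega> s) p = a then 1 else 0) - int T)"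
    using g by (simp add: sum_subtractf T if_distrib[of of_int] cong: if_cong)
  finally show ?thesis by blast
qed

lemma cis_sum: "cis (\<Sum>a\<in>A. f a) = (\<Prod>a\<in>A. cis (f a))"
  by (induction A rule: infinite_finite_induct) (simp_all add: cis_mult[symmetric])

text \<open>Expanding \<open>phi ^ t\<close> over all sequences of \<open>t\<close> steps gives
  products over the coordinates, and orthogonality of integer frequencies keeps only the paths
  returning to 0. The window may start at any \<open>\<alpha>\<close>, so it can be placed around
  the centres later.\<close>

lemma fourier_inversion_walk:
  fixes g k t :: nat
  assumes g: "g \<ge> 1" and t: "g dvd t"
  defines "I \<equiv> coord_idx g k"
  shows "(\<integral>l. indicator (PiE I (\<lambda>_. {\<alpha>..\<alpha> + 2 * pi})) l *\<^sub>R phi g k l ^ t \<partial>PiM I (\<lambda>_. lborel))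
      = of_real ((2 * pi) ^ card I * pmf (walk_pmf g k t) (\<lambda>_. 0))"
proof -
  let ?L = "PiM I (\<lambda>_. lborel) :: (idx \<Rightarrow> real) measure"
  let ?T = "{\<alpha>..\<alpha> + 2 * pi}"
  define \<Omega> where "\<Omega> = PiE {..<t} (\<lambda>_. Zgk g k)"
  have fin\<Omega>: "finite \<Omega>" unfolding \<Omega>_def by (intro finite_PiE) auto
  have card\<Omega>: "card \<Omega> = (g ^ k) ^ t" by (simp add: \<Omega>_def card_PiE card_Zgk)
  have ne\<Omega>: "\<Omega> \<noteq> {}" using Zgk_nonempty[OF g] by (auto simp: \<Omega>_def PiE_eq_empty_iff)
  define X where "X = (\<lambda>\<omega> c. \<Sum>s<t. Zmap g k (\<omega> s) c)"
  have PiE_dflt: "PiE_dflt {..<t} undefined (\<lambda>_. Zgk g k) = \<Omega>"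
    unfolding \<Omega>_def PiE_dflt_def by (auto simp: PiE_iff extensional_def)
  have "walk_pmf g k t = map_pmf X (pmf_of_set \<Omega>)"
    unfolding walk_pmf_def step_pmf_def X_def
    by (subst Pi_pmf_of_set) (use Zgk_nonempty[OF g] PiE_dflt in auto)
  hence pmf: "pmf (walk_pmf g k t) (\<lambda>_. 0) = card {\<omega> \<in> \<Omega>. X \<omega> = (\<lambda>_. 0)} / card \<Omega>"
    using fin\<Omega> ne\<Omega> by (simp add: pmf_map measure_pmf_of_set vimage_def Int_def)
  have char: "phi g k l ^ t = (\<Sum>\<omega>\<in>\<Omega>. \<Prod>c\<in>I. cis (X \<omega> c * l c)) / of_nat (card \<Omega>)" for l
  proof -
    have "(\<Prod>c\<in>I. cis (X \<omega> c * l c)) = (\<Prod>s<t. cis (zdot g k l (\<omega> s)))" for \<omega>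
    proof -
      have "(\<Prod>c\<in>I. cis (X \<omega> c * l c)) = cis (\<Sum>c\<in>I. X \<omega> c * l c)"
        by (simp add: cis_sum)
      also have "(\<Sum>c\<in>I. X \<omega> c * l c) = (\<Sum>s<t. zdot g k l (\<omega> s))"
        unfolding X_def zdot_def I_def sum_distrib_right by (subst sum.swap) (simp add: mult.commute)
      finally show ?thesis by (simp add: cis_sum)
    qed
    hence "(\<Sum>\<omega>\<in>\<Omega>. \<Prod>c\<in>I. cis (X \<omega> c * l c)) = (\<Sum>x\<in>Zgk g k. cis (zdot g k l x)) ^ t"
      using prod_sum_PiE[of "{..<t}" "\<lambda>_. Zgk g k" "\<lambda>_ x. cis (zdot g k l x)"] by (simp add: \<Omega>_def)
    thus ?thesis by (simp add: phi_def power_divide card\<Omega>)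
  qed
  have one: "(\<integral>l. (\<Prod>c\<in>I. indicator ?T (l c) *\<^sub>R cis (X \<omega> c * l c)) \<partial>?L) = (if X \<omega> = (\<lambda>_. 0) then (2 * pi) ^ card I else 0)"
    and int: "integrable ?L (\<lambda>l. \<Prod>c\<in>I. indicator ?T (l c) *\<^sub>R cis (X \<omega> c * l c))" for \<omega>
  proof -
    have "\<forall>c. \<exists>m::int. c \<in> I \<longrightarrow> X \<omega> c = m"
      using Zmap_sum_int[OF _ t] unfolding X_def I_def by blast
    then obtain m :: "idx \<Rightarrow> int" where m: "\<And>c. c \<in> I \<Longrightarrow> X \<omega> c = m c" by metis
    have int1: "integrable lborel (\<lambda>x. indicator ?T x *\<^sub>R cis (X \<omega> c * x))" if "c \<in> I" for c
      unfolding m[OF that] by (rule integral_cis_int)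
    show "integrable ?L (\<lambda>l. \<Prod>c\<in>I. indicator ?T (l c) *\<^sub>R cis (X \<omega> c * l c))"
      by (rule lebesgue_prod.product_integrable_prod) (auto simp: I_def intro!: int1[unfolded I_def])
    have "(\<integral>l. (\<Prod>c\<in>I. indicator ?T (l c) *\<^sub>R cis (X \<omega> c * l c)) \<partial>?L)
        = (\<Prod>c\<in>I. \<integral>x. indicator ?T x *\<^sub>R cis (X \<omega> c * x) \<partial>lborel)"
      by (rule lebesgue_prod.product_integral_prod) (auto simp: I_def intro!: int1[unfolded I_def])
    also have "\<dots> = (\<Prod>c\<in>I. if X \<omega> c = 0 then complex_of_real (2 * pi) else 0)"
      by (rule prod.cong) (auto simp: m integral_cis_int)
    also have "\<dots> = (if X \<omega> = (\<lambda>_. 0) then (2 * pi) ^ card I else 0)"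
    proof (cases "X \<omega> = (\<lambda>_. 0)")
      case False
      then obtain c where c: "X \<omega> c \<noteq> 0" by (auto simp: fun_eq_iff)
      \<comment> \<open>The walk is zero off the index set, so being the zero function is decided on
        \<open>I\<close>.\<close>
      moreover have "X \<omega> c = 0" if "c \<notin> I" using that by (simp add: X_def Zmap_def I_def)
      ultimately have "c \<in> I" by blast
      with c have "(\<Prod>c\<in>I. if X \<omega> c = 0 then complex_of_real (2 * pi) else 0) = 0"
        by (intro prod_zero) (auto simp: I_def)
      thus ?thesis using False by simp
    qed simp
    finally show "(\<integral>l. (\<Prod>c\<in>I. indicator ?T (l c) *\<^sub>R cis (X \<omega> c * l c)) \<partial>?L) = (if X \<omega> = (\<lambda>_. 0) then (2 * pi) ^ card I else 0)" .
  qed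
  have "(\<integral>l. indicator (PiE I (\<lambda>_. ?T)) l *\<^sub>R phi g k l ^ t \<partial>?L)
      = (\<integral>l. (\<Sum>\<omega>\<in>\<Omega>. \<Prod>c\<in>I. indicator ?T (l c) *\<^sub>R cis (X \<omega> c * l c)) / of_nat (card \<Omega>) \<partial>?L)"
  proof (rule Bochner_Integration.integral_cong[OF refl])
    fix l assume l: "l \<in> space ?L"
    show "indicator (PiE I (\<lambda>_. ?T)) l *\<^sub>R phi g k l ^ t
        = (\<Sum>\<omega>\<in>\<Omega>. \<Prod>c\<in>I. indicator ?T (l c) *\<^sub>R cis (X \<omega> c * l c)) / of_nat (card \<Omega>)"
    proof (cases "l \<in> PiE I (\<lambda>_. ?T)")
      case True
      hence "(\<Prod>c\<in>I. indicator ?T (l c) *\<^sub>R cis (X \<omega> c * l c)) = (\<Prod>c\<in>I. cis (X \<omega> c * l c))" for \<omega>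
        by (intro prod.cong) (auto simp: PiE_iff)
      thus ?thesis using True by (simp add: char)
    next
      case False
      then obtain c where "c \<in> I" "l c \<notin> ?T" using l by (auto simp: space_PiM PiE_iff)
      hence "(\<Prod>c\<in>I. indicator ?T (l c) *\<^sub>R cis (X \<omega> c * l c)) = 0" for \<omega>
        by (intro prod_zero bexI[of _ c]) (auto simp: I_def)
      thus ?thesis using False by simp
    qed
  qed
  also have "\<dots> = (\<Sum>\<omega>\<in>\<Omega>. if X \<omega> = (\<lambda>_. 0) then (2 * pi) ^ card I else 0) / of_nat (card \<Omega>)"
    by (simp add: Bochner_Integration.integral_sum int one)
  also have "(\<Sum>\<omega>\<in>\<Omega>. if X \<omega> = (\<lambda>_. 0) then (2 * pi) ^ card I else 0) = real (card {\<omega> \<in> \<Omega>. X \<omega> = (\<lambda>_. 0)}) * (2 * pi) ^ card I"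
    using fin\<Omega> by (simp add: sum.If_cases Int_def)
  finally show ?thesis by (simp add: pmf)
qed

section \<open>The return probability\<close>

text \<open>\<open>n > 0\<close> matters at \<open>x = 0\<close>, where \<open>0 powr 0\<close> is 0
  but \<open>0 ^ 0\<close> is 1.\<close>

lemma sqrt_power_eq_powr: "x \<ge> 0 \<Longrightarrow> n > 0 \<Longrightarrow> sqrt x ^ n = x powr (real n / 2)"
  by (cases "x = 0") (simp_all add: powr_half_sqrt[symmetric] powr_realpow[symmetric] powr_powr)

locale walk_at_zero =
  fixes g k t :: nat and \<delta> :: real
  assumes g: "g \<ge> 2" and k: "k \<ge> 2" and t: "g dvd t" "odd g \<or> even (t div g)" "t > 0"
    and delta: "0 < \<delta>" "real k ^ 2 * real g * \<delta> \<le> 1 / 10"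
    and t_less: "real t < 2 / (real ((k choose 2) * (g - 1)) * \<delta>) ^ 3"
begin

abbreviation "I \<equiv> coord_idx g k"
abbreviation "L \<equiv> PiM (coord_idx g k) (\<lambda>_. lborel :: real measure)"
abbreviation "C \<equiv> null_coeffs g k"

section \<open>The torus, the boxes around the centres and the remaining region\<close>

definition "d = (k choose 2) * (g - 1)"
definition "\<rho> = real d * \<delta>"
text \<open>Starting the window at \<open>- pi / g\<close> leaves a margin of \<open>pi / g\<close>
  on both sides of the centres, whose coordinates run from 0 to \<open>2 * pi - 2 * pi / g\<close>;
  as \<open>\<delta> < pi / g\<close>, no box wraps around.\<close>

definition "torus = PiE I (\<lambda>_. {- pi / g..- pi / g + 2 * pi})"
definition "centre_box c = PiE I (\<lambda>i. {centre g c i - \<delta>..centre g c i + \<delta>})"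
definition "origin_box = PiE I (\<lambda>_. {- \<delta>..\<delta>})"
definition "rest = torus - (\<Union>c\<in>C. centre_box c)"

lemma g1: "g \<ge> 1" using g by simp

lemma card_I: "card I = d" by (simp add: card_coord_idx d_def)

lemma choose2_pos: "k choose 2 > 0" using k by (simp add: zero_less_binomial)

lemma d_pos: "d > 0" using g choose2_pos by (simp add: d_def)

lemma choose2_le: "2 * real (k choose 2) \<le> real k ^ 2"
proof -
  have "2 * (k choose 2) \<le> k * (k - 1)" by (simp add: choose_two)
  also have "\<dots> \<le> k ^ 2" by (simp add: power2_eq_square)
  finally have "2 * (k choose 2) \<le> k ^ 2" .
  thus ?thesis by (metis of_nat_le_iff of_nat_mult of_nat_numeral of_nat_power)
qed

lemma g_delta: "real g * \<delta> \<le> 1 / 10"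
proof -
  have "1 * (real g * \<delta>) \<le> real k ^ 2 * (real g * \<delta>)"
    using k delta by (intro mult_right_mono) (auto simp: one_le_power)
  thus ?thesis using delta by (simp add: mult.assoc)
qed

lemma choose2_g_delta: "real (k choose 2) * (real g * \<delta>) \<le> 1 / 20"
proof -
  have "(2 * real (k choose 2)) * (real g * \<delta>) \<le> real k ^ 2 * (real g * \<delta>)"
    using choose2_le delta by (intro mult_right_mono) auto
  thus ?thesis using delta by (simp add: mult.assoc)
qed

lemma delta_le: "\<delta> \<le> 1 / 10"
proof -
  have "1 * \<delta> \<le> real g * \<delta>" using g delta by (intro mult_right_mono) auto
  thus ?thesis using g_delta by simp
qed

lemma rho: "0 < \<rho>" "\<rho> \<le> 1"
proof -
  show "0 < \<rho>" using d_pos delta by (simp add: \<rho>_def)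
  have "\<rho> = real (k choose 2) * (real (g - 1) * \<delta>)" by (simp add: \<rho>_def d_def)
  also have "\<dots> \<le> real (k choose 2) * (real g * \<delta>)"
    using delta by (intro mult_left_mono mult_right_mono) auto
  finally show "\<rho> \<le> 1" using choose2_g_delta by simp
qed

lemma delta_less: "\<delta> < pi / g"
  using g_delta g pi_gt3 by (simp add: field_simps)

lemma centre_bounds: "0 \<le> centre g c i" "centre g c i \<le> 2 * pi - 2 * pi / g"
proof -
  obtain p a where i: "i = (p, a)" by (rule prod.exhaust)
  show "0 \<le> centre g c i" by (simp add: centre_def i)
  have "(c p * a) mod g < g" using g by simp
  hence "(c p * a) mod g \<le> g - 1" by simp
  hence "2 * pi * real ((c p * a) mod g) / g \<le> 2 * pi * real (g - 1) / g"
    by (intro divide_right_mono mult_left_mono) auto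
  also have "\<dots> = 2 * pi - 2 * pi / g" using g by (simp add: field_simps of_nat_diff)
  finally show "centre g c i \<le> 2 * pi - 2 * pi / g" by (simp add: centre_def i)
qed

lemma centre_box_subset_torus: "centre_box c \<subseteq> torus"
proof
  fix l assume l: "l \<in> centre_box c"
  have "l i \<in> {- pi / g..- pi / g + 2 * pi}" if "i \<in> I" for i
  proof -
    have "l i \<in> {centre g c i - \<delta>..centre g c i + \<delta>}" using l that by (auto simp: centre_box_def PiE_iff)
    thus ?thesis using centre_bounds[of c i] delta_less by auto
  qed
  thus "l \<in> torus" using l by (auto simp: centre_box_def torus_def PiE_iff)
qed

text \<open>Within the window, \<open>u\<close> and the centre differ by at most
  \<open>2 * pi - pi / g\<close>, so closeness modulo \<open>2 * pi\<close> with an error below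
  \<open>pi / g\<close> is genuine closeness.\<close>

lemma near_centre_in_torus:
  assumes u: "u \<in> {- pi / g..- pi / g + 2 * pi}" and near: "near_2pi \<delta> (u - centre g c i)"
  shows "u \<in> {centre g c i - \<delta>..centre g c i + \<delta>}"
proof -
  obtain n :: int where n: "\<bar>u - centre g c i - 2 * pi * n\<bar> \<le> \<delta>" using near by (auto simp: near_2pi_def)
  have 1: "- (2 * pi) + pi / g \<le> u - centre g c i" "u - centre g c i \<le> 2 * pi - pi / g"
    using u centre_bounds[of c i] by auto
  have n_less: "2 * pi * n < 2 * pi * 1" and n_greater: "2 * pi * (- 1) < 2 * pi * n"
    using abs_le_D1[OF n] abs_le_D2[OF n] 1 delta_less by linarith+
  have "0 < 2 * pi" by simp
  note cancel = mult_less_cancel_left_pos[OF this, THEN iffD1]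
  have "n = 0" using cancel[OF n_less] cancel[OF n_greater] by linarith
  thus ?thesis using n by (auto simp: abs_le_iff)
qed

lemma norm_phi_rest:
  assumes l: "l \<in> rest"
  shows "norm (phi g k l) \<le> exp (- (11/192) * \<delta>\<^sup>2 / real g ^ k)"
proof -
  have lT: "l \<in> torus" using l by (simp add: rest_def)
  have "\<exists>x\<in>Zgk g k. \<exists>y\<in>Zgk g k. \<not> near_2pi (\<delta> / 2) (phase g k l x - phase g k l y)"
  proof (rule ccontr)
    assume "\<not> ?thesis"
    hence near: "near_2pi (\<delta> / 2) (phase g k l x - phase g k l y)" if "x \<in> Zgk g k" "y \<in> Zgk g k" for x y
      using that by blast
    have "4 * \<delta> < 2 * pi" using delta_le pi_gt3 by linarith
    moreover have "(real (k choose 2) * \<delta> + \<delta> / 2) * g = real (k choose 2) * (real g * \<delta>) + real g * \<delta> / 2"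
      by (simp add: algebra_simps)
    hence "(real (k choose 2) * \<delta> + \<delta> / 2) * g < 2 * pi"
      using choose2_g_delta g_delta pi_gt3 by linarith
    ultimately obtain c where c: "c \<in> C" "\<forall>i\<in>I. near_2pi \<delta> (l i - centre g c i)"
      using near_centre_of_close_phases[OF g delta(1) _ _ near] by blast
    have "l \<in> centre_box c"
      using lT c(2) near_centre_in_torus[of "l _" c] by (auto simp: torus_def centre_box_def PiE_iff)
    thus False using l c(1) by (auto simp: rest_def)
  qed
  thus ?thesis
    using norm_phi_le_of_distant_phases[OF g1 delta(1)] delta_le by auto
qed

lemma finite_C: "finite C"
  by (rule finite_subset[of _ "PiE (pair_idx k) (\<lambda>_. {..<g})"]) (auto simp: null_coeffs_def intro: finite_PiE)

text \<open>The coordinate with residue 1 reads off \<open>c p\<close>, and different values of it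
  are at least \<open>2 * pi / g > 2 * \<delta>\<close> apart.\<close>

lemma box_disjoint:
  assumes "c \<in> C" "c' \<in> C" "l \<in> centre_box c" "l \<in> centre_box c'"
  shows "c = c'"
proof -
  have "c p = c' p" if p: "p \<in> pair_idx k" for p
  proof -
    have i: "(p, 1) \<in> I" using p g by (auto simp: coord_idx_eq)
    have lt: "c p < g" "c' p < g" using assms p by (auto simp: null_coeffs_def PiE_iff)
    hence e: "centre g c (p, 1) = 2 * pi / g * real (c p)" "centre g c' (p, 1) = 2 * pi / g * real (c' p)"
      by (simp_all add: centre_def)
    have "\<bar>centre g c (p, 1) - centre g c' (p, 1)\<bar> \<le> 2 * \<delta>"
      using assms(3,4) i by (auto simp: centre_box_def PiE_iff abs_le_iff dest!: bspec[of _ _ "(p, 1)"])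
    also have "\<dots> < 2 * pi / g" using delta_less by simp
    finally have "\<bar>2 * pi / g * (real (c p) - real (c' p))\<bar> < 2 * pi / g"
      by (simp only: e right_diff_distrib)
    moreover have "0 \<le> 2 * pi / g" by simp
    ultimately have "2 * pi / g * \<bar>real (c p) - real (c' p)\<bar> < 2 * pi / g * 1"
      by (simp only: abs_mult abs_of_nonneg mult_1_right)
    hence "\<bar>real (c p) - real (c' p)\<bar> < 1"
      by (rule mult_less_cancel_left_pos[THEN iffD1, rotated]) (use g in simp)
    thus ?thesis by linarith
  qed
  thus ?thesis using assms unfolding null_coeffs_def by (auto intro: PiE_ext)
qed

lemma sets_L [measurable]: "torus \<in> sets L" "centre_box c \<in> sets L" "origin_box \<in> sets L"
  unfolding torus_def centre_box_def origin_box_def by (auto intro!: sets_PiM_I_finite)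

lemma sets_rest [measurable]: "rest \<in> sets L"
  unfolding rest_def using finite_C by (intro sets.Diff sets.finite_UN sets_L) auto

lemma emeasure_torus: "emeasure L torus = ennreal ((2 * pi) ^ d)"
  unfolding torus_def by (subst lebesgue_prod.emeasure_PiM) (auto simp: card_I ennreal_power)

lemma origin_box_subset_torus: "origin_box \<subseteq> torus"
proof -
  have "- \<delta> \<ge> - pi / g" "\<delta> \<le> - pi / g + 2 * pi"
  proof -
    show "- \<delta> \<ge> - pi / g" using delta_less by simp
    have "pi / g \<le> pi / 1" using g by (intro divide_left_mono) auto
    thus "\<delta> \<le> - pi / g + 2 * pi" using delta_less by simp
  qed
  thus ?thesis unfolding origin_box_def torus_def by (intro PiE_mono) auto
qed

section \<open>Splitting the inversion integral into the centre boxes and the rest\<close>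

lemma integrable_phi_power:
  assumes S [measurable]: "S \<in> sets L" and "S \<subseteq> torus"
  shows "integrable L (\<lambda>l. indicator S l *\<^sub>R phi g k l ^ t)"
proof (rule Bochner_Integration.integrable_bound)
  have "emeasure L S \<le> emeasure L torus" using assms by (intro emeasure_mono) auto
  hence "emeasure L S < \<infinity>" unfolding emeasure_torus by (simp add: le_less_trans)
  thus "integrable L (indicator S :: _ \<Rightarrow> real)" using S by (simp add: integrable_indicator_iff)
  show "AE l in L. norm (indicator S l *\<^sub>R phi g k l ^ t) \<le> norm (indicator S l :: real)"
    using norm_phi_le_1[OF g1] by (auto simp: norm_power indicator_def power_le_one)
qed measurable

lemma integral_centre_box:
  assumes c: "c \<in> C"
  shows "(\<integral>l. indicator (centre_box c) l *\<^sub>R phi g k l ^ t \<partial>L) = (\<integral>l. indicator origin_box l *\<^sub>R phi g k l ^ t \<partial>L)"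
proof -
  let ?s = "\<lambda>l. \<lambda>i\<in>I. l i + centre g c i"
  have "(\<integral>l. indicator (centre_box c) l *\<^sub>R phi g k l ^ t \<partial>L) = (\<integral>l. indicator (centre_box c) l *\<^sub>R phi g k l ^ t \<partial>distr L L ?s)"
    by (simp add: distr_PiM_lborel_shift)
  also have "\<dots> = (\<integral>l. indicator (centre_box c) (?s l) *\<^sub>R phi g k (?s l) ^ t \<partial>L)"
    by (rule integral_distr) measurable
  also have "\<dots> = (\<integral>l. indicator origin_box l *\<^sub>R phi g k l ^ t \<partial>L)"
  proof (rule Bochner_Integration.integral_cong[OF refl])
    fix l assume "l \<in> space L"
    hence "?s l \<in> centre_box c \<longleftrightarrow> l \<in> origin_box"
      by (auto simp: centre_box_def origin_box_def space_PiM PiE_iff)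
    thus "indicator (centre_box c) (?s l) *\<^sub>R phi g k (?s l) ^ t = indicator origin_box l *\<^sub>R phi g k l ^ t"
      using phi_power_shift_centre[OF g1 c t(1,2)] by (simp add: indicator_def)
  qed
  finally show ?thesis .
qed

definition "main = (\<integral>l. indicator origin_box l *\<^sub>R phi g k l ^ t \<partial>L)"
definition "error = (\<integral>l. indicator rest l *\<^sub>R phi g k l ^ t \<partial>L)"

lemma pmf_decomposition:
  "of_real ((2 * pi) ^ d * pmf (walk_pmf g k t) (\<lambda>_. 0)) = of_nat (g ^ ((k - 1) choose 2)) * main + error"
proof -
  have "of_real ((2 * pi) ^ d * pmf (walk_pmf g k t) (\<lambda>_. 0)) = (\<integral>l. indicator torus l *\<^sub>R phi g k l ^ t \<partial>L)"
    using fourier_inversion_walk[OF g1 t(1), where \<alpha>="- pi / g" and k=k] by (simp add: torus_def card_I)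
  also have "\<dots> = (\<integral>l. (\<Sum>c\<in>C. indicator (centre_box c) l *\<^sub>R phi g k l ^ t) + indicator rest l *\<^sub>R phi g k l ^ t \<partial>L)"
  proof (rule Bochner_Integration.integral_cong[OF refl])
    fix l
    have "indicator torus l = (\<Sum>c\<in>C. indicator (centre_box c) l :: real) + indicator rest l"
    proof (cases "\<exists>c\<in>C. l \<in> centre_box c")
      case True
      then obtain c where c: "c \<in> C" "l \<in> centre_box c" by blast
      have "(\<Sum>c'\<in>C. indicator (centre_box c') l :: real) = (\<Sum>c'\<in>C. if c' = c then 1 else 0)"
        using box_disjoint c by (intro sum.cong) (auto simp: indicator_def)
      also have "\<dots> = 1" using finite_C c by simp
      finally show ?thesis using c centre_box_subset_torus by (auto simp: indicator_def rest_def)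
    next
      case False
      hence "(\<Sum>c\<in>C. indicator (centre_box c) l :: real) = 0" by (intro sum.neutral) auto
      thus ?thesis using False by (auto simp: indicator_def rest_def)
    qed
    thus "indicator torus l *\<^sub>R phi g k l ^ t = (\<Sum>c\<in>C. indicator (centre_box c) l *\<^sub>R phi g k l ^ t) + indicator rest l *\<^sub>R phi g k l ^ t"
      by (simp add: scaleR_left_distrib scaleR_sum_left)
  qed
  also have "\<dots> = (\<Sum>c\<in>C. \<integral>l. indicator (centre_box c) l *\<^sub>R phi g k l ^ t \<partial>L) + error"
    unfolding error_def using integrable_phi_power[OF sets_L(2) centre_box_subset_torus]
      integrable_phi_power[OF sets_rest] by (simp add: rest_def Bochner_Integration.integral_add Bochner_Integration.integral_sum)
  also have "(\<Sum>c\<in>C. \<integral>l. indicator (centre_box c) l *\<^sub>R phi g k l ^ t \<partial>L) = of_nat (card C) * main"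
    by (simp add: integral_centre_box main_def)
  also have "card C = g ^ ((k - 1) choose 2)" using k by (intro card_null_coeffs[OF g1]) simp
  finally show ?thesis .
qed

lemma norm_error: "norm error \<le> (2 * pi) ^ d * exp (- (11/192) * real t * \<delta>\<^sup>2 / real g ^ k)"
proof -
  let ?e = "exp (- (11/192) * real t * \<delta>\<^sup>2 / real g ^ k)"
  have m: "measure L torus = (2 * pi) ^ d" by (simp add: measure_def emeasure_torus)
  have "norm error \<le> (\<integral>l. norm (indicator rest l *\<^sub>R phi g k l ^ t) \<partial>L)"
    unfolding error_def by (rule integral_norm_bound)
  also have "\<dots> \<le> (\<integral>l. ?e * indicator torus l \<partial>L)"
  proof (rule integral_mono)
    show "integrable L (\<lambda>l. norm (indicator rest l *\<^sub>R phi g k l ^ t))"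
      by (intro integrable_norm integrable_phi_power sets_rest) (auto simp: rest_def)
    have "emeasure L torus < \<infinity>" by (simp add: emeasure_torus)
    thus "integrable L (\<lambda>l. ?e * indicator torus l)"
      by (intro integrable_mult_right) (simp add: integrable_indicator_iff)
    fix l
    show "norm (indicator rest l *\<^sub>R phi g k l ^ t) \<le> ?e * indicator torus l"
    proof (cases "l \<in> rest")
      case True
      have "norm (phi g k l) ^ t \<le> exp (- (11/192) * \<delta>\<^sup>2 / real g ^ k) ^ t"
        using norm_phi_rest[OF True] by (intro power_mono) auto
      also have "\<dots> = ?e" by (simp add: exp_of_nat_mult[symmetric])
      finally show ?thesis using True by (simp add: norm_power rest_def)
    qed simp
  qed
  also have "\<dots> = (2 * pi) ^ d * ?e" by (simp add: m)
  finally show ?thesis .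
qed

section \<open>Comparison with a Gaussian on the box at the origin\<close>

definition "gauss = (\<integral>l. indicator origin_box l * exp (- real t / 2 * Mform g k l) \<partial>L)"

lemma measurable_Mform [measurable]: "Mform g k \<in> borel_measurable L"
  unfolding Mform_def by measurable

lemma near_origin_of_origin_box:
  assumes "l \<in> origin_box"
  shows "near_origin g k \<delta> \<rho> l"
proof
  fix i assume "i \<in> I"
  thus "\<bar>l i\<bar> \<le> \<delta>" using assms by (auto simp: origin_box_def PiE_iff abs_le_iff minus_le_iff)
qed (use g1 rho in \<open>auto simp: \<rho>_def d_def\<close>)

lemma integrable_gauss: "integrable L (\<lambda>l. indicator origin_box l * exp (- real t / 2 * Mform g k l))"
proof (rule Bochner_Integration.integrable_bound)
  have "emeasure L origin_box \<le> emeasure L torus" using origin_box_subset_torus by (intro emeasure_mono) auto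
  hence "emeasure L origin_box < \<infinity>" unfolding emeasure_torus by (simp add: le_less_trans)
  thus "integrable L (indicator origin_box :: _ \<Rightarrow> real)" by (simp add: integrable_indicator_iff)
  show "AE l in L. norm (indicator origin_box l * exp (- real t / 2 * Mform g k l)) \<le> norm (indicator origin_box l :: real)"
  proof (rule AE_I2)
    fix l
    show "norm (indicator origin_box l * exp (- real t / 2 * Mform g k l)) \<le> norm (indicator origin_box l :: real)"
      using near_origin.q_bounds(1)[OF near_origin_of_origin_box, of l] by (auto simp: indicator_def)
  qed
qed measurable

lemma gauss_nn: "(\<integral>\<^sup>+l. ennreal (indicator origin_box l * exp (- real t / 2 * Mform g k l)) \<partial>L) = ennreal gauss"
  unfolding gauss_def by (rule nn_integral_eq_integral[OF integrable_gauss]) auto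

lemma gauss_nonneg: "gauss \<ge> 0"
  unfolding gauss_def by (rule Bochner_Integration.integral_nonneg) auto

definition "upper_factor = (1 + \<rho> ^ 6 / 4) powr (real t / 2) * (1 + \<rho> ^ 4 / 3) ^ t"
definition "lower_factor = (1 + (real t)\<^sup>2 * \<rho> ^ 6) powr (- 1 / 2) * (1 - \<rho> ^ 4 / 3) ^ t"

lemma norm_main_le: "norm main \<le> upper_factor * gauss"
proof -
  have "norm main \<le> (\<integral>l. norm (indicator origin_box l *\<^sub>R phi g k l ^ t) \<partial>L)"
    unfolding main_def by (rule integral_norm_bound)
  also have "\<dots> \<le> (\<integral>l. upper_factor * (indicator origin_box l * exp (- real t / 2 * Mform g k l)) \<partial>L)"
  proof (rule integral_mono)
    show "integrable L (\<lambda>l. norm (indicator origin_box l *\<^sub>R phi g k l ^ t))"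
      by (intro integrable_norm integrable_phi_power sets_L origin_box_subset_torus)
    show "integrable L (\<lambda>l. upper_factor * (indicator origin_box l * exp (- real t / 2 * Mform g k l)))"
      by (intro integrable_mult_right integrable_gauss)
    fix l
    show "norm (indicator origin_box l *\<^sub>R phi g k l ^ t) \<le> upper_factor * (indicator origin_box l * exp (- real t / 2 * Mform g k l))"
      using near_origin.norm_phi_power_le[OF near_origin_of_origin_box, of l t]
      by (auto simp: indicator_def upper_factor_def)
  qed
  also have "\<dots> = upper_factor * gauss" by (simp add: gauss_def)
  finally show ?thesis .
qed

text \<open>The real part is bounded below rather than the modulus, since the mere size of
  \<open>phi ^ t\<close> would not exclude cancellation in the integral.\<close>

lemma Re_main_ge: "Re main \<ge> lower_factor * gauss"
proof -
  have int: "integrable L (\<lambda>l. indicator origin_box l *\<^sub>R phi g k l ^ t)"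
    by (intro integrable_phi_power sets_L origin_box_subset_torus)
  have "lower_factor * gauss = (\<integral>l. lower_factor * (indicator origin_box l * exp (- real t / 2 * Mform g k l)) \<partial>L)"
    by (simp add: gauss_def)
  also have "\<dots> \<le> (\<integral>l. Re (indicator origin_box l *\<^sub>R phi g k l ^ t) \<partial>L)"
  proof (rule integral_mono)
    show "integrable L (\<lambda>l. Re (indicator origin_box l *\<^sub>R phi g k l ^ t))" using int by (rule integrable_Re)
    show "integrable L (\<lambda>l. lower_factor * (indicator origin_box l * exp (- real t / 2 * Mform g k l)))"
      by (intro integrable_mult_right integrable_gauss)
    fix l
    show "lower_factor * (indicator origin_box l * exp (- real t / 2 * Mform g k l)) \<le> Re (indicator origin_box l *\<^sub>R phi g k l ^ t)"
    proof (cases "l \<in> origin_box")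
      case True
      have "real t < 2 / \<rho> ^ 3" using t_less by (simp only: \<rho>_def d_def)
      from near_origin.Re_phi_power_ge[OF near_origin_of_origin_box[OF True] this] True
      show ?thesis by (simp add: lower_factor_def)
    qed simp
  qed
  also have "\<dots> = Re main" unfolding main_def by (rule integral_Re[OF int])
  finally show ?thesis .
qed

text \<open>Each dimension contributes
  \<open>sqrt (2 * pi / t) / (2 * pi) = 1 / sqrt (2 * pi * t)\<close>; the powers of
  \<open>g\<close> collect the inverse determinant of \<open>P\<close> and the number of
  centres.\<close>

lemma normalisation:
  assumes "0 \<le> e" "e \<le> 1"
  shows "real g ^ ((k - 1) choose 2) * (sqrt (2 * pi / t * (1 - e)) ^ d * sqrt g ^ (g * (k choose 2))) / (2 * pi) ^ d
    = real g powr (real g / 2 * real (k choose 2) + real ((k - 1) choose 2)) / sqrt ((2 * pi * real t) ^ d) * (1 - e) powr (real d / 2)"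
proof -
  have "sqrt (2 * pi / t * (1 - e)) ^ d = sqrt (2 * pi / t) ^ d * (1 - e) powr (real d / 2)"
    unfolding real_sqrt_mult power_mult_distrib using assms d_pos by (simp only: sqrt_power_eq_powr diff_ge_0_iff_ge)
  moreover have "sqrt (2 * pi / t) ^ d / (2 * pi) ^ d = 1 / sqrt ((2 * pi * real t) ^ d)"
  proof -
    have "sqrt (2 * pi / t) / (2 * pi) = 1 / sqrt (2 * pi * t)"
    proof -
      have "sqrt (2 * pi / t) * sqrt (2 * pi * t) = 2 * pi"
      proof -
        have "2 * pi / t * (2 * pi * t) = (2 * pi)\<^sup>2" using t by (simp add: power2_eq_square)
        thus ?thesis by (simp only: real_sqrt_mult[symmetric] real_sqrt_abs) simp
      qed
      thus ?thesis using t by (simp add: field_simps)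
    qed
    hence "(sqrt (2 * pi / t) / (2 * pi)) ^ d = (1 / sqrt (2 * pi * t)) ^ d" by simp
    thus ?thesis by (simp add: power_divide real_sqrt_power)
  qed
  moreover have "real g powr (real g / 2 * real (k choose 2) + real ((k - 1) choose 2))
      = sqrt g ^ (g * (k choose 2)) * real g ^ ((k - 1) choose 2)"
    using g choose2_pos by (simp add: powr_add powr_realpow sqrt_power_eq_powr)
  ultimately show ?thesis by (simp add: field_simps)
qed

section \<open>Assembling the two bounds\<close>

lemma pmf_le:
  "pmf (walk_pmf g k t) (\<lambda>_. 0) \<le> real g ^ ((k - 1) choose 2) * (upper_factor * gauss) / (2 * pi) ^ d
     + exp (- (11/192) * real t * \<delta>\<^sup>2 / real g ^ k)"
proof -
  have "(2 * pi) ^ d * pmf (walk_pmf g k t) (\<lambda>_. 0) = Re (of_nat (g ^ ((k - 1) choose 2)) * main + error)"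
    by (simp only: pmf_decomposition[symmetric] Re_complex_of_real)
  also have "\<dots> = real g ^ ((k - 1) choose 2) * Re main + Re error"
    by (simp del: of_nat_power)
  also have "\<dots> \<le> real g ^ ((k - 1) choose 2) * (upper_factor * gauss) + (2 * pi) ^ d * exp (- (11/192) * real t * \<delta>\<^sup>2 / real g ^ k)"
    using order_trans[OF complex_Re_le_cmod norm_main_le] order_trans[OF complex_Re_le_cmod norm_error]
    by (intro add_mono mult_left_mono) auto
  finally show ?thesis by (simp add: field_simps)
qed

lemma pmf_ge:
  "pmf (walk_pmf g k t) (\<lambda>_. 0) \<ge> real g ^ ((k - 1) choose 2) * (lower_factor * gauss) / (2 * pi) ^ d
     - exp (- (11/192) * real t * \<delta>\<^sup>2 / real g ^ k)"
proof -
  have "real g ^ ((k - 1) choose 2) * (lower_factor * gauss) - (2 * pi) ^ d * exp (- (11/192) * real t * \<delta>\<^sup>2 / real g ^ k)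
      \<le> real g ^ ((k - 1) choose 2) * Re main + Re error"
  proof -
    have "- Re error \<le> norm error" using abs_Re_le_cmod[of error] by linarith
    hence "- Re error \<le> (2 * pi) ^ d * exp (- (11/192) * real t * \<delta>\<^sup>2 / real g ^ k)"
      using norm_error by linarith
    moreover have "real g ^ ((k - 1) choose 2) * (lower_factor * gauss) \<le> real g ^ ((k - 1) choose 2) * Re main"
      using Re_main_ge by (intro mult_left_mono) auto
    ultimately show ?thesis by linarith
  qed
  also have "\<dots> = Re (of_nat (g ^ ((k - 1) choose 2)) * main + error)"
    by (simp del: of_nat_power)
  also have "\<dots> = (2 * pi) ^ d * pmf (walk_pmf g k t) (\<lambda>_. 0)"
    by (simp only: pmf_decomposition[symmetric] Re_complex_of_real)
  finally show ?thesis by (simp add: field_simps)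
qed

context
  fixes P D1 D2
  assumes D: "D1 > 0" "D2 > 0"
    and sym: "\<forall>c\<in>I. \<forall>c'\<in>I. P c c' = P c' c"
    and root: "\<forall>c\<in>I. \<forall>c'\<in>I. (\<Sum>e\<in>I. P c e * P e c') = Mmat g c c'"
    and D1: "\<And>\<delta> v. \<delta> > 0 \<Longrightarrow> \<forall>c\<in>I. \<bar>v c\<bar> \<le> D1 * \<delta> \<Longrightarrow>
           \<exists>\<mu>. (\<forall>c\<in>I. \<bar>\<mu> c\<bar> \<le> \<delta>) \<and> (\<forall>c\<in>I. v c = (\<Sum>e\<in>I. P c e * \<mu> e))"
    and D2: "\<And>\<delta> \<mu>. \<delta> > 0 \<Longrightarrow> \<forall>c\<in>I. \<bar>\<mu> c\<bar> \<le> \<delta> \<Longrightarrow> \<forall>c\<in>I. \<bar>\<Sum>e\<in>I. P c e * \<mu> e\<bar> \<le> D2 * \<delta>"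
begin

lemma root_matrix_P: "root_matrix g k P"
proof
  show "\<exists>w. \<forall>c\<in>I. y c = (\<Sum>e\<in>I. P c e * w e)" for y
  proof -
    \<comment> \<open>Scaling the cube until it contains \<open>y\<close> turns the lower cube
      inclusion into surjectivity of \<open>P\<close>; the summand 1 keeps \<open>s\<close> positive
      even for \<open>y = 0\<close>.\<close>
    define s where "s = (1 + (\<Sum>c\<in>I. \<bar>y c\<bar>)) / D1"
    have "s > 0" using D by (auto simp: s_def intro!: divide_pos_pos add_pos_nonneg sum_nonneg)
    moreover have "\<bar>y c\<bar> \<le> D1 * s" if "c \<in> I" for c
      using D member_le_sum[OF that, of "\<lambda>c. \<bar>y c\<bar>"] by (simp add: s_def)
    ultimately show ?thesis using D1[of s y] by blast
  qed
qed (use g1 sym root in auto)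

lemma gauss_upper: "gauss \<le> sqrt (2 * pi / t * (1 - exp (- real t * (D2 * \<delta>)\<^sup>2))) ^ d * sqrt g ^ (g * (k choose 2))"
proof -
  have "ennreal gauss \<le> ennreal (sqrt (2 * pi / t * (1 - exp (- real t * (D2 * \<delta>)\<^sup>2))) ^ d * sqrt g ^ (g * (k choose 2)))"
    unfolding gauss_nn[symmetric] origin_box_def d_def
    by (rule root_matrix.box_gaussian_upper[OF root_matrix_P]) (use D D2 delta t in auto)
  thus ?thesis by (subst (asm) ennreal_le_iff) (use t in auto)
qed

lemma gauss_lower: "gauss \<ge> sqrt (2 * pi / t * (1 - exp (- real t / 2 * (D1 * \<delta>)\<^sup>2))) ^ d * sqrt g ^ (g * (k choose 2))"
proof -
  have "ennreal gauss \<ge> ennreal (sqrt (2 * pi / t * (1 - exp (- real t / 2 * (D1 * \<delta>)\<^sup>2))) ^ d * sqrt g ^ (g * (k choose 2)))"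
    unfolding gauss_nn[symmetric] origin_box_def d_def
    by (rule root_matrix.box_gaussian_lower[OF root_matrix_P]) (use D D1 delta t in auto)
  thus ?thesis using gauss_nonneg by (simp add: ennreal_le_iff)
qed

lemma pmf_upper:
  "pmf (walk_pmf g k t) (\<lambda>_. 0) \<le>
     real g powr (real g / 2 * real (k choose 2) + real ((k - 1) choose 2))
       / sqrt ((2 * pi * real t) ^ d) * Ufun (real d) D2 t \<delta>
     + exp (- (11/192) * real t * \<delta>\<^sup>2 / real g ^ k)"
proof -
  define e where "e = exp (- real t * (D2 * \<delta>)\<^sup>2)"
  have e: "0 \<le> e" "e \<le> 1" by (auto simp: e_def)
  have "real g ^ ((k - 1) choose 2) * (upper_factor * gauss) / (2 * pi) ^ d
      \<le> real g ^ ((k - 1) choose 2) * (upper_factor * (sqrt (2 * pi / t * (1 - e)) ^ d * sqrt g ^ (g * (k choose 2)))) / (2 * pi) ^ d"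
    using gauss_upper rho by (intro divide_right_mono mult_left_mono) (auto simp: upper_factor_def e_def)
  also have "\<dots> = upper_factor * (real g ^ ((k - 1) choose 2) * (sqrt (2 * pi / t * (1 - e)) ^ d * sqrt g ^ (g * (k choose 2))) / (2 * pi) ^ d)"
    by (simp add: mult_ac)
  also have "\<dots> = real g powr (real g / 2 * real (k choose 2) + real ((k - 1) choose 2))
       / sqrt ((2 * pi * real t) ^ d) * Ufun (real d) D2 t \<delta>"
    unfolding normalisation[OF e] by (simp add: Ufun_def upper_factor_def \<rho>_def e_def mult_ac)
  finally show ?thesis using pmf_le by linarith
qed

lemma pmf_lower:
  "pmf (walk_pmf g k t) (\<lambda>_. 0) \<ge>
     real g powr (real g / 2 * real (k choose 2) + real ((k - 1) choose 2))
       / sqrt ((2 * pi * real t) ^ d) * Lfun (real d) D1 t \<delta>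
     - exp (- (11/192) * real t * \<delta>\<^sup>2 / real g ^ k)"
proof -
  define e where "e = exp (- (real t / 2) * (D1 * \<delta>)\<^sup>2)"
  have e: "0 \<le> e" "e \<le> 1" by (auto simp: e_def)
  have "\<rho> ^ 4 \<le> 1" using rho by (simp add: power_le_one)
  hence "0 \<le> lower_factor" by (simp add: lower_factor_def)
  hence "real g ^ ((k - 1) choose 2) * (lower_factor * (sqrt (2 * pi / t * (1 - e)) ^ d * sqrt g ^ (g * (k choose 2)))) / (2 * pi) ^ d
      \<le> real g ^ ((k - 1) choose 2) * (lower_factor * gauss) / (2 * pi) ^ d"
    using gauss_lower by (intro divide_right_mono mult_left_mono) (auto simp: e_def)
  moreover have "real g ^ ((k - 1) choose 2) * (lower_factor * (sqrt (2 * pi / t * (1 - e)) ^ d * sqrt g ^ (g * (k choose 2)))) / (2 * pi) ^ d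
      = lower_factor * (real g ^ ((k - 1) choose 2) * (sqrt (2 * pi / t * (1 - e)) ^ d * sqrt g ^ (g * (k choose 2))) / (2 * pi) ^ d)"
    by (simp add: mult_ac)
  moreover have "\<dots> = real g powr (real g / 2 * real (k choose 2) + real ((k - 1) choose 2))
       / sqrt ((2 * pi * real t) ^ d) * Lfun (real d) D1 t \<delta>"
    unfolding normalisation[OF e] by (simp add: Lfun_def lower_factor_def \<rho>_def e_def mult_ac)
  ultimately show ?thesis using pmf_ge by linarith
qed

end

end

text \<open>The constant 1/10 is 8/5 divided by 16, a lower bound for \<open>g ^ (k + 2)\<close>;
  the remaining factor \<open>g\<close> stays with \<open>\<delta>\<close>.\<close>

lemma small_delta:
  fixes g k :: nat and \<delta> :: real
  assumes "g \<ge> 2" "k \<ge> 2" "0 < \<delta>" "\<delta> < 8/5 / (real g ^ (k + 3) * real k ^ 2)"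
  shows "real k ^ 2 * real g * \<delta> \<le> 1 / 10"
proof -
  have pos: "0 < real g ^ (k + 3) * real k ^ 2" using assms by simp
  have "\<delta> * (real g ^ (k + 3) * real k ^ 2) < 8/5"
    using assms(4) pos by (simp add: pos_less_divide_eq)
  moreover have "real g ^ (k + 3) = real g ^ (k + 2) * real g" by (simp add: power_add eval_nat_numeral)
  ultimately have 1: "real g ^ (k + 2) * (real k ^ 2 * real g * \<delta>) < 8/5" by (simp add: mult_ac)
  have "(16::real) = 2 ^ 4" by simp
  also have "\<dots> \<le> real g ^ 4" using assms by (intro power_mono) auto
  also have "\<dots> \<le> real g ^ (k + 2)" using assms by (intro power_increasing) auto
  finally have "16 * (real k ^ 2 * real g * \<delta>) \<le> real g ^ (k + 2) * (real k ^ 2 * real g * \<delta>)"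
    using assms by (intro mult_right_mono) auto
  thus ?thesis using 1 by simp
qed

theorem theorem5p4:
  fixes g k t :: nat and D1 D2 \<delta> :: real
  defines "d \<equiv> (k choose 2) * (g - 1)"
  assumes "g \<ge> 2" and "k \<ge> 2"
    and "good_consts g k D1 D2"
    and "0 < \<delta>" and "\<delta> < 8/5 / (real g ^ (k + 3) * real k ^ 2)"
    and "t > 0" and "g dvd t" and "real t < 2 / (real d * \<delta>) ^ 3"
    and "odd g \<or> (even g \<and> even (t div g))"
  shows "pmf (walk_pmf g k t) (\<lambda>_. 0) \<le>
           real g powr (real g / 2 * real (k choose 2) + real ((k - 1) choose 2))
             / sqrt ((2 * pi * real t) ^ d) * Ufun (real d) D2 t \<delta>
           + exp (- (11/192) * real t * \<delta>^2 / real g ^ k)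
       \<and> pmf (walk_pmf g k t) (\<lambda>_. 0) \<ge>
           real g powr (real g / 2 * real (k choose 2) + real ((k - 1) choose 2))
             / sqrt ((2 * pi * real t) ^ d) * Lfun (real d) D1 t \<delta>
           - exp (- (11/192) * real t * \<delta>^2 / real g ^ k)"
proof -
  interpret walk_at_zero g k t \<delta>
    using assms small_delta[of g k \<delta>] by unfold_locales auto
  have D: "D1 > 0" "D2 > 0" using \<open>good_consts g k D1 D2\<close> by (simp_all add: good_consts_def)
  obtain P where P: "\<forall>c\<in>I. \<forall>c'\<in>I. P c c' = P c' c"
      "\<forall>c\<in>I. \<forall>c'\<in>I. (\<Sum>e\<in>I. P c e * P e c') = Mmat g c c'"
    and cube: "\<forall>\<delta>>0. (\<forall>v. (\<forall>c\<in>I. \<bar>v c\<bar> \<le> D1 * \<delta>) \<longrightarrow>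
           (\<exists>\<mu>. (\<forall>c\<in>I. \<bar>\<mu> c\<bar> \<le> \<delta>) \<and> (\<forall>c\<in>I. v c = (\<Sum>e\<in>I. P c e * \<mu> e)))) \<and>
        (\<forall>\<mu>. (\<forall>c\<in>I. \<bar>\<mu> c\<bar> \<le> \<delta>) \<longrightarrow> (\<forall>c\<in>I. \<bar>\<Sum>e\<in>I. P c e * \<mu> e\<bar> \<le> D2 * \<delta>))"
    using \<open>good_consts g k D1 D2\<close> unfolding good_consts_def by blast
  have cube1: "\<exists>\<mu>. (\<forall>c\<in>I. \<bar>\<mu> c\<bar> \<le> \<delta>) \<and> (\<forall>c\<in>I. v c = (\<Sum>e\<in>I. P c e * \<mu> e))"
    if "\<delta> > 0" "\<forall>c\<in>I. \<bar>v c\<bar> \<le> D1 * \<delta>" for \<delta> v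
    using cube that by blast
  have cube2: "\<forall>c\<in>I. \<bar>\<Sum>e\<in>I. P c e * \<mu> e\<bar> \<le> D2 * \<delta>"
    if "\<delta> > 0" "\<forall>c\<in>I. \<bar>\<mu> c\<bar> \<le> \<delta>" for \<delta> \<mu>
    using cube that by blast
  show ?thesis
    using pmf_upper[OF D P cube1 cube2] pmf_lower[OF D P cube1 cube2] by (simp only: d_def assms(1))
qed

end
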